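(* Let $n_r\ge n\ge1$ and let $H_1,H_2,\dots$ be independent random matrices in $M_{n_r\times n}(\mathbb{C})$ whose entries are i.i.d. circularly symmetric complex Gaussian with mean $0$ and variance $1$ per complex dimension; let $H$ denote a random matrix with this distribution. Let $L_{n,k}\subset M_{n\times nk}(\mathbb{C})$ be a family of $2n^2k$-dimensional lattices (with $k\to\infty$) such that, for some constant $C_L>0$ independent of $k$, $\det_{\min}(L_{n,k})=1$ and $\mathrm{Vol}(L_{n,k})^{\frac1{n^2k}}\le C_L$. Then, for power constraint $P>0$, over the $(n,n_r,k)$-multiblock channel with fading $\{H_i\}$ the codes built from $L_{n,k}$ achieve any rate $$R<\mathbb{E}_H\left[\log\det\frac Pn H^\dagger H\right]-n\log C_L+n\log\frac{\pi e}{4n},$$ where $$\mathbb{E}_H\left[\log\det\frac Pn H^\dagger H\right]=n\log\left(\frac Pn\, e^{\frac1n\sum_{i=n_r-n+1}^{n_r}\psi(i)}\right).$$ Moreover, for any such rate the error probability vanishes exponentially fast as $k\to\infty$.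
   Context: $\log$ is the base-2 logarithm, $\ln$ the natural one; $\psi(x)=\frac{d}{dx}\ln\Gamma(x)$ is the Digamma function. $\|\cdot\|$ is the Frobenius norm. Channel: in the $(n,n_r,k)$-multiblock channel a codeword $X=(X_1,\dots,X_k)\in M_{n\times nk}(\mathbb{C})$, $X_i\in M_n(\mathbb{C})$, is received as $Y_i=H_iX_i+W_i$, $i=1,\dots,k$, where the entries of the $W_i\in M_{n_r\times n}(\mathbb{C})$ are i.i.d. circularly symmetric complex Gaussian with mean $0$ and variance $1$ per complex dimension, independent of the $H_i$ and of $X$. The receiver (not the transmitter) knows $H_1,\dots,H_k$ and decodes after all $k$ blocks. Lattices: $M_{n\times nk}(\mathbb{C})$ is a $2n^2k$-dimensional real space with inner product $\langle X,Y\rangle=\Re(\mathrm{Tr}(XY^\dagger))$. A lattice is the $\mathbb{Z}$-span of $\mathbb{R}$-linearly independent matrices; its dimension is the number of these; $\mathrm{Vol}(L)$ is the square root of the determinant of the Gram matrix of a basis. For $X=(X_1,\dots,X_k)$ put $\mathrm{pdet}(X)=\prod_{i=1}^k\det(X_i)$ and $\det_{\min}(L)=\inf_{X\in L\setminus\{0\}}|\mathrm{pdet}(X)|$. The index $k$ ranges over some infinite set of positive integers. Codes: given $P>0$ and a rate $R$, let $C_{n,k}=\frac{(\pi nk)^{n^2k}}{(n^2k)!}$ and $\alpha>0$ be given by $\alpha^2=\frac{C_{n,k}^{1/(n^2k)}P}{2^{R/n}\mathrm{Vol}(L_{n,k})^{1/(n^2k)}}$. Let $B(r)$ be the set of matrices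 in $M_{n\times nk}(\mathbb{C})$ of Frobenius norm at most $r$. The code is $\mathcal{C}=B(\sqrt{Pkn})\cap(X_R+\alpha L_{n,k})$, where the shift $X_R\in M_{n\times nk}(\mathbb{C})$ is chosen so that $|\mathcal{C}|\ge 2^{Rnk}$ (such a shift exists). Thus every codeword satisfies $\frac1{nk}\|X\|^2\le P$, and the rate is at least $R$ bits per complex channel use. Decoding: the decoder is either maximum likelihood (minimize $\sum_{i=1}^k\|Y_i-H_iX_i'\|^2$ over $X'\in\mathcal{C}$) or naive lattice decoding (minimize the same quantity over the whole shifted lattice $X_R+\alpha L_{n,k}$). The error probability $P_e$ is the probability that the output differs from the transmitted codeword (uniform in $\mathcal{C}$). A rate $R$ is achieved if $P_e\to0$ as $k\to\infty$; it vanishes exponentially fast if $P_e\le Ae^{-ak}$ for some constants $A,a>0$ and all large $k$. *)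

theory Defs
  imports "HOL-Probability.Probability" "Jordan_Normal_Form.Determinant"
begin

no_notation Matrix.vec_index (infixl \<open>$\<close> 100)
no_notation Matrix.scalar_prod (infix \<open>\<bullet>\<close> 70)
hide_const (open) Matrix.mat Determinant.det Matrix.vec Matrix.row Matrix.rows Matrix.transpose_mat

text \<open>
  A matrix in \<open>M\<^bsub>n\<times>nk\<^esub>(\<complex>)\<close> is given by its blocks \<open>X 0, \<dots>, X (k - 1)\<close>, with the value \<open>0\<close> at
  all other indices so that equality of functions is equality of matrices.
  The channel matrices are of type \<open>complex^'n^'r\<close>, with \<open>n = CARD('n)\<close> columns and
  \<open>n\<^sub>r = CARD('r)\<close> rows.
\<close>

type_synonym 'n multiblock = "nat \<Rightarrow> complex^'n^'n"

definition multiblocks :: "nat \<Rightarrow> ('n::finite) multiblock set" where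
  "multiblocks k = {X. \<forall>i\<ge>k. X i = 0}"

definition ctranspose :: "complex^'m^'n \<Rightarrow> complex^'n^'m" where
  "ctranspose A = (\<chi> i j. cnj (A $ j $ i))"

definition mb_inner :: "nat \<Rightarrow> ('n::finite) multiblock \<Rightarrow> 'n multiblock \<Rightarrow> real" where
  "mb_inner k X Y = (\<Sum>i<k. Re (trace (X i ** ctranspose (Y i))))"

definition mb_norm :: "nat \<Rightarrow> ('n::finite) multiblock \<Rightarrow> real" where
  "mb_norm k X = sqrt (mb_inner k X X)"

definition pdet :: "nat \<Rightarrow> ('n::finite) multiblock \<Rightarrow> complex" where
  "pdet k X = (\<Prod>i<k. det (X i))"

definition lattice_basis ::
    "nat \<Rightarrow> nat \<Rightarrow> (nat \<Rightarrow> ('n::finite) multiblock) \<Rightarrow> 'n multiblock set \<Rightarrow> bool" where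
  "lattice_basis k d b L \<longleftrightarrow>
     (\<forall>j<d. b j \<in> multiblocks k) \<and>
     (\<forall>c::nat \<Rightarrow> real. (\<forall>i. (\<Sum>j<d. c j *\<^sub>R b j i) = 0) \<longrightarrow> (\<forall>j<d. c j = 0)) \<and>
     L = {X. \<exists>z::nat \<Rightarrow> int. X = (\<lambda>i. \<Sum>j<d. of_int (z j) *\<^sub>R b j i)}"

definition is_lattice :: "nat \<Rightarrow> nat \<Rightarrow> ('n::finite) multiblock set \<Rightarrow> bool" where
  "is_lattice k d L \<longleftrightarrow> (\<exists>b. lattice_basis k d b L)"

text \<open>The Gram determinant does not depend on the chosen basis.\<close>

definition lattice_vol :: "nat \<Rightarrow> nat \<Rightarrow> ('n::finite) multiblock set \<Rightarrow> real" where
  "lattice_vol k d L =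
     (let b = (SOME b. lattice_basis k d b L)
      in sqrt (Determinant.det (Matrix.mat d d (\<lambda>(i, j). mb_inner k (b i) (b j)))))"

definition det_min :: "nat \<Rightarrow> ('n::finite) multiblock set \<Rightarrow> real" where
  "det_min k L = (INF X\<in>L - {\<lambda>_. 0}. cmod (pdet k X))"

definition log_det_gram :: "real \<Rightarrow> complex^'n^'r \<Rightarrow> real" where
  "log_det_gram P A = log 2 (Re (det ((P / real CARD('n)) *\<^sub>R (ctranspose A ** A))))"

definition code_const :: "nat \<Rightarrow> nat \<Rightarrow> real" where
  "code_const n k = (pi * real n * real k) ^ (n\<^sup>2 * k) / fact (n\<^sup>2 * k)"

definition code_scale :: "real \<Rightarrow> real \<Rightarrow> nat \<Rightarrow> ('n::finite) multiblock set \<Rightarrow> real" where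
  "code_scale P R k L =
     (let n = CARD('n); N = n\<^sup>2 * k
      in sqrt (code_const n k powr (1 / real N) * P /
               (2 powr (R / real n) * lattice_vol k (2 * N) L powr (1 / real N))))"

definition shifted_lattice ::
    "real \<Rightarrow> real \<Rightarrow> nat \<Rightarrow> ('n::finite) multiblock set \<Rightarrow> 'n multiblock \<Rightarrow> 'n multiblock set" where
  "shifted_lattice P R k L S = (\<lambda>X i. S i + code_scale P R k L *\<^sub>R X i) ` L"

definition lattice_code ::
    "real \<Rightarrow> real \<Rightarrow> nat \<Rightarrow> ('n::finite) multiblock set \<Rightarrow> 'n multiblock \<Rightarrow> 'n multiblock set" where
  "lattice_code P R k L S =
     {X \<in> multiblocks k. mb_norm k X \<le> sqrt (P * real k * real CARD('n))} \<inter> shifted_lattice P R k L S"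

text \<open>
  As \<open>card\<close> is \<open>0\<close> on infinite sets, the inequality forces the code to be finite and nonempty.
\<close>

definition admissible_shift ::
    "real \<Rightarrow> real \<Rightarrow> nat \<Rightarrow> ('n::finite) multiblock set \<Rightarrow> 'n multiblock \<Rightarrow> bool" where
  "admissible_shift P R k L S \<longleftrightarrow>
     S \<in> multiblocks k \<and> real (card (lattice_code P R k L S)) \<ge> 2 powr (R * real CARD('n) * real k)"

text \<open>Variance \<open>1\<close> per complex dimension means variance \<open>1/2\<close> for each of the real and imaginary parts.\<close>

definition std_complex_gaussian :: "'w measure \<Rightarrow> ('w \<Rightarrow> complex) \<Rightarrow> bool" where
  "std_complex_gaussian M Z \<longleftrightarrow>
     distributed M lborel (\<lambda>\<omega>. Re (Z \<omega>)) (\<lambda>x. ennreal (normal_density 0 (sqrt (1/2)) x)) \<and>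
     distributed M lborel (\<lambda>\<omega>. Im (Z \<omega>)) (\<lambda>x. ennreal (normal_density 0 (sqrt (1/2)) x)) \<and>
     prob_space.indep_var M borel (\<lambda>\<omega>. Re (Z \<omega>)) borel (\<lambda>\<omega>. Im (Z \<omega>))"

definition iid_gaussian :: "'w measure \<Rightarrow> ('i \<Rightarrow> 'w \<Rightarrow> complex) \<Rightarrow> bool" where
  "iid_gaussian M Z \<longleftrightarrow>
     prob_space.indep_vars M (\<lambda>_. borel) Z UNIV \<and> (\<forall>i. std_complex_gaussian M (Z i))"

abbreviation block_space :: "nat \<Rightarrow> (nat \<Rightarrow> complex^'n^'r) measure" where
  "block_space k \<equiv> PiM {..<k} (\<lambda>_. borel)"

definition decoding_metric ::
    "nat \<Rightarrow> (nat \<Rightarrow> complex^'n^'r) \<Rightarrow> (nat \<Rightarrow> complex^'n^'r) \<Rightarrow> ('n::finite) multiblock \<Rightarrow> real" where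
  "decoding_metric k H Y X = (\<Sum>i<k. (norm (Y i - H i ** X i))\<^sup>2)"

text \<open>
  The library norm on \<open>complex^'n^'r\<close> is the Frobenius norm. Ties are broken arbitrarily, and
  when no minimizer over an infinite set \<open>A\<close> exists (which requires some \<open>H i\<close> to be rank deficient)
  the output is an arbitrary element of \<open>A\<close>.
\<close>

definition min_distance_decoder ::
    "nat \<Rightarrow> ('n::finite) multiblock set \<Rightarrow>
     ((nat \<Rightarrow> complex^'n^'r) \<times> (nat \<Rightarrow> complex^'n^'r) \<Rightarrow> 'n multiblock) \<Rightarrow> bool" where
  "min_distance_decoder k A D \<longleftrightarrow>
     D \<in> block_space k \<Otimes>\<^sub>M block_space k \<rightarrow>\<^sub>M count_space A \<and>
     (\<forall>(H, Y)\<in>space (block_space k \<Otimes>\<^sub>M block_space k).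
        (\<exists>X. is_arg_min (decoding_metric k H Y) (\<lambda>X. X \<in> A) X) \<longrightarrow>
        is_arg_min (decoding_metric k H Y) (\<lambda>X. X \<in> A) (D (H, Y)))"

text \<open>
  The transmitted codeword is the first component of a point of the product space; it is uniform
  on \<open>C\<close> and independent of the fading \<open>H\<close> and the noise \<open>W\<close>, which live on \<open>M\<close>.
\<close>

definition error_prob ::
    "'w measure \<Rightarrow> (nat \<Rightarrow> 'w \<Rightarrow> complex^'n^'r) \<Rightarrow> (nat \<Rightarrow> 'w \<Rightarrow> complex^'n^'r) \<Rightarrow> nat \<Rightarrow>
     ('n::finite) multiblock set \<Rightarrow>
     ((nat \<Rightarrow> complex^'n^'r) \<times> (nat \<Rightarrow> complex^'n^'r) \<Rightarrow> 'n multiblock) \<Rightarrow> real" where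
  "error_prob M H W k C D =
     measure (uniform_count_measure C \<Otimes>\<^sub>M M)
       {(X, \<omega>) \<in> C \<times> space M.
          D (\<lambda>i\<in>{..<k}. H i \<omega>, \<lambda>i\<in>{..<k}. H i \<omega> ** X i + W i \<omega>) \<noteq> X}"

definition vanishes_along :: "nat set \<Rightarrow> (nat \<Rightarrow> real) \<Rightarrow> bool" where
  "vanishes_along K p \<longleftrightarrow> (p \<longlongrightarrow> 0) (inf at_top (principal K))"

definition vanishes_exponentially_along :: "nat set \<Rightarrow> (nat \<Rightarrow> real) \<Rightarrow> bool" where
  "vanishes_exponentially_along K p \<longleftrightarrow>
     (\<exists>A>0. \<exists>a>0. \<forall>\<^sub>F k in inf at_top (principal K). p k \<le> A * exp (- a * real k))"

end

theory Submission
  imports Defs "HOL-Real_Asymp.Real_Asymp"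
begin

text \<open>
  If the decoder errs, some \<open>Z \<noteq> 0\<close> in the scaled lattice satisfies
  \<open>\<parallel>HZ\<parallel>\<^sup>2 \<le> 2 \<langle>HZ, W\<rangle> = 2 \<langle>HZ, QW\<rangle>\<close>, where \<open>Q\<close> projects each
  noise block onto the space of the matrices \<open>H\<^sub>i Z\<^sub>i\<close>; hence
  \<open>\<parallel>HZ\<parallel>\<^sup>2 \<le> 4 \<parallel>QW\<parallel>\<^sup>2\<close>. By Hadamard's inequality and AM-GM,
  \<open>\<parallel>HZ\<parallel>\<^sup>2\<close> is at least \<open>nk \<alpha>\<^sup>2\<close> times the geometric mean of the
  \<open>det (H\<^sub>i\<^sup>\<dagger> H\<^sub>i)\<^sup>1\<^sup>/\<^sup>n\<close>. Given \<open>H\<close>, \<open>\<parallel>QW\<parallel>\<^sup>2\<close> has moment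
  generating function \<open>(1 - t) powr (-n\<^sup>2k)\<close>, since only \<open>n\<^sup>2k\<close> complex noise dimensions survive
  the projection, and the logarithms of \<open>det (H\<^sub>i\<^sup>\<dagger> H\<^sub>i)\<close> are i.i.d. Two Chernoff bounds give
  the exponential decay.

  Adding one column at a time shows that \<open>det (H\<^sup>\<dagger> H)\<close> has negative moments
  \<open>\<Prod>i<n. \<Gamma> (n\<^sub>r - i - u) / \<Gamma> (n\<^sub>r - i)\<close>, whose derivative at \<open>u = 0\<close> is minus the sum
  of Digamma values. The shifts exist because the average number of points of a shifted lattice in
  a ball is the quotient of the volumes.
\<close>

text \<open>The lower bound on the norm of HZ is uniform over all nonzero lattice points, so a
  single event in (H, W), mentioning neither the codeword nor the decoder, covers every error. Hence
  maximum likelihood and naive lattice decoding, and all admissible shifts, share one estimate. The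
  projection keeps the number of receive antennas out of the last term of the rate: the full noise
  has \<open>CARD('r) * n * k\<close> complex dimensions, and using it would replace pi e / (4 n) by
  pi e / (4 \<open>CARD('r)\<close>). Origin of the rate: by Stirling, alpha^2 is asymptotically at
  least (pi e / n) P / (2^(R/n) C_L). The geometric mean of the n-th roots of the determinants
  concentrates at e^(psi/n), where psi is the sum of the Digamma values. The mean of the squared
  norm of QW is n^2 k, and Cauchy-Schwarz costs the factor 4. The requirement n k alpha^2 e^(psi/n)
  / 4 > n^2 k is then the condition on R, with Stirling's value in place of alpha^2.\<close>

section \<open>Gaussian vectors\<close>

text \<open>
  The Laplace transform below is the only property of a standard Gaussian vector (variance \<open>1/2\<close>
  per real coordinate) that is ever used.
\<close>

definition gauss_vec :: "'a::euclidean_space measure \<Rightarrow> bool" where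
  "gauss_vec \<mu> \<longleftrightarrow> prob_space \<mu> \<and> sets \<mu> = sets borel \<and>
     (\<forall>v a. a \<ge> 0 \<longrightarrow> (\<integral>\<^sup>+x. ennreal (exp (2 * (v \<bullet> x) - a * (norm x)\<^sup>2)) \<partial>\<mu>) =
        ennreal ((1 + a) powr (- (real DIM('a) / 2)) * exp ((norm v)\<^sup>2 / (1 + a))))"

abbreviation half_normal :: "real measure" where
  "half_normal \<equiv> density lborel (\<lambda>x. ennreal (normal_density 0 (sqrt (1/2)) x))"

lemma prob_space_half_normal: "prob_space half_normal"
  by (rule prob_space_normal_density) simp

text \<open>Completing the square leaves a constant times the normal density with mean
  \<open>c / s\<close> and variance \<open>1 / (2 * s)\<close>, where \<open>s = 1 + a\<close>. The
  range of \<open>a\<close> reaches down to -1 because the averaging variable introduced below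
  carries the coefficient \<open>- b / (1 + a)\<close>.\<close>

lemma half_normal_exp_quadratic:
  fixes a c :: real
  assumes "a > -1"
  shows "(\<integral>\<^sup>+x. ennreal (exp (2 * c * x - a * x\<^sup>2)) \<partial>half_normal) =
     ennreal ((1 + a) powr (- (1/2)) * exp (c\<^sup>2 / (1 + a)))"
proof -
  define s where "s = 1 + a"
  have s: "s > 0" using assms by (simp add: s_def)
  let ?K = "s powr (- (1/2)) * exp (c\<^sup>2 / s)"
  have *: "normal_density 0 (sqrt (1/2)) x * exp (2 * c * x - a * x\<^sup>2) =
      ?K * normal_density (c / s) (1 / sqrt (2 * s)) x" for x
  proof -
    have e: "- x\<^sup>2 + (2 * c * x - a * x\<^sup>2) = c\<^sup>2 / s + (- (x - c / s)\<^sup>2 / (2 * (1 / sqrt (2 * s))\<^sup>2))"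
    proof -
      have "2 * (1 / sqrt (2 * s))\<^sup>2 = 1 / s" using s by (simp add: power_divide)
      moreover have "- (x - c / s)\<^sup>2 / (1 / s) = - s * x\<^sup>2 + 2 * c * x - c\<^sup>2 / s"
        using s by (simp add: power2_eq_square field_simps)
      ultimately show ?thesis by (simp add: s_def algebra_simps)
    qed
    have "sqrt (2 * pi * (1 / sqrt (2 * s))\<^sup>2) = sqrt pi / sqrt s"
      using s by (simp add: power_divide real_sqrt_divide)
    moreover have "s powr (- (1/2)) = 1 / sqrt s"
      using s by (simp add: powr_minus powr_half_sqrt field_simps)
    moreover have "normal_density 0 (sqrt (1/2)) x * exp (2 * c * x - a * x\<^sup>2)
      = 1 / sqrt pi * exp (- x\<^sup>2 + (2 * c * x - a * x\<^sup>2))"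
      by (simp add: normal_density_def power_divide mult_exp_exp)
    ultimately show ?thesis
      unfolding e exp_add normal_density_def using s by simp
  qed
  interpret N: prob_space "density lborel (\<lambda>x. ennreal (normal_density (c / s) (1 / sqrt (2 * s)) x))"
    using s by (intro prob_space_normal_density) simp
  have "(\<integral>\<^sup>+x. ennreal (exp (2 * c * x - a * x\<^sup>2)) \<partial>half_normal) =
     (\<integral>\<^sup>+x. ennreal ?K * ennreal (normal_density (c / s) (1 / sqrt (2 * s)) x) \<partial>lborel)"
    by (subst nn_integral_density) (auto simp: * ennreal_mult[symmetric])
  also have "\<dots> = ennreal ?K * (\<integral>\<^sup>+x. ennreal (normal_density (c / s) (1 / sqrt (2 * s)) x) \<partial>lborel)"
    by (rule nn_integral_cmult) simp
  also have "(\<integral>\<^sup>+x. ennreal (normal_density (c / s) (1 / sqrt (2 * s)) x) \<partial>lborel) = 1"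
    using N.emeasure_space_1 by (simp add: emeasure_density)
  finally show ?thesis by (simp add: s_def)
qed

text \<open>
  Induction over \<open>B\<close>: \<open>exp (b y\<^sup>2)\<close> is the average of \<open>exp (2 sqrt b g y)\<close> over a real Gaussian
  \<open>g\<close> of variance \<open>1/2\<close>, so Fubini turns a quadratic term into a shift of the linear one. This
  replaces rotation invariance.
\<close>

lemma gauss_vec_exp_quadratic:
  fixes \<mu> :: "'a::euclidean_space measure"
  assumes g: "gauss_vec \<mu>" and a: "a \<ge> 0" and b: "0 \<le> b" "b < 1 + a"
    and B: "finite B" "\<And>u. u \<in> B \<Longrightarrow> norm u = 1" "pairwise Linear_Algebra.orthogonal B"
  shows "(\<integral>\<^sup>+x. ennreal (exp (2 * (v \<bullet> x) - a * (norm x)\<^sup>2 + b * (\<Sum>u\<in>B. (u \<bullet> x)\<^sup>2))) \<partial>\<mu>) =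
     ennreal ((1 + a) powr (- (real DIM('a) / 2)) * (1 - b / (1 + a)) powr (- (real (card B) / 2)) *
       exp (((norm v)\<^sup>2 + b / (1 + a - b) * (\<Sum>u\<in>B. (u \<bullet> v)\<^sup>2)) / (1 + a)))"
  using B
proof (induction B arbitrary: v rule: finite_induct)
  case empty
  have "1 - b / (1 + a) \<noteq> 0" using a b by (simp add: field_simps)
  then show ?case using g a by (simp add: gauss_vec_def)
next
  case (insert u B v)
  interpret \<mu>: prob_space \<mu> using g by (simp add: gauss_vec_def)
  interpret N: prob_space half_normal by (rule prob_space_half_normal)
  interpret P: pair_sigma_finite \<mu> half_normal ..
  have [measurable_cong]: "sets \<mu> = sets borel" using g by (simp add: gauss_vec_def)
  define K where "K = (1 + a) powr (- (real DIM('a) / 2)) * (1 - b / (1 + a)) powr (- (real (card B) / 2))"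
  define \<beta> where "\<beta> = b / (1 + a - b)"
  define S where "S v = (\<Sum>u\<in>B. (u \<bullet> v)\<^sup>2)" for v
  have u: "norm u = 1" "u \<bullet> u = 1" using insert.prems(1)[of u] by (auto simp: dot_square_norm)
  have orth: "w \<bullet> u = 0" if "w \<in> B" for w
    using insert.prems(2) insert.hyps(2) that by (auto simp: pairwise_def Linear_Algebra.orthogonal_def)
  have IH: "(\<integral>\<^sup>+x. ennreal (exp (2 * (v \<bullet> x) - a * (norm x)\<^sup>2 + b * S x)) \<partial>\<mu>) =
     ennreal (K * exp (((norm v)\<^sup>2 + \<beta> * S v) / (1 + a)))" for v
    unfolding K_def \<beta>_def S_def using insert.prems
    by (intro insert.IH) (auto simp: pairwise_insert)
  \<comment> \<open>Moving \<open>v\<close> along \<open>u\<close> leaves its coordinates along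
    \<open>B\<close> alone, so after the induction hypothesis the averaging variable enters only
    through the norm of \<open>v\<close>.\<close>
  have Su: "S (v + s *\<^sub>R u) = S v" for s
    unfolding S_def by (intro sum.cong) (auto simp: inner_add_right orth)
  have nu: "(norm (v + s *\<^sub>R u))\<^sup>2 = (norm v)\<^sup>2 + 2 * s * (u \<bullet> v) + s\<^sup>2" for s
    unfolding power2_norm_eq_inner inner_add_left inner_add_right inner_scaleR_left inner_scaleR_right u(2)
    by (simp add: inner_commute power2_eq_square algebra_simps)
  have [measurable]: "S \<in> borel_measurable borel" unfolding S_def by measurable
  have Suv: "(\<Sum>w\<in>insert u B. (w \<bullet> x)\<^sup>2) = (u \<bullet> x)\<^sup>2 + S x" for x
    using insert.hyps by (simp add: S_def)
  let ?f = "\<lambda>x y. ennreal (exp (2 * ((v + (sqrt b * y) *\<^sub>R u) \<bullet> x) - a * (norm x)\<^sup>2 + b * S x))"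
  let ?c = "sqrt b * (u \<bullet> v) / (1 + a)"
  have "(\<integral>\<^sup>+x. ennreal (exp (2 * (v \<bullet> x) - a * (norm x)\<^sup>2 + b * (\<Sum>u\<in>insert u B. (u \<bullet> x)\<^sup>2))) \<partial>\<mu>) =
     (\<integral>\<^sup>+x. \<integral>\<^sup>+y. ?f x y \<partial>half_normal \<partial>\<mu>)"
  proof (rule nn_integral_cong)
    fix x
    have "(\<integral>\<^sup>+y. ?f x y \<partial>half_normal) =
      (\<integral>\<^sup>+y. ennreal (exp (2 * (v \<bullet> x) - a * (norm x)\<^sup>2 + b * S x)) * ennreal (exp (2 * (sqrt b * (u \<bullet> x)) * y - 0 * y\<^sup>2)) \<partial>half_normal)"
      by (intro nn_integral_cong) (simp add: ennreal_mult[symmetric] exp_add[symmetric] inner_add_left algebra_simps)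
    also have "\<dots> = ennreal (exp (2 * (v \<bullet> x) - a * (norm x)\<^sup>2 + b * S x)) * ennreal (exp (b * (u \<bullet> x)\<^sup>2))"
      using b by (subst nn_integral_cmult, simp, subst half_normal_exp_quadratic) (auto simp: power_mult_distrib)
    finally show "ennreal (exp (2 * (v \<bullet> x) - a * (norm x)\<^sup>2 + b * (\<Sum>u\<in>insert u B. (u \<bullet> x)\<^sup>2))) = (\<integral>\<^sup>+y. ?f x y \<partial>half_normal)"
      by (simp add: Suv ennreal_mult[symmetric] exp_add[symmetric] algebra_simps)
  qed
  also have "\<dots> = (\<integral>\<^sup>+y. \<integral>\<^sup>+x. ?f x y \<partial>\<mu> \<partial>half_normal)"
    by (subst P.Fubini') auto
  \<comment> \<open>What remains is a one-dimensional Gaussian integral with quadratic coefficient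
    \<open>- b / (1 + a)\<close>; it converges because \<open>b < 1 + a\<close>.\<close>
  also have "\<dots> = (\<integral>\<^sup>+y. ennreal (K * exp (((norm v)\<^sup>2 + \<beta> * S v) / (1 + a))) *
      ennreal (exp (2 * ?c * y - (- b / (1 + a)) * y\<^sup>2)) \<partial>half_normal)"
    unfolding IH Su nu using b
    by (intro nn_integral_cong) (simp add: ennreal_mult''[symmetric] mult.assoc exp_add[symmetric] power_mult_distrib add_divide_distrib algebra_simps)
  also have "\<dots> = ennreal (K * exp (((norm v)\<^sup>2 + \<beta> * S v) / (1 + a))) *
      ennreal ((1 - b / (1 + a)) powr (- (1/2)) * exp (?c\<^sup>2 / (1 - b / (1 + a))))"
    using a b by (subst nn_integral_cmult, simp, subst half_normal_exp_quadratic) (auto simp: field_simps)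
  also have "?c\<^sup>2 / (1 - b / (1 + a)) = \<beta> * (u \<bullet> v)\<^sup>2 / (1 + a)"
  proof -
    have "b * y / s\<^sup>2 / (1 - b / s) = b / (s - b) * y / s" if "s > 0" "b < s" for s y :: real
    proof -
      have "1 - b / s = (s - b) / s" using that by (simp add: field_simps)
      then show ?thesis using that by (simp add: power2_eq_square)
    qed
    from this[of "1 + a" "(u \<bullet> v)\<^sup>2"] show ?thesis
      using a b by (simp add: power_divide power_mult_distrib \<beta>_def)
  qed
  also have "ennreal (K * exp (((norm v)\<^sup>2 + \<beta> * S v) / (1 + a))) *
      ennreal ((1 - b / (1 + a)) powr (- (1/2)) * exp (\<beta> * (u \<bullet> v)\<^sup>2 / (1 + a)))
    = ennreal ((1 + a) powr (- (real DIM('a) / 2)) *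
      (1 - b / (1 + a)) powr (- (real (card (insert u B)) / 2)) *
       exp (((norm v)\<^sup>2 + b / (1 + a - b) * (\<Sum>u\<in>insert u B. (u \<bullet> v)\<^sup>2)) / (1 + a)))"
    using insert.hyps
    by (simp add: ennreal_mult''[symmetric] K_def exp_add[symmetric] powr_add[symmetric] \<beta>_def Suv add_divide_distrib algebra_simps)
  finally show ?case .
qed

text \<open>For a subspace \<open>S\<close>, the squared norm of the orthogonal projection to \<open>S\<close>.\<close>

definition psq :: "'a::euclidean_space set \<Rightarrow> 'a \<Rightarrow> real" where
  "psq S x = (\<Sum>u\<in>(SOME B. B \<subseteq> S \<and> pairwise Linear_Algebra.orthogonal B \<and> (\<forall>x\<in>B. norm x = 1) \<and>
      finite B \<and> card B = dim S \<and> span B = S). (u \<bullet> x)\<^sup>2)"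

lemma psq_basis:
  fixes S :: "'a::euclidean_space set"
  assumes "subspace S"
  obtains B where "pairwise Linear_Algebra.orthogonal B" "\<And>x. x \<in> B \<Longrightarrow> norm x = 1" "finite B" "card B = dim S"
    "span B = S" "\<And>x. psq S x = (\<Sum>u\<in>B. (u \<bullet> x)\<^sup>2)"
proof -
  let ?P = "\<lambda>B. B \<subseteq> S \<and> pairwise Linear_Algebra.orthogonal B \<and> (\<forall>x\<in>B. norm x = 1) \<and> finite B \<and> card B = dim S \<and> span B = S"
  have "\<exists>B. ?P B"
    using orthonormal_basis_subspace[OF assms] finiteI_independent by metis
  from someI_ex[OF this] that[of "SOME B. ?P B"] show ?thesis
    unfolding psq_def by blast
qed

lemma psq_nonneg: "psq S x \<ge> 0"
  by (simp add: psq_def sum_nonneg)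

lemma psq_measurable [measurable]: "psq S \<in> borel_measurable borel"
  unfolding psq_def by measurable

lemma orthonormal_expansion:
  fixes B :: "'a::euclidean_space set"
  assumes "pairwise Linear_Algebra.orthogonal B" "\<And>x. x \<in> B \<Longrightarrow> norm x = 1" "finite B" "x \<in> span B"
  shows "x = (\<Sum>u\<in>B. (u \<bullet> x) *\<^sub>R u)"
proof -
  obtain c where c: "x = (\<Sum>u\<in>B. c u *\<^sub>R u)"
    using assms(3,4) by (auto simp: span_finite)
  have "w \<bullet> x = c w" if "w \<in> B" for w
  proof -
    have "w \<bullet> x = (\<Sum>u\<in>B. if u = w then c w else 0)"
      unfolding c inner_sum_right
      using assms(1,2) that
      by (intro sum.cong) (auto simp: pairwise_def Linear_Algebra.orthogonal_def dot_square_norm)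
    then show ?thesis using assms(3) that by simp
  qed
  then show ?thesis by (subst (1) c) simp
qed

lemma psq_span:
  fixes S :: "'a::euclidean_space set"
  assumes "subspace S" "y \<in> S"
  shows "psq S y = (norm y)\<^sup>2"
proof -
  obtain B where B: "pairwise Linear_Algebra.orthogonal B" "\<And>x. x \<in> B \<Longrightarrow> norm x = 1" "finite B" "card B = dim S"
    "span B = S" "\<And>x. psq S x = (\<Sum>u\<in>B. (u \<bullet> x)\<^sup>2)"
    using psq_basis[OF assms(1)] by metis
  have "(norm y)\<^sup>2 = y \<bullet> (\<Sum>u\<in>B. (u \<bullet> y) *\<^sub>R u)"
    by (subst orthonormal_expansion[OF B(1,2,3), symmetric]) (use B assms in \<open>auto simp: dot_square_norm\<close>)
  also have "\<dots> = psq S y"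
    by (simp add: inner_sum_right B(6) power2_eq_square inner_commute)
  finally show ?thesis by simp
qed

text \<open>Each basis vector lies in \<open>S\<close> and does not see \<open>z\<close>. This
  identifies \<open>psq\<close> with the squared norm of the component in \<open>S\<close>, whatever
  basis was chosen, and the remainder with the squared distance to \<open>S\<close>.\<close>

lemma psq_orthogonal_decomp:
  fixes S :: "'a::euclidean_space set"
  assumes "subspace S" "y \<in> S" "\<And>w. w \<in> S \<Longrightarrow> z \<bullet> w = 0"
  shows "psq S (y + z) = (norm y)\<^sup>2" "(norm z)\<^sup>2 = (norm (y + z))\<^sup>2 - psq S (y + z)"
proof -
  obtain B where B: "span B = S" "\<And>x. psq S x = (\<Sum>u\<in>B. (u \<bullet> x)\<^sup>2)"
    using psq_basis[OF assms(1)] by metis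
  have "u \<bullet> z = 0" if "u \<in> B" for u
    using assms(3)[of u] B(1) that span_base[of u B] by (auto simp: inner_commute)
  then have "psq S (y + z) = psq S y"
    unfolding B(2) by (intro sum.cong) (auto simp: inner_add_right)
  then show 1: "psq S (y + z) = (norm y)\<^sup>2" by (simp add: psq_span assms)
  show "(norm z)\<^sup>2 = (norm (y + z))\<^sup>2 - psq S (y + z)"
    unfolding 1 using assms(3)[OF assms(2)]
    by (simp add: power2_norm_eq_inner inner_add_left inner_add_right inner_commute)
qed

text \<open>A vector of \<open>S\<close> pairs only with the projection of \<open>w\<close>, and
  Cauchy-Schwarz applies to that projection. This is where noise outside the signal space drops
  out.\<close>

lemma inner_le_norm_psq:
  fixes S :: "'a::euclidean_space set"
  assumes "subspace S" "y \<in> S"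
  shows "y \<bullet> w \<le> norm y * sqrt (psq S w)"
proof -
  obtain p q where pq: "p \<in> span S" "\<And>u. u \<in> span S \<Longrightarrow> Linear_Algebra.orthogonal q u" "w = p + q"
    using orthogonal_subspace_decomp_exists[of S w] by metis
  have S: "span S = S" using assms(1) by (simp add: span_eq_iff)
  have "psq S w = (norm p)\<^sup>2"
    unfolding pq(3) using pq(1,2) S by (intro psq_orthogonal_decomp[OF assms(1)]) (auto simp: Linear_Algebra.orthogonal_def)
  moreover have "y \<bullet> w = y \<bullet> p"
    using pq(2)[of y] S assms by (simp add: pq(3) inner_add_right Linear_Algebra.orthogonal_def inner_commute)
  ultimately show ?thesis using norm_cauchy_schwarz[of y p] by simp
qed

lemma gauss_vec_exp_psq:
  fixes \<mu> :: "'a::euclidean_space measure"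
  assumes "gauss_vec \<mu>" "subspace S" "0 \<le> t" "t < 1"
  shows "(\<integral>\<^sup>+x. ennreal (exp (t * psq S x)) \<partial>\<mu>) = ennreal ((1 - t) powr (- (real (dim S) / 2)))"
proof -
  obtain B where B: "pairwise Linear_Algebra.orthogonal B" "\<And>x. x \<in> B \<Longrightarrow> norm x = 1" "finite B" "card B = dim S"
    "\<And>x. psq S x = (\<Sum>u\<in>B. (u \<bullet> x)\<^sup>2)"
    using psq_basis[OF assms(2)] by metis
  show ?thesis
    using gauss_vec_exp_quadratic[OF assms(1), of 0 t B 0] assms(3,4) B by simp
qed

text \<open>The case \<open>a = b = t\<close>, \<open>v = 0\<close>. The two powers merge because
  \<open>1 - t / (1 + t)\<close> is the inverse of \<open>1 + t\<close>: the squared distance to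
  \<open>S\<close> has the Laplace transform of a Gamma variable of shape
  \<open>(DIM('a) - dim S) / 2\<close>.\<close>

lemma gauss_vec_exp_copsq:
  fixes \<mu> :: "'a::euclidean_space measure"
  assumes "gauss_vec \<mu>" "subspace S" "0 \<le> t"
  shows "(\<integral>\<^sup>+x. ennreal (exp (- t * ((norm x)\<^sup>2 - psq S x))) \<partial>\<mu>) =
    ennreal ((1 + t) powr (- ((real DIM('a) - real (dim S)) / 2)))"
proof -
  obtain B where B: "pairwise Linear_Algebra.orthogonal B" "\<And>x. x \<in> B \<Longrightarrow> norm x = 1" "finite B" "card B = dim S"
    "\<And>x. psq S x = (\<Sum>u\<in>B. (u \<bullet> x)\<^sup>2)"
    using psq_basis[OF assms(2)] by metis
  have "(\<integral>\<^sup>+x. ennreal (exp (- t * ((norm x)\<^sup>2 - psq S x))) \<partial>\<mu>) =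
     ennreal ((1 + t) powr (- (real DIM('a) / 2)) * (1 - t / (1 + t)) powr (- (real (dim S) / 2)))"
    using gauss_vec_exp_quadratic[OF assms(1), of t t B 0] assms(3) B by (simp add: algebra_simps)
  also have "1 - t / (1 + t) = (1 + t) powr (-1)"
    using assms(3) by (simp add: powr_minus field_simps)
  finally show ?thesis
    unfolding powr_powr powr_add[symmetric] by (simp add: diff_divide_distrib)
qed

section \<open>Gram determinants\<close>

definition cip :: "complex^'r \<Rightarrow> complex^'r \<Rightarrow> complex" where
  "cip x y = (\<Sum>a\<in>UNIV. cnj (x $ a) * y $ a)"

lemma cip_simps:
  "cip (x + y) z = cip x z + cip y z" "cip z (x + y) = cip z x + cip z y"
  "cip 0 z = 0" "cip z 0 = 0"
  "cip (c *s x) z = cnj c * cip x z" "cip z (c *s x) = c * cip z x"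
  by (simp_all add: cip_def sum.distrib[symmetric] sum_distrib_left algebra_simps)

lemma Re_cip: "Re (cip x y) = x \<bullet> y"
  by (simp add: cip_def inner_vec_def inner_complex_def)

lemma cip_self: "cip x x = of_real ((norm x)\<^sup>2)"
proof -
  have "Im (cip x x) = 0" by (simp add: cip_def)
  then show ?thesis
    by (simp add: complex_eq_iff Re_cip power2_norm_eq_inner)
qed

lemma scaleR_eq_vec_scale: "c *\<^sub>R (x :: complex^'r) = of_real c *s x"
proof -
  have "(c *\<^sub>R x) $ i = (of_real c *s x) $ i" for i
    by (simp add: complex_eq_iff)
  then show ?thesis by (simp add: Finite_Cartesian_Product.vec_eq_iff)
qed

lemma subspace_vec_span: "subspace (vec.span (A :: (complex^'r) set))"
  by (auto simp: subspace_def vec.span_zero vec.span_add vec.span_scale scaleR_eq_vec_scale)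

text \<open>A complex span contains \<open>\<i> *s w\<close> along with \<open>w\<close>. Real
  orthogonality to both kills the real and the imaginary part of \<open>cip q w\<close>.\<close>

lemma cip_orthogonal:
  assumes "\<And>w. w \<in> vec.span A \<Longrightarrow> q \<bullet> w = 0" "w \<in> vec.span A"
  shows "cip q w = 0"
proof -
  have "Re (cip q (\<i> *s w)) = 0" "Re (cip q w) = 0"
    using assms by (auto simp: Re_cip vec.span_scale)
  then show ?thesis by (simp add: cip_simps complex_eq_iff)
qed

text \<open>The Gram determinant of the columns in \<open>J\<close>, padded by an identity block so that it stays
  a determinant over the full index type while columns are added one at a time.\<close>

definition gram_mat :: "'n set \<Rightarrow> ('n \<Rightarrow> complex^'r) \<Rightarrow> complex^'n^'n" where
  "gram_mat J h = (\<chi> i j. if i \<in> J \<and> j \<in> J then cip (h i) (h j) else if i = j then 1 else 0)"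

text \<open>Row \<open>a\<close> of the Gram matrix is conjugate-linear in \<open>h a\<close>. The
  part coming from \<open>p\<close> is a combination of the other rows and can be subtracted; the
  part coming from \<open>q\<close> vanishes except for the diagonal entry, the squared norm of
  \<open>q\<close>.\<close>

lemma det_gram_insert:
  fixes h :: "'n::finite \<Rightarrow> complex^'r"
  assumes "a \<notin> J" and p: "p \<in> vec.span (h ` J)" and q: "\<And>w. w \<in> vec.span (h ` J) \<Longrightarrow> q \<bullet> w = 0"
    and ha: "h a = p + q"
  shows "det (gram_mat (insert a J) h) = of_real ((norm q)\<^sup>2) * det (gram_mat J h)"
proof -
  let ?A = "gram_mat (insert a J) h"
  define R where "R x = (\<chi> j. if j \<in> insert a J then cip x (h j) else 0)" for x
  have Rsimps: "R 0 = 0" "R (x + y) = R x + R y" "R (c *s x) = cnj c *s R x" for x y c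
    by (auto simp: R_def Finite_Cartesian_Product.vec_eq_iff cip_simps)
  have rowR: "row j ?A = R (h j)" if "j \<in> insert a J" for j
    using that by (auto simp: Finite_Cartesian_Product.row_def gram_mat_def R_def Finite_Cartesian_Product.vec_eq_iff)
  have "R p \<in> vec.span {row j ?A |j. j \<noteq> a}"
    using p
  proof (induction p rule: vec.span_induct_alt)
    case base then show ?case by (simp add: Rsimps vec.span_zero)
  next
    case (step c x y)
    then obtain j where j: "j \<in> J" "x = h j" by auto
    then have "R x \<in> vec.span {row j ?A |j. j \<noteq> a}"
      using rowR[of j] assms(1) by (intro vec.span_base) force
    then show ?case using step by (simp add: Rsimps vec.span_add vec.span_scale)
  qed
  then have "- R p \<in> vec.span {row j ?A |j. j \<noteq> a}" by (rule vec.span_neg)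
  from det_row_span[OF this] have "det ?A = det (\<chi> k. if k = a then row a ?A + - R p else row k ?A)" by simp
  also have "row a ?A + - R p = R q"
    by (simp add: rowR Rsimps ha)
  also have "R q = of_real ((norm q)\<^sup>2) *s axis a 1"
  proof -
    have "cip q (h j) = 0" if "j \<in> J" for j
      using that by (intro cip_orthogonal[OF q]) (auto intro: vec.span_base)
    moreover have "cip q (h a) = of_real ((norm q)\<^sup>2)"
      using cip_orthogonal[OF q p] by (simp add: ha cip_simps cip_self)
    ultimately show ?thesis using assms(1) by (auto simp: R_def Finite_Cartesian_Product.vec_eq_iff axis_def)
  qed
  also have "det (\<chi> k. if k = a then of_real ((norm q)\<^sup>2) *s axis a 1 else row k ?A) =
      of_real ((norm q)\<^sup>2) * det (\<chi> k. if k = a then axis a 1 else row k ?A)"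
    by (rule det_row_mul)
  \<comment> \<open>Column \<open>a\<close> of the left matrix is not cleared. A permutation moving
    \<open>a\<close> still contributes 0 on both sides, through the unit vector in row
    \<open>a\<close> on the left and the identity padding on the right, and one fixing
    \<open>a\<close> uses that column only in row \<open>a\<close>.\<close>
  also have "det (\<chi> k. if k = a then axis a 1 else row k ?A) = det (gram_mat J h)"
    unfolding Determinants.det_def
  proof (intro sum.cong refl arg_cong2[where f = "(*)"])
    fix \<pi> :: "'n \<Rightarrow> 'n" assume "\<pi> \<in> {\<pi>. \<pi> permutes UNIV}"
    then have inj: "inj \<pi>" by (auto intro: permutes_inj)
    let ?l = "\<lambda>i. (\<chi> k. if k = a then axis a 1 else row k ?A) $ i $ \<pi> i"
    let ?r = "\<lambda>i. gram_mat J h $ i $ \<pi> i"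
    show "prod ?l UNIV = prod ?r UNIV"
    proof (cases "\<pi> a = a")
      case True
      then have "\<pi> i \<noteq> a" if "i \<noteq> a" for i using injD[OF inj, of i a] that by auto
      then show ?thesis
        using True assms(1) by (intro prod.cong) (auto simp: gram_mat_def Finite_Cartesian_Product.row_def axis_def)
    next
      case False
      then have "?l a = 0" "?r a = 0" using assms(1) by (auto simp: gram_mat_def axis_def)
      then have "prod ?l UNIV = 0" "prod ?r UNIV = 0" by (meson UNIV_I finite prod_zero)+
      then show ?thesis by (simp only:)
    qed
  qed
  finally show ?thesis .
qed

definition rgram :: "'n set \<Rightarrow> ('n::finite \<Rightarrow> complex^'r) \<Rightarrow> real" where
  "rgram J h = Re (det (gram_mat J h))"

lemma rgram_empty [simp]: "rgram {} h = 1"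
proof -
  have "gram_mat {} h = mat 1" by (auto simp: gram_mat_def Finite_Cartesian_Product.mat_def Finite_Cartesian_Product.vec_eq_iff)
  then show ?thesis by (simp add: rgram_def)
qed

text \<open>The new factor is the squared distance of the new column to the span of the old ones.
  Realness and dimension are phrased as one-step implications, to be chained by the induction that
  follows.\<close>

lemma rgram_insert:
  fixes h :: "'n::finite \<Rightarrow> complex^'r"
  assumes "a \<notin> J"
  shows "rgram (insert a J) h = ((norm (h a))\<^sup>2 - psq (vec.span (h ` J)) (h a)) * rgram J h"
    and "(norm (h a))\<^sup>2 - psq (vec.span (h ` J)) (h a) \<ge> 0"
    and "det (gram_mat J h) = of_real (rgram J h) \<Longrightarrow>
      det (gram_mat (insert a J) h) = of_real (rgram (insert a J) h)"
    and "(norm (h a))\<^sup>2 - psq (vec.span (h ` J)) (h a) > 0 \<Longrightarrow>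
      dim (vec.span (h ` insert a J)) = dim (vec.span (h ` J)) + 2"
proof -
  define V where "V = vec.span (h ` J)"
  have S: "subspace V" by (simp add: V_def subspace_vec_span)
  obtain p q where p: "p \<in> V" and q: "\<And>w. w \<in> V \<Longrightarrow> q \<bullet> w = 0" and ha: "h a = p + q"
  proof -
    obtain p q where "p \<in> span V" "\<And>w. w \<in> span V \<Longrightarrow> Linear_Algebra.orthogonal q w" "h a = p + q"
      using orthogonal_subspace_decomp_exists[of V "h a"] by metis
    then show thesis using that[of p q] S by (simp add: span_eq_iff[THEN iffD2] Linear_Algebra.orthogonal_def)
  qed
  have n: "(norm (h a))\<^sup>2 - psq V (h a) = (norm q)\<^sup>2"
    unfolding ha using psq_orthogonal_decomp(2)[OF S p q] by simp
  have d: "det (gram_mat (insert a J) h) = of_real ((norm q)\<^sup>2) * det (gram_mat J h)"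
    by (rule det_gram_insert[where p = p and q = q and h = h and a = a and J = J,
          OF assms p[unfolded V_def] q[unfolded V_def] ha])
  show "rgram (insert a J) h = ((norm (h a))\<^sup>2 - psq (vec.span (h ` J)) (h a)) * rgram J h"
    unfolding V_def[symmetric] n by (simp add: rgram_def d)
  show "(norm (h a))\<^sup>2 - psq (vec.span (h ` J)) (h a) \<ge> 0"
    unfolding V_def[symmetric] n by simp
  show "det (gram_mat (insert a J) h) = of_real (rgram (insert a J) h)"
    if "det (gram_mat J h) = of_real (rgram J h)"
  proof -
    have "det (gram_mat (insert a J) h) = of_real ((norm q)\<^sup>2 * rgram J h)"
      using d unfolding that by simp
    then show ?thesis by (simp only: rgram_def[of "insert a J"] Re_complex_of_real)
  qed
  show "dim (vec.span (h ` insert a J)) = dim (vec.span (h ` J)) + 2"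
    if "(norm (h a))\<^sup>2 - psq (vec.span (h ` J)) (h a) > 0"
  proof -
    have q0: "q \<noteq> 0" using that unfolding V_def[symmetric] n by auto
    let ?iq = "\<i> *s q"
    have sV: "span V = V" using S by (simp add: span_eq_iff)
    have iqq: "?iq \<bullet> q = 0"
      by (simp add: inner_vec_def inner_complex_def)
    have iqV: "?iq \<bullet> w = 0" if "w \<in> V" for w
    proof -
      have "cip q w = 0" using cip_orthogonal[of "h ` J" q w] q that by (auto simp: V_def)
      then show ?thesis by (simp add: Re_cip[symmetric] cip_simps)
    qed
    \<comment> \<open>Modulo \<open>V\<close>, the complex multiples of \<open>h a\<close> are those
      of \<open>q\<close>, that is the real combinations of \<open>q\<close> and
      \<open>\<i> *s q\<close>. Both directions are new, which gives the 2 in the dimension.\<close>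
    have "vec.span (h ` insert a J) = span (insert ?iq (insert q V))"
    proof -
      have "x - k *s h a \<in> V \<longleftrightarrow> x - Im k *\<^sub>R ?iq - Re k *\<^sub>R q \<in> V" for x k
      proof -
        have "Im k *\<^sub>R ?iq + Re k *\<^sub>R q = k *s q"
          unfolding scaleR_eq_vec_scale Finite_Cartesian_Product.vec_eq_iff
          by (auto simp: complex_eq_iff algebra_simps)
        then have "x - Im k *\<^sub>R ?iq - Re k *\<^sub>R q = (x - k *s h a) + k *s p"
          by (simp add: ha algebra_simps vec.scale_right_distrib)
        moreover have kp: "k *s p \<in> V" using p by (simp add: V_def vec.span_scale)
        moreover have "y + k *s p \<in> V \<longleftrightarrow> y \<in> V" for y
          using subspace_add[OF S _ kp, of y] subspace_diff[OF S _ kp, of "y + k *s p"] by auto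
        ultimately show ?thesis by metis
      qed
      then have "(\<exists>k. x - k *s h a \<in> V) \<longleftrightarrow> (\<exists>\<beta> \<alpha>. x - \<beta> *\<^sub>R ?iq - \<alpha> *\<^sub>R q \<in> V)" for x
        by (auto intro: exI[of _ "Complex _ _"])
      then have "{x. \<exists>k. x - k *s h a \<in> vec.span (h ` J)} = {x. \<exists>\<beta>. x - \<beta> *\<^sub>R ?iq \<in> {x. \<exists>\<alpha>. x - \<alpha> *\<^sub>R q \<in> span V}}"
        by (simp add: sV V_def[symmetric])
      then show ?thesis
        unfolding image_insert vec.span_insert span_insert .
    qed
    moreover have "q \<notin> span V" unfolding sV using q[of q] q0 by auto
    moreover have "?iq \<notin> span (insert q V)"
    proof
      assume "?iq \<in> span (insert q V)"
      then obtain k where k: "?iq - k *\<^sub>R q \<in> V" by (auto simp: span_insert sV)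
      have "?iq \<bullet> (?iq - k *\<^sub>R q) = 0" using iqV[OF k] .
      then have "?iq \<bullet> ?iq = 0" by (simp add: inner_diff_right iqq)
      then have "?iq = 0" by simp
      then show False using q0 by (simp add: Finite_Cartesian_Product.vec_eq_iff)
    qed
    ultimately show ?thesis unfolding V_def[symmetric] by (simp add: dim_insert)
  qed
qed

text \<open>The third claim is Hadamard's inequality: every factor is a squared distance to a
  subspace, hence at most a squared norm. A positive determinant forces every factor to be positive,
  so each column adds two real dimensions.\<close>

lemma rgram_basic:
  fixes h :: "'n::finite \<Rightarrow> complex^'r"
  shows "det (gram_mat J h) = of_real (rgram J h)" "rgram J h \<ge> 0"
    "rgram J h \<le> (\<Prod>j\<in>J. (norm (h j))\<^sup>2)"
    "rgram J h > 0 \<Longrightarrow> dim (vec.span (h ` J)) = 2 * card J"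
proof -
  have "det (gram_mat J h) = of_real (rgram J h) \<and> rgram J h \<ge> 0 \<and>
    rgram J h \<le> (\<Prod>j\<in>J. (norm (h j))\<^sup>2) \<and> (rgram J h > 0 \<longrightarrow> dim (vec.span (h ` J)) = 2 * card J)"
    using finite[of J]
  proof (induction J rule: finite_induct)
    case empty
    have "gram_mat {} h = mat 1" by (auto simp: gram_mat_def Finite_Cartesian_Product.mat_def Finite_Cartesian_Product.vec_eq_iff)
    moreover have "vec.span (h ` {}) = {0}" by simp
    ultimately show ?case by simp
  next
    case (insert a J)
    note r = rgram_insert[OF insert.hyps(2), of h]
    have "(norm (h a))\<^sup>2 - psq (vec.span (h ` J)) (h a) \<le> (norm (h a))\<^sup>2"
      using psq_nonneg by simp
    then have "rgram (insert a J) h \<le> (norm (h a))\<^sup>2 * (\<Prod>j\<in>J. (norm (h j))\<^sup>2)"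
      unfolding r(1) using insert.IH r(2) by (intro mult_mono) auto
    moreover have "dim (vec.span (h ` insert a J)) = 2 * card (insert a J)" if "rgram (insert a J) h > 0"
    proof -
      have "rgram J h > 0" "(norm (h a))\<^sup>2 - psq (vec.span (h ` J)) (h a) > 0"
        using that r(2) insert.IH unfolding r(1) by (auto simp: zero_less_mult_iff)
      then show ?thesis using r(4) insert by simp
    qed
    ultimately show ?case
      using insert r(1,2) r(3) by simp
  qed
  then show "det (gram_mat J h) = of_real (rgram J h)" "rgram J h \<ge> 0"
    "rgram J h \<le> (\<Prod>j\<in>J. (norm (h j))\<^sup>2)"
    "rgram J h > 0 \<Longrightarrow> dim (vec.span (h ` J)) = 2 * card J"
    by auto
qed

lemma rgram_cong: "(\<And>j. j \<in> J \<Longrightarrow> h j = h' j) \<Longrightarrow> rgram J h = rgram J h'"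
proof -
  assume "\<And>j. j \<in> J \<Longrightarrow> h j = h' j"
  then have "gram_mat J h = gram_mat J h'"
    unfolding gram_mat_def by (intro arg_cong[where f = vec_lambda] ext) simp
  then show ?thesis by (simp add: rgram_def)
qed

lemma gram_mat_columns:
  "gram_mat UNIV (\<lambda>j. column j A) = ctranspose A ** A"
  by (simp add: gram_mat_def ctranspose_def matrix_matrix_mult_def column_def cip_def Finite_Cartesian_Product.vec_eq_iff)

section \<open>Negative moments\<close>

text \<open>Presents \<open>x powr (- u)\<close> as a mixture of exponentials in \<open>x\<close>,
  so that a Laplace transform determines negative moments.\<close>

lemma Gamma_scaled_nn_integral:
  fixes x u :: real
  assumes "x > 0" "u > 0"
  shows "(\<integral>\<^sup>+t. ennreal (indicator {0..} t * t powr (u - 1) * exp (- t * x)) \<partial>lborel) =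
    ennreal (Gamma u * x powr (- u))"
proof -
  have "ennreal (Gamma u) = (\<integral>\<^sup>+t. ennreal (indicator {0..} t * t powr (u - 1) / exp t) \<partial>lborel)"
    using Gamma_conv_nn_integral_real[OF assms(2)] .
  also have "\<dots> = ennreal x * (\<integral>\<^sup>+t. ennreal (indicator {0..} (0 + x * t) * (0 + x * t) powr (u - 1) / exp (0 + x * t)) \<partial>lborel)"
    by (subst nn_integral_real_affine[where c = x and t = 0]) (use assms in auto)
  also have "\<dots> = ennreal x * (\<integral>\<^sup>+t. ennreal (x powr (u - 1)) * ennreal (indicator {0..} t * t powr (u - 1) * exp (- t * x)) \<partial>lborel)"
    using assms
    by (intro arg_cong2[where f = "(*)"] nn_integral_cong refl)
       (auto simp: ennreal_mult[symmetric] indicator_def powr_mult exp_minus field_simps zero_le_mult_iff)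
  also have "\<dots> = ennreal (x powr u) * (\<integral>\<^sup>+t. ennreal (indicator {0..} t * t powr (u - 1) * exp (- t * x)) \<partial>lborel)"
    using assms by (subst nn_integral_cmult) (auto simp: mult.assoc[symmetric] ennreal_mult[symmetric] powr_diff)
  finally have *: "ennreal (Gamma u) = ennreal (x powr u) * (\<integral>\<^sup>+t. ennreal (indicator {0..} t * t powr (u - 1) * exp (- t * x)) \<partial>lborel)" .
  have "ennreal (Gamma u * x powr (- u)) = ennreal (x powr (- u)) * ennreal (Gamma u)"
    using assms by (simp add: ennreal_mult[symmetric] mult.commute)
  also have "\<dots> = ennreal (x powr (- u) * x powr u) * (\<integral>\<^sup>+t. ennreal (indicator {0..} t * t powr (u - 1) * exp (- t * x)) \<partial>lborel)"
    unfolding * by (simp add: ennreal_mult mult.assoc)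
  also have "x powr (- u) * x powr u = 1" using assms by (simp add: powr_add[symmetric])
  finally show ?thesis by simp
qed

text \<open>A Beta integral. The factor \<open>(1 + t) powr (- m)\<close> is itself written as a
  Gamma integral over \<open>s\<close>; after exchanging the order of integration both integrals are
  Gamma integrals.\<close>

lemma nn_integral_powr_Lomax:
  fixes m u :: real
  assumes "0 < u" "u < m"
  shows "(\<integral>\<^sup>+t. ennreal (indicator {0..} t * t powr (u - 1) * (1 + t) powr (- m)) \<partial>lborel) =
    ennreal (Gamma u * Gamma (m - u) / Gamma m)"
proof -
  have m: "m > 0" using assms by simp
  let ?g = "\<lambda>s t::real. ennreal (indicator {0..} t * t powr (u - 1)) * ennreal (indicator {0..} s * s powr (m - 1) * exp (- s * (1 + t)) / Gamma m)"
  have "(\<integral>\<^sup>+t. ennreal (indicator {0..} t * t powr (u - 1) * (1 + t) powr (- m)) \<partial>lborel) =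
    (\<integral>\<^sup>+t. (\<integral>\<^sup>+s. ?g s t \<partial>lborel) \<partial>lborel)"
  proof (rule nn_integral_cong)
    fix t :: real
    show "ennreal (indicator {0..} t * t powr (u - 1) * (1 + t) powr (- m)) = (\<integral>\<^sup>+s. ?g s t \<partial>lborel)"
    proof (cases "t \<ge> 0")
      case True
      have "(\<integral>\<^sup>+s. ?g s t \<partial>lborel) = (\<integral>\<^sup>+s. ennreal (indicator {0..} t * t powr (u - 1) / Gamma m) *
          ennreal (indicator {0..} s * s powr (m - 1) * exp (- s * (1 + t))) \<partial>lborel)"
        using m by (intro nn_integral_cong) (auto simp: ennreal_mult[symmetric] Gamma_real_nonneg field_simps)
      also have "\<dots> = ennreal (indicator {0..} t * t powr (u - 1) / Gamma m) * ennreal (Gamma m * (1 + t) powr (- m))"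
        using True m by (subst nn_integral_cmult, simp, subst Gamma_scaled_nn_integral) auto
      also have "\<dots> = ennreal (indicator {0..} t * t powr (u - 1) * (1 + t) powr (- m))"
        using Gamma_real_pos[OF m] by (simp add: ennreal_mult''[symmetric])
      finally show ?thesis by simp
    qed simp
  qed
  also have "\<dots> = (\<integral>\<^sup>+s. (\<integral>\<^sup>+t. ?g s t \<partial>lborel) \<partial>lborel)"
    by (rule lborel_pair.Fubini') measurable
  also have "\<dots> = (\<integral>\<^sup>+s. ennreal (Gamma u / Gamma m) * ennreal (indicator {0..} s * s powr ((m - u) - 1) * exp (- s * 1)) \<partial>lborel)"
  proof (rule nn_integral_cong_AE)
    have "AE s::real in lborel. s \<noteq> 0" by (rule AE_lborel_singleton)
    then show "AE s in lborel. (\<integral>\<^sup>+t. ?g s t \<partial>lborel) =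
      ennreal (Gamma u / Gamma m) * ennreal (indicator {0..} s * s powr ((m - u) - 1) * exp (- s * 1))"
    proof eventually_elim
      case (elim s)
      show ?case
      proof (cases "s > 0")
        case True
        have "(\<integral>\<^sup>+t. ?g s t \<partial>lborel) = (\<integral>\<^sup>+t. ennreal (s powr (m - 1) * exp (- s) / Gamma m) *
            ennreal (indicator {0..} t * t powr (u - 1) * exp (- t * s)) \<partial>lborel)"
          using m True by (intro nn_integral_cong) (auto simp: ennreal_mult[symmetric] mult_exp_exp Gamma_real_nonneg field_simps)
        also have "\<dots> = ennreal (s powr (m - 1) * exp (- s) / Gamma m) * ennreal (Gamma u * s powr (- u))"
          using True m assms by (subst nn_integral_cmult, simp, subst Gamma_scaled_nn_integral) auto
        also have "\<dots> = ennreal (Gamma u / Gamma m) * ennreal (indicator {0..} s * s powr ((m - u) - 1) * exp (- s * 1))"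
        proof -
          have "s powr ((m - u) - 1) = s powr (m - 1) * s powr (- u)"
            by (simp add: powr_add[symmetric] algebra_simps)
          then show ?thesis
          using True m assms Gamma_real_nonneg[of u] Gamma_real_nonneg[of m]
          by (simp add: ennreal_mult''[symmetric] algebra_simps)
        qed
        finally show ?thesis .
      qed (use elim in auto)
    qed
  qed
  also have "\<dots> = ennreal (Gamma u / Gamma m) * ennreal (Gamma (m - u))"
    using assms by (subst nn_integral_cmult, simp, subst Gamma_scaled_nn_integral) auto
  also have "\<dots> = ennreal (Gamma u * Gamma (m - u) / Gamma m)"
    using assms Gamma_real_nonneg[of u] Gamma_real_nonneg[of m] by (simp add: ennreal_mult'[symmetric] Gamma_real_nonneg)
  finally show ?thesis .
qed

lemma psq_le_norm:
  fixes S :: "'a::euclidean_space set"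
  assumes "subspace S"
  shows "psq S x \<le> (norm x)\<^sup>2"
proof -
  obtain p q where pq: "p \<in> span S" "\<And>u. u \<in> span S \<Longrightarrow> Linear_Algebra.orthogonal q u" "x = p + q"
    using orthogonal_subspace_decomp_exists[of S x] by metis
  have S: "span S = S" using assms(1) by (simp add: span_eq_iff)
  have "(norm q)\<^sup>2 = (norm (p + q))\<^sup>2 - psq S (p + q)"
    using pq(1,2) S by (intro psq_orthogonal_decomp(2)[OF assms(1)]) (auto simp: Linear_Algebra.orthogonal_def)
  then show ?thesis unfolding pq(3) by (metis diff_ge_0_iff_ge zero_le_power2)
qed

text \<open>The squared distance to \<open>S\<close> has the Laplace transform
  \<open>(1 + t) powr (- m)\<close> with \<open>m = CARD('r) - j\<close>. Letting \<open>t\<close>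
  grow excludes an atom at 0; integrating against \<open>t powr (u - 1)\<close> gives the negative
  moment.\<close>

lemma gauss_vec_copsq_powr:
  fixes \<mu> :: "(complex^'r) measure"
  assumes g: "gauss_vec \<mu>" and S: "subspace S" "dim S = 2 * j" "j < CARD('r)" and u: "0 < u" "u < 1"
  shows "AE x in \<mu>. (norm x)\<^sup>2 - psq S x > 0"
    and "(\<integral>\<^sup>+x. ennreal (((norm x)\<^sup>2 - psq S x) powr (- u)) \<partial>\<mu>) =
      ennreal (Gamma (real CARD('r) - real j - u) / Gamma (real CARD('r) - real j))"
proof -
  interpret \<mu>: prob_space \<mu> using g by (simp add: gauss_vec_def)
  interpret P: pair_sigma_finite \<mu> lborel ..
  have [measurable_cong]: "sets \<mu> = sets borel" using g by (simp add: gauss_vec_def)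
  define q where "q x = (norm x)\<^sup>2 - psq S x" for x
  have [measurable]: "q \<in> borel_measurable borel" unfolding q_def by measurable
  have q0: "q x \<ge> 0" for x using psq_le_norm[OF S(1)] by (simp add: q_def)
  define m where "m = real CARD('r) - real j"
  have m: "m \<ge> 1" using S(3) by (simp add: m_def)
  have L: "(\<integral>\<^sup>+x. ennreal (exp (- t * q x)) \<partial>\<mu>) = ennreal ((1 + t) powr (- m))" if "t \<ge> 0" for t
  proof -
    have "(real DIM(complex^'r) - real (dim S)) / 2 = m" by (simp add: m_def S(2))
    then show ?thesis using gauss_vec_exp_copsq[OF g S(1) that] by (simp only: q_def)
  qed
  show ae: "AE x in \<mu>. (norm x)\<^sup>2 - psq S x > 0"
  proof -
    define \<delta> where "\<delta> = \<mu>.prob {x \<in> space \<mu>. q x = 0}"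
    have "\<delta> \<le> 1 / (1 + t)" if "t \<ge> 0" for t
    proof -
      have "ennreal \<delta> = (\<integral>\<^sup>+x. indicator {x \<in> space \<mu>. q x = 0} x \<partial>\<mu>)"
        by (simp add: \<delta>_def \<mu>.emeasure_eq_measure)
      also have "\<dots> \<le> (\<integral>\<^sup>+x. ennreal (exp (- t * q x)) \<partial>\<mu>)"
        by (intro nn_integral_mono) (auto split: split_indicator)
      also have "\<dots> = ennreal ((1 + t) powr (- m))" by (rule L[OF that])
      finally have "\<delta> \<le> (1 + t) powr (- m)" by simp
      also have "\<dots> \<le> (1 + t) powr (- 1)" using that m by (intro powr_mono) auto
      also have "\<dots> = 1 / (1 + t)" using that by (simp add: powr_minus field_simps)
      finally show ?thesis .
    qed
    \<comment> \<open>At \<open>t = 1 / \<delta>\<close> the bound would read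
      \<open>\<delta> \<le> \<delta> / (\<delta> + 1)\<close>, impossible for positive
      \<open>\<delta>\<close>.\<close>
    from this[of "1 / \<delta>"] have "\<not> \<delta> > 0"
      by (auto simp: field_simps mult_le_0_iff)
    moreover have "\<delta> \<ge> 0" by (simp add: \<delta>_def)
    ultimately have "\<delta> = 0" by simp
    then have "AE x in \<mu>. \<not> (q x = 0)"
      unfolding \<delta>_def by (subst (asm) \<mu>.prob_eq_0) auto
    then show ?thesis using q0 by (auto simp: q_def less_le)
  qed
  have "ennreal (Gamma u) * (\<integral>\<^sup>+x. ennreal (q x powr (- u)) \<partial>\<mu>) = (\<integral>\<^sup>+x. ennreal (Gamma u * q x powr (- u)) \<partial>\<mu>)"
    using u by (subst nn_integral_cmult[symmetric]) (auto simp: ennreal_mult Gamma_real_nonneg)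
  also have "\<dots> = (\<integral>\<^sup>+x. \<integral>\<^sup>+t. ennreal (indicator {0..} t * t powr (u - 1) * exp (- t * q x)) \<partial>lborel \<partial>\<mu>)"
  proof (rule nn_integral_cong_AE)
    show "AE x in \<mu>. ennreal (Gamma u * q x powr (- u)) =
      (\<integral>\<^sup>+t. ennreal (indicator {0..} t * t powr (u - 1) * exp (- t * q x)) \<partial>lborel)"
      using ae unfolding q_def[symmetric]
      by eventually_elim (rule Gamma_scaled_nn_integral[symmetric], use u in auto)
  qed
  also have "\<dots> = (\<integral>\<^sup>+t. \<integral>\<^sup>+x. ennreal (indicator {0..} t * t powr (u - 1) * exp (- t * q x)) \<partial>\<mu> \<partial>lborel)"
    by (subst P.Fubini') auto
  also have "\<dots> = (\<integral>\<^sup>+t. ennreal (indicator {0..} t * t powr (u - 1) * (1 + t) powr (- m)) \<partial>lborel)"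
  proof (rule nn_integral_cong)
    fix t :: real
    have "(\<integral>\<^sup>+x. ennreal (indicator {0..} t * t powr (u - 1) * exp (- t * q x)) \<partial>\<mu>) =
      ennreal (indicator {0..} t * t powr (u - 1)) * (\<integral>\<^sup>+x. ennreal (exp (- t * q x)) \<partial>\<mu>)"
      by (subst nn_integral_cmult[symmetric]) (auto simp: ennreal_mult)
    also have "\<dots> = ennreal (indicator {0..} t * t powr (u - 1) * (1 + t) powr (- m))"
      using L[of t] by (cases "t \<ge> 0") (auto simp: ennreal_mult''[symmetric])
    finally show "(\<integral>\<^sup>+x. ennreal (indicator {0..} t * t powr (u - 1) * exp (- t * q x)) \<partial>\<mu>) =
      ennreal (indicator {0..} t * t powr (u - 1) * (1 + t) powr (- m))" .
  qed
  also have "\<dots> = ennreal (Gamma u * Gamma (m - u) / Gamma m)"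
    using u m by (intro nn_integral_powr_Lomax) auto
  also have "\<dots> = ennreal (Gamma u) * ennreal (Gamma (m - u) / Gamma m)"
    using u m by (simp add: ennreal_mult'[symmetric] Gamma_real_nonneg)
  finally have "(\<integral>\<^sup>+x. ennreal (q x powr (- u)) \<partial>\<mu>) = ennreal (Gamma (m - u) / Gamma m)"
    using Gamma_real_pos[OF u(1)] by (subst (asm) ennreal_mult_cancel_left) auto
  then show "(\<integral>\<^sup>+x. ennreal (((norm x)\<^sup>2 - psq S x) powr (- u)) \<partial>\<mu>) =
      ennreal (Gamma (real CARD('r) - real j - u) / Gamma (real CARD('r) - real j))"
    by (simp add: q_def m_def)
qed

lemma rgram_measurable:
  fixes J :: "'n::finite set" and N :: "'n \<Rightarrow> (complex^'r) measure"
  assumes N: "\<And>j. sets (N j) = sets borel"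
  shows "rgram J \<in> borel_measurable (PiM J N)"
proof -
  have c: "(\<lambda>h. cip (h i) (h j)) \<in> borel_measurable (PiM J N)" if ij: "i \<in> J" "j \<in> J" for i j
  proof -
    have nth: "(\<lambda>x::complex^'r. x $ a) \<in> borel_measurable borel" for a
      by (intro borel_measurable_continuous_onI continuous_intros)
    have cmp: "(\<lambda>h. h j $ a) \<in> borel_measurable (PiM J N)" if "j \<in> J" for j a
      using measurable_compose[OF _ nth] measurable_component_singleton[OF that, of N] N
      by (simp cong: measurable_cong_sets)
    have cnj: "cnj \<in> borel_measurable borel"
      by (intro borel_measurable_continuous_onI continuous_intros)
    show ?thesis unfolding cip_def
      by (intro borel_measurable_sum borel_measurable_times measurable_compose[OF cmp cnj] cmp ij)
  qed
  have "(\<lambda>h. gram_mat J h $ i $ j) \<in> borel_measurable (PiM J N)" for i j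
    using c[of i j] by (cases "i \<in> J \<and> j \<in> J") (auto simp: gram_mat_def)
  then have "(\<lambda>h. Re (\<Sum>p\<in>{p. p permutes UNIV}. of_int (sign p) * (\<Prod>i\<in>UNIV. gram_mat J h $ i $ p i))) \<in> borel_measurable (PiM J N)"
    by measurable
  then show ?thesis
    by (simp add: rgram_def[abs_def] Determinants.det_def)
qed

text \<open>Given the columns in \<open>J\<close>, the negative moment of the squared distance from
  the next column to their span depends only on the dimension of that span, so the moments multiply.
  Positivity is carried along because the dimension is known only where
  \<open>rgram J h > 0\<close>.\<close>

lemma rgram_powr_nn_integral:
  fixes J :: "'n::finite set" and \<mu> :: "'n \<Rightarrow> (complex^'r) measure"
  assumes g: "\<And>j. gauss_vec (\<mu> j)" and u: "0 < u" "u < 1" and J: "card J \<le> CARD('r)"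
  shows "(AE h in PiM J \<mu>. rgram J h > 0) \<and>
    (\<integral>\<^sup>+h. ennreal (rgram J h powr (- u)) \<partial>PiM J \<mu>) =
      ennreal (\<Prod>i<card J. Gamma (real CARD('r) - real i - u) / Gamma (real CARD('r) - real i))"
  using finite[of J] J
proof (induction J rule: finite_induct)
  case empty
  interpret product_prob_space \<mu> "{}"
    using g by (intro product_prob_spaceI) (auto simp: gauss_vec_def)
  show ?case using emeasure_space_1 by simp
next
  case (insert a J)
  interpret product_prob_space \<mu> J
    using g by (intro product_prob_spaceI) (auto simp: gauss_vec_def)
  interpret PJ: finite_product_prob_space \<mu> J by standard auto
  have s: "sets (\<mu> j) = sets borel" for j using g by (simp add: gauss_vec_def)
  note [measurable] = rgram_measurable[OF s]
  have ih: "AE h in PiM J \<mu>. rgram J h > 0"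
    and IH: "(\<integral>\<^sup>+h. ennreal (rgram J h powr (- u)) \<partial>PiM J \<mu>) =
      ennreal (\<Prod>i<card J. Gamma (real CARD('r) - real i - u) / Gamma (real CARD('r) - real i))"
    using insert by auto
  have lt: "card J < CARD('r)" using insert by simp
  let ?\<Gamma> = "Gamma (real CARD('r) - real (card J) - u) / Gamma (real CARD('r) - real (card J))"
  define q where "q h x = (norm x)\<^sup>2 - psq (vec.span (h ` J)) x" for h :: "'n \<Rightarrow> complex^'r" and x
  have up: "rgram (insert a J) (h(a := x)) = q h x * rgram J h" for h x
  proof -
    have "(h(a := x)) ` J = h ` J" using insert.hyps by auto
    moreover have "rgram J (h(a := x)) = rgram J h" using insert.hyps by (intro rgram_cong) auto
    ultimately show ?thesis
      using rgram_insert(1)[OF insert.hyps(2), of "h(a := x)"] by (simp add: q_def)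
  qed
  have q0: "q h x \<ge> 0" for h x
    using psq_le_norm[OF subspace_vec_span] by (simp add: q_def)
  have col: "AE x in \<mu> a. q h x > 0" "(\<integral>\<^sup>+x. ennreal (q h x powr (- u)) \<partial>\<mu> a) = ennreal ?\<Gamma>"
    if "rgram J h > 0" for h
    using gauss_vec_copsq_powr[OF g subspace_vec_span rgram_basic(4)[OF that] lt u]
    by (auto simp: q_def)
  \<comment> \<open>Almost sure positivity passes to the larger product through the integral of the
    indicator of failure, to which the iterated integral applies.\<close>
  let ?z = "\<lambda>h. if rgram (insert a J) h > 0 then 0 else 1 :: ennreal"
  have "(\<integral>\<^sup>+h. ?z h \<partial>PiM (insert a J) \<mu>) =
    (\<integral>\<^sup>+h. (\<integral>\<^sup>+x. ?z (h(a := x)) \<partial>\<mu> a) \<partial>PiM J \<mu>)"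
    using insert.hyps by (intro product_nn_integral_insert) auto
  also have "\<dots> = (\<integral>\<^sup>+h. 0 \<partial>PiM J \<mu>)"
  proof (rule nn_integral_cong_AE)
    show "AE h in PiM J \<mu>. (\<integral>\<^sup>+x. ?z (h(a := x)) \<partial>\<mu> a) = 0"
      using ih
    proof eventually_elim
      case (elim h)
      have "(\<integral>\<^sup>+x. ?z (h(a := x)) \<partial>\<mu> a) = (\<integral>\<^sup>+x. 0 \<partial>\<mu> a)"
        using col(1)[OF elim] by (intro nn_integral_cong_AE) (auto simp: up elim)
      then show ?case by simp
    qed
  qed
  finally have "(\<integral>\<^sup>+h. ?z h \<partial>PiM (insert a J) \<mu>) = 0" by simp
  then have "AE h in PiM (insert a J) \<mu>. ?z h = 0"
    by (subst (asm) nn_integral_0_iff_AE) auto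
  then have 1: "AE h in PiM (insert a J) \<mu>. rgram (insert a J) h > 0"
    by eventually_elim (simp split: if_splits)
  have "(\<integral>\<^sup>+h. ennreal (rgram (insert a J) h powr (- u)) \<partial>PiM (insert a J) \<mu>) =
    (\<integral>\<^sup>+h. (\<integral>\<^sup>+x. ennreal (rgram (insert a J) (h(a := x)) powr (- u)) \<partial>\<mu> a) \<partial>PiM J \<mu>)"
    using insert.hyps by (intro product_nn_integral_insert) auto
  also have "\<dots> = (\<integral>\<^sup>+h. ennreal (rgram J h powr (- u)) * ennreal ?\<Gamma> \<partial>PiM J \<mu>)"
  proof (rule nn_integral_cong_AE)
    show "AE h in PiM J \<mu>. (\<integral>\<^sup>+x. ennreal (rgram (insert a J) (h(a := x)) powr (- u)) \<partial>\<mu> a) =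
        ennreal (rgram J h powr (- u)) * ennreal ?\<Gamma>"
      using ih
    proof eventually_elim
      case (elim h)
      have [measurable]: "q h \<in> borel_measurable (\<mu> a)" 
        unfolding q_def using s by (simp cong: measurable_cong_sets)
      have "(\<integral>\<^sup>+x. ennreal (rgram (insert a J) (h(a := x)) powr (- u)) \<partial>\<mu> a) =
        (\<integral>\<^sup>+x. ennreal (rgram J h powr (- u)) * ennreal (q h x powr (- u)) \<partial>\<mu> a)"
        using elim q0 by (intro nn_integral_cong) (simp add: up powr_mult ennreal_mult[symmetric] mult.commute)
      also have "\<dots> = ennreal (rgram J h powr (- u)) * ennreal ?\<Gamma>"
        by (subst nn_integral_cmult) (auto simp: col(2)[OF elim])
      finally show ?case .
    qed
  qed
  also have "\<dots> = ennreal (\<Prod>i<card (insert a J). Gamma (real CARD('r) - real i - u) / Gamma (real CARD('r) - real i))"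
    using insert.hyps lt u IH
    by (subst nn_integral_multc) (auto simp: ennreal_mult''[symmetric] Gamma_real_nonneg)
  finally show ?case using 1 by simp
qed

section \<open>From independent entries to Gaussian vectors\<close>

lemma (in prob_space) indep_var_nn_integral:
  assumes "indep_var S X T Y" "f \<in> borel_measurable (S \<Otimes>\<^sub>M T)"
  shows "(\<integral>\<^sup>+\<omega>. f (X \<omega>, Y \<omega>) \<partial>M) = (\<integral>\<^sup>+x. \<integral>\<^sup>+y. f (x, y) \<partial>distr M T Y \<partial>distr M S X)"
proof -
  have m: "X \<in> measurable M S" "Y \<in> measurable M T"
    and eq: "distr M S X \<Otimes>\<^sub>M distr M T Y = distr M (S \<Otimes>\<^sub>M T) (\<lambda>x. (X x, Y x))"
    using assms(1) by (auto simp: indep_var_distribution_eq)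
  interpret Y: prob_space "distr M T Y" by (rule prob_space_distr) (rule m)
  have "(\<integral>\<^sup>+\<omega>. f (X \<omega>, Y \<omega>) \<partial>M) = (\<integral>\<^sup>+z. f z \<partial>distr M (S \<Otimes>\<^sub>M T) (\<lambda>x. (X x, Y x)))"
    using m assms(2) by (subst nn_integral_distr) auto
  also have "\<dots> = (\<integral>\<^sup>+x. \<integral>\<^sup>+y. f (x, y) \<partial>distr M T Y \<partial>distr M S X)"
    unfolding eq[symmetric] using assms(2) by (subst Y.nn_integral_fst) auto
  finally show ?thesis .
qed

lemma std_complex_gaussian_exp_quadratic:
  assumes "prob_space M" "std_complex_gaussian M Z" "a \<ge> 0"
  shows "(\<integral>\<^sup>+\<omega>. ennreal (exp (2 * (v \<bullet> Z \<omega>) - a * (norm (Z \<omega>))\<^sup>2)) \<partial>M) =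
    ennreal ((1 + a) powr (- 1) * exp ((norm v)\<^sup>2 / (1 + a)))"
proof -
  interpret prob_space M by fact
  let ?f = "\<lambda>c x::real. ennreal (exp (2 * c * x - a * x\<^sup>2))"
  have d: "distributed M lborel (\<lambda>\<omega>. Re (Z \<omega>)) (\<lambda>x. ennreal (normal_density 0 (sqrt (1/2)) x))"
    "distributed M lborel (\<lambda>\<omega>. Im (Z \<omega>)) (\<lambda>x. ennreal (normal_density 0 (sqrt (1/2)) x))"
    and ind: "indep_var borel (\<lambda>\<omega>. Re (Z \<omega>)) borel (\<lambda>\<omega>. Im (Z \<omega>))"
    using assms(2) by (auto simp: std_complex_gaussian_def)
  have m [measurable]: "(\<lambda>\<omega>. Re (Z \<omega>)) \<in> borel_measurable M" "(\<lambda>\<omega>. Im (Z \<omega>)) \<in> borel_measurable M"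
    using d distributed_measurable by force+
  have K: "(\<integral>\<^sup>+x. ?f c x \<partial>distr M borel X) = ennreal ((1 + a) powr (- (1/2)) * exp (c\<^sup>2 / (1 + a)))"
    if "distributed M lborel X (\<lambda>x. ennreal (normal_density 0 (sqrt (1/2)) x))" for c X
  proof -
    have "distr M borel X = half_normal"
      using distributed_distr_eq_density[OF that] by (simp cong: distr_cong)
    then show ?thesis using assms(3) by (simp add: half_normal_exp_quadratic)
  qed
  have "(\<integral>\<^sup>+\<omega>. ennreal (exp (2 * (v \<bullet> Z \<omega>) - a * (norm (Z \<omega>))\<^sup>2)) \<partial>M) =
    (\<integral>\<^sup>+\<omega>. (\<lambda>(x, y). ?f (Re v) x * ?f (Im v) y) (Re (Z \<omega>), Im (Z \<omega>)) \<partial>M)"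
    by (intro nn_integral_cong)
       (simp add: ennreal_mult[symmetric] mult_exp_exp inner_complex_def cmod_power2 algebra_simps)
  also have "\<dots> = (\<integral>\<^sup>+x. \<integral>\<^sup>+y. ?f (Re v) x * ?f (Im v) y \<partial>distr M borel (\<lambda>\<omega>. Im (Z \<omega>)) \<partial>distr M borel (\<lambda>\<omega>. Re (Z \<omega>)))"
    by (subst indep_var_nn_integral[OF ind]) auto
  also have "\<dots> = ennreal ((1 + a) powr (- (1/2)) * exp ((Re v)\<^sup>2 / (1 + a))) * ennreal ((1 + a) powr (- (1/2)) * exp ((Im v)\<^sup>2 / (1 + a)))"
    by (simp add: nn_integral_cmult nn_integral_multc K d)
  also have "\<dots> = ennreal ((1 + a) powr (- 1) * exp ((norm v)\<^sup>2 / (1 + a)))"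
  proof -
    have "(1 + a) powr (- (1/2)) * (1 + a) powr (- (1/2)) = (1 + a) powr (- 1)"
      by (simp add: powr_add[symmetric])
    moreover have "exp ((Re v)\<^sup>2 / (1 + a)) * exp ((Im v)\<^sup>2 / (1 + a)) = exp ((norm v)\<^sup>2 / (1 + a))"
      by (simp add: mult_exp_exp cmod_power2 add_divide_distrib)
    ultimately show ?thesis
      by (simp add: ennreal_mult[symmetric] algebra_simps mult.assoc[symmetric])
  qed
  finally show ?thesis .
qed

lemma iid_gaussian_measurable:
  assumes "prob_space M" "iid_gaussian M Z"
  shows "Z i \<in> borel_measurable M"
  using assms by (auto simp: iid_gaussian_def prob_space.indep_vars_def)

lemma iid_gaussian_exp_quadratic:
  fixes Z :: "'i::finite \<Rightarrow> 'w \<Rightarrow> complex"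
  assumes "prob_space M" "iid_gaussian M Z" "a \<ge> 0"
  shows "(\<integral>\<^sup>+\<omega>. ennreal (exp (2 * (\<Sum>i\<in>UNIV. v i \<bullet> Z i \<omega>) - a * (\<Sum>i\<in>UNIV. (norm (Z i \<omega>))\<^sup>2))) \<partial>M) =
    ennreal ((1 + a) powr (- real CARD('i)) * exp ((\<Sum>i\<in>UNIV. (norm (v i))\<^sup>2) / (1 + a)))"
proof -
  interpret prob_space M by fact
  have ind: "indep_vars (\<lambda>_. borel) Z UNIV" and std: "\<And>i. std_complex_gaussian M (Z i)"
    using assms(2) by (auto simp: iid_gaussian_def)
  have "(\<integral>\<^sup>+\<omega>. ennreal (exp (2 * (\<Sum>i\<in>UNIV. v i \<bullet> Z i \<omega>) - a * (\<Sum>i\<in>UNIV. (norm (Z i \<omega>))\<^sup>2))) \<partial>M) =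
    (\<integral>\<^sup>+\<omega>. (\<Prod>i\<in>UNIV. ennreal (exp (2 * (v i \<bullet> Z i \<omega>) - a * (norm (Z i \<omega>))\<^sup>2))) \<partial>M)"
    by (intro nn_integral_cong) (simp add: prod_ennreal exp_sum[symmetric] sum_subtractf sum_distrib_left)
  also have "\<dots> = (\<Prod>i\<in>UNIV. \<integral>\<^sup>+\<omega>. ennreal (exp (2 * (v i \<bullet> Z i \<omega>) - a * (norm (Z i \<omega>))\<^sup>2)) \<partial>M)"
    by (intro indep_vars_nn_integral indep_vars_compose2[OF ind]) auto
  also have "\<dots> = ennreal ((1 + a) powr (- real CARD('i)) * exp ((\<Sum>i\<in>UNIV. (norm (v i))\<^sup>2) / (1 + a)))"
  proof -
    have "(\<Prod>i\<in>UNIV. (1 + a) powr (- 1) * exp ((norm (v i))\<^sup>2 / (1 + a))) =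
        ((1 + a) powr (- 1)) ^ CARD('i) * exp ((\<Sum>i\<in>UNIV. (norm (v i))\<^sup>2) / (1 + a))"
      by (simp only: prod.distrib prod_constant exp_sum[OF finite] sum_divide_distrib)
    also have "((1 + a) powr (- 1)) ^ CARD('i) = (1 + a) powr (- real CARD('i))"
      using assms(3) by (subst powr_power) auto
    finally show ?thesis
      by (simp only: std_complex_gaussian_exp_quadratic[OF assms(1) std assms(3)] prod_ennreal
        mult_nonneg_nonneg[OF powr_ge_zero exp_ge_zero])
  qed
  finally show ?thesis .
qed

lemma borel_measurable_vec_lambda:
  fixes f :: "'a::finite \<Rightarrow> 'w \<Rightarrow> 'b::euclidean_space"
  assumes "\<And>a. f a \<in> borel_measurable M"
  shows "(\<lambda>x. \<chi> a. f a x) \<in> borel_measurable M"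
  using assms by (subst borel_measurable_euclidean_space) (auto simp: Basis_vec_def inner_axis)

lemma gauss_vec_iid_vec:
  fixes Z :: "'r::finite \<Rightarrow> 'w \<Rightarrow> complex"
  assumes "prob_space M" "iid_gaussian M Z"
  shows "gauss_vec (distr M borel (\<lambda>\<omega>. \<chi> a. Z a \<omega>))"
proof -
  have m: "(\<lambda>\<omega>. \<chi> a. Z a \<omega>) \<in> borel_measurable M"
    using iid_gaussian_measurable[OF assms] by (rule borel_measurable_vec_lambda)
  show ?thesis
    unfolding gauss_vec_def
  proof (intro conjI allI impI)
    fix v :: "complex^'r" and a :: real assume a: "a \<ge> 0"
    show "(\<integral>\<^sup>+x. ennreal (exp (2 * (v \<bullet> x) - a * (norm x)\<^sup>2)) \<partial>distr M borel (\<lambda>\<omega>. \<chi> a. Z a \<omega>)) =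
        ennreal ((1 + a) powr (- (real DIM(complex^'r) / 2)) * exp ((norm v)\<^sup>2 / (1 + a)))"
      by (subst nn_integral_distr[OF m], measurable)
         (use iid_gaussian_exp_quadratic[OF assms a, of "\<lambda>i. v $ i"] in
           \<open>auto simp: norm_vec_def L2_set_def inner_vec_def sum_nonneg\<close>)
  qed (auto intro: prob_space.prob_space_distr[OF assms(1) m])
qed

lemma gauss_vec_iid_mat:
  fixes Z :: "'r::finite \<times> 'n::finite \<Rightarrow> 'w \<Rightarrow> complex"
  assumes "prob_space M" "iid_gaussian M Z"
  shows "gauss_vec (distr M borel (\<lambda>\<omega>. \<chi> a b. Z (a, b) \<omega>))"
proof -
  have m: "(\<lambda>\<omega>. \<chi> a b. Z (a, b) \<omega>) \<in> borel_measurable M"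
    using iid_gaussian_measurable[OF assms] by (intro borel_measurable_vec_lambda)
  show ?thesis
    unfolding gauss_vec_def
  proof (intro conjI allI impI)
    fix v :: "complex^'n^'r" and a :: real assume a: "a \<ge> 0"
    show "(\<integral>\<^sup>+x. ennreal (exp (2 * (v \<bullet> x) - a * (norm x)\<^sup>2)) \<partial>distr M borel (\<lambda>\<omega>. \<chi> a b. Z (a, b) \<omega>)) =
        ennreal ((1 + a) powr (- (real DIM(complex^'n^'r) / 2)) * exp ((norm v)\<^sup>2 / (1 + a)))"
      using iid_gaussian_exp_quadratic[OF assms a, of "\<lambda>(i, j). v $ i $ j"]
      by (subst nn_integral_distr[OF m], measurable)
         (simp_all add: norm_vec_def[abs_def] L2_set_def inner_vec_def[abs_def] sum_nonneg
          UNIV_Times_UNIV[symmetric] sum.cartesian_product case_prod_unfold del: UNIV_Times_UNIV)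
  qed (auto intro: prob_space.prob_space_distr[OF assms(1) m])
qed

lemma iid_gaussian_reindex:
  assumes "prob_space M" "iid_gaussian M Z" "inj g"
  shows "iid_gaussian M (\<lambda>i. Z (g i))"
proof -
  interpret prob_space M by fact
  have ind: "indep_vars (\<lambda>_. borel) Z UNIV" using assms(2) by (auto simp: iid_gaussian_def)
  have "indep_vars (\<lambda>i. PiM {g i} (\<lambda>_. borel)) (\<lambda>i \<omega>. restrict (\<lambda>i. Z i \<omega>) {g i}) UNIV"
    using assms(3) by (intro indep_vars_restrict[OF ind]) (auto simp: disjoint_family_on_def inj_def)
  then have "indep_vars (\<lambda>_. borel) (\<lambda>i \<omega>. (\<lambda>f. f (g i)) (restrict (\<lambda>i. Z i \<omega>) {g i})) UNIV"
    by (rule indep_vars_compose2) (auto intro!: measurable_component_singleton)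
  then show ?thesis
    using assms(2) by (simp add: iid_gaussian_def)
qed

section \<open>Moments of the Gram determinant\<close>

definition gram_det :: "complex^'n^'r \<Rightarrow> real" where
  "gram_det A = Re (det (ctranspose A ** A))"

lemma gram_det_eq_rgram: "gram_det A = rgram UNIV (\<lambda>j. column j A)"
  by (simp add: gram_det_def rgram_def gram_mat_columns)

lemma gram_det_nonneg: "gram_det A \<ge> 0"
  by (simp add: gram_det_eq_rgram rgram_basic)

lemma det_ctranspose_self: "det (ctranspose A ** A) = of_real (gram_det A)"
  unfolding gram_det_eq_rgram gram_mat_columns[symmetric] by (rule rgram_basic)

lemma borel_measurable_column [measurable]:
  "(\<lambda>A::complex^'n^'r. column j A) \<in> borel_measurable borel"
  unfolding Finite_Cartesian_Product.column_def
  by (intro borel_measurable_vec_lambda borel_measurable_continuous_onI continuous_intros)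

lemma gram_det_measurable [measurable]: "gram_det \<in> borel_measurable (borel :: (complex^'n^'r) measure)"
proof -
  have "(\<lambda>A. rgram UNIV (\<lambda>j\<in>UNIV. column j A)) \<in> borel_measurable (borel :: (complex^'n^'r) measure)"
    by (rule measurable_compose[OF measurable_restrict rgram_measurable]) auto
  then show ?thesis by (simp add: gram_det_eq_rgram[abs_def] restrict_UNIV)
qed

lemma (in prob_space) indep_vars_groups:
  assumes ind: "indep_vars (\<lambda>_. borel) Z UNIV"
    and K: "disjoint_family K"
    and f: "\<And>j. f j \<in> measurable (PiM (K j) (\<lambda>_. borel)) (N j)"
    and X: "\<And>j \<omega>. X j \<omega> = f j (restrict (\<lambda>i. Z i \<omega>) (K j))"
  shows "indep_vars N X UNIV"
proof -
  have "indep_vars (\<lambda>j. PiM (K j) (\<lambda>_. borel)) (\<lambda>j \<omega>. restrict (\<lambda>i. Z i \<omega>) (K j)) UNIV"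
    using K by (intro indep_vars_restrict[OF ind]) auto
  then have "indep_vars N (\<lambda>j \<omega>. f j (restrict (\<lambda>i. Z i \<omega>) (K j))) UNIV"
    by (rule indep_vars_compose2) (rule f)
  then show ?thesis by (simp add: X[abs_def])
qed

definition gram_moment :: "nat \<Rightarrow> nat \<Rightarrow> real \<Rightarrow> real" where
  "gram_moment n r u = (\<Prod>i<n. Gamma (real r - real i - u) / Gamma (real r - real i))"

text \<open>Columns use disjoint groups of entries, hence are independent Gaussian vectors. Their
  joint law is a product measure, to which the column-by-column computation applies.\<close>

lemma gram_det_powr_nn_integral:
  fixes X :: "'w \<Rightarrow> complex^'n^'r"
  assumes M: "prob_space M" and iid: "iid_gaussian M (\<lambda>(a, b) \<omega>. X \<omega> $ a $ b)"
    and le: "CARD('n) \<le> CARD('r)" and u: "0 < u" "u < 1"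
  shows "AE \<omega> in M. gram_det (X \<omega>) > 0"
    and "(\<integral>\<^sup>+\<omega>. ennreal (gram_det (X \<omega>) powr (- u)) \<partial>M) = ennreal (gram_moment CARD('n) CARD('r) u)"
proof -
  interpret prob_space M by fact
  let ?Z = "\<lambda>(a, b) \<omega>. X \<omega> $ a $ b"
  let ?C = "\<lambda>j \<omega>. column j (X \<omega>)"
  have Z: "indep_vars (\<lambda>_. borel) ?Z UNIV" using iid by (simp add: iid_gaussian_def)
  have col: "?C j = (\<lambda>\<omega>. \<chi> a. ?Z (a, j) \<omega>)" for j by (simp add: Finite_Cartesian_Product.column_def fun_eq_iff)
  have g: "gauss_vec (distr M borel (?C j))" for j
    unfolding col by (intro gauss_vec_iid_vec M iid_gaussian_reindex[OF M iid]) (auto simp: inj_def)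
  have ind: "indep_vars (\<lambda>_. borel) ?C UNIV"
  proof (rule indep_vars_groups[OF Z])
    show "disjoint_family (\<lambda>j. range (\<lambda>a::'r. (a, j)))" by (auto simp: disjoint_family_on_def)
    show "(\<lambda>f. \<chi> a. f (a, j)) \<in> borel_measurable (PiM (range (\<lambda>a::'r. (a, j))) (\<lambda>_. borel :: complex measure))" for j :: 'n
      by (intro borel_measurable_vec_lambda measurable_component_singleton) auto
    show "?C j \<omega> = (\<chi> a. restrict (\<lambda>i. ?Z i \<omega>) (range (\<lambda>a. (a, j))) (a, j))" for j \<omega>
      by (simp add: Finite_Cartesian_Product.column_def)
  qed
  have rv: "random_variable borel (?C j)" for j
    using ind by (auto simp: indep_vars_def)
  have d: "distr M (PiM UNIV (\<lambda>_. borel)) (\<lambda>\<omega>. \<lambda>j\<in>UNIV. ?C j \<omega>) = PiM UNIV (\<lambda>j. distr M borel (?C j))"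
    using ind by (subst (asm) indep_vars_iff_distr_eq_PiM'[OF _ rv]) auto
  have rvj: "(\<lambda>\<omega>. \<lambda>j\<in>UNIV. ?C j \<omega>) \<in> measurable M (PiM UNIV (\<lambda>_. borel))"
    using rv by (intro measurable_restrict) auto
  note R = rgram_powr_nn_integral[where J = "UNIV :: 'n set", OF g u le]
  have [measurable]: "rgram UNIV \<in> borel_measurable (PiM UNIV (\<lambda>_::'n. borel :: (complex^'r) measure))"
    by (rule rgram_measurable) simp
  have eq: "rgram UNIV (\<lambda>j\<in>UNIV. ?C j \<omega>) = gram_det (X \<omega>)" for \<omega>
    by (simp add: gram_det_eq_rgram restrict_UNIV)
  from R have "AE h in distr M (PiM UNIV (\<lambda>_. borel)) (\<lambda>\<omega>. \<lambda>j\<in>UNIV. ?C j \<omega>). rgram UNIV h > 0"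
    unfolding d by simp
  then show "AE \<omega> in M. gram_det (X \<omega>) > 0"
    by (subst (asm) AE_distr_iff[OF rvj]) (auto simp: eq)
  have "(\<integral>\<^sup>+h. ennreal (rgram UNIV h powr (- u)) \<partial>distr M (PiM UNIV (\<lambda>_. borel)) (\<lambda>\<omega>. \<lambda>j\<in>UNIV. ?C j \<omega>)) =
      ennreal (gram_moment CARD('n) CARD('r) u)"
    unfolding d using R by (simp add: gram_moment_def)
  then show "(\<integral>\<^sup>+\<omega>. ennreal (gram_det (X \<omega>) powr (- u)) \<partial>M) = ennreal (gram_moment CARD('n) CARD('r) u)"
    by (subst (asm) nn_integral_distr[OF rvj]) (auto simp: eq)
qed

section \<open>Mean and lower deviations of the logarithm of the Gram determinant\<close>

definition gram_log_mean :: "nat \<Rightarrow> nat \<Rightarrow> real" where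
  "gram_log_mean n r = (\<Sum>i<n. Digamma (real r - real i))"

lemma gram_moment_props:
  assumes "n \<le> r"
  shows "gram_moment n r 0 = 1"
    and "(gram_moment n r has_real_derivative - gram_log_mean n r) (at 0)"
    and "u < 1 \<Longrightarrow> gram_moment n r u > 0"
proof -
  have pos: "real r - real i > 0" "real r - real i \<ge> 1" if "i < n" for i using that assms by auto
  show 0: "gram_moment n r 0 = 1"
    unfolding gram_moment_def using pos(1)[THEN Gamma_real_pos, THEN less_imp_neq] by (intro prod.neutral) auto
  show "gram_moment n r u > 0" if "u < 1"
    unfolding gram_moment_def
  proof (intro prod_pos ballI divide_pos_pos Gamma_real_pos)
    fix i assume "i \<in> {..<n}"
    then show "real r - real i - u > 0" "real r - real i > 0" using pos[of i] that by auto
  qed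
  have "((\<lambda>u. \<Prod>i<n. Gamma (real r - real i - u) / Gamma (real r - real i)) has_field_derivative
     (\<Sum>i<n. - Digamma (real r - real i) * (\<Prod>y\<in>{..<n} - {i}. Gamma (real r - real y - 0) / Gamma (real r - real y)))) (at 0)"
  proof (rule has_field_derivative_prod)
    fix i assume "i \<in> {..<n}"
    then have p: "real r - real i > 0" using pos by simp
    then have "real r - real i \<notin> \<int>\<^sub>\<le>\<^sub>0" by (auto elim!: nonpos_Ints_cases)
    then show "((\<lambda>u. Gamma (real r - real i - u) / Gamma (real r - real i)) has_field_derivative - Digamma (real r - real i)) (at 0)"
      using Gamma_real_pos[OF p] by (auto intro!: derivative_eq_intros)
  qed
  also have "(\<Sum>i<n. - Digamma (real r - real i) * (\<Prod>y\<in>{..<n} - {i}. Gamma (real r - real y - 0) / Gamma (real r - real y))) =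
    (\<Sum>i<n. - Digamma (real r - real i))"
  proof (intro sum.cong refl)
    fix i
    have "(\<Prod>y\<in>{..<n} - {i}. Gamma (real r - real y - 0) / Gamma (real r - real y)) = 1"
      using pos(1)[THEN Gamma_real_pos, THEN less_imp_neq] by (intro prod.neutral) auto
    then show "- Digamma (real r - real i) * (\<Prod>y\<in>{..<n} - {i}. Gamma (real r - real y - 0) / Gamma (real r - real y)) =
      - Digamma (real r - real i)" by simp
  qed
  finally show "(gram_moment n r has_real_derivative - gram_log_mean n r) (at 0)"
    by (simp add: gram_moment_def[abs_def] gram_log_mean_def sum_negf)
qed

text \<open>Convexity of \<open>exp\<close> at \<open>- v * z\<close>, a point between 0 and
  \<open>- u * z\<close> with weight \<open>v / u\<close>. It supplies the monotonicity for the
  monotone convergence argument below.\<close>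

lemma exp_difference_quotient_antimono:
  fixes z :: real
  assumes "0 < v" "v \<le> u"
  shows "(1 - exp (- u * z)) / u \<le> (1 - exp (- v * z)) / v"
proof -
  have "exp ((1 - v / u) *\<^sub>R 0 + (v / u) *\<^sub>R (- u * z)) \<le> (1 - v / u) * exp 0 + (v / u) * exp (- u * z)"
    using assms by (intro convex_onD[OF exp_convex]) auto
  then have "(1 - exp (- u * z)) / u * v \<le> 1 - exp (- v * z)"
    using assms by (simp add: algebra_simps diff_divide_distrib)
  then show ?thesis using assms by (simp only: pos_le_divide_eq)
qed

lemma deriv_at_0_sequence:
  fixes f :: "real \<Rightarrow> real"
  assumes "(f has_real_derivative d) (at 0)"
  shows "(\<lambda>k. (f 0 - f (1 / real (k + 2))) / (1 / real (k + 2))) \<longlonglongrightarrow> - d"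
proof -
  have "((\<lambda>h. (f h - f 0) / h) \<longlongrightarrow> d) (at 0)"
    using assms by (simp add: DERIV_def)
  moreover have "filterlim (\<lambda>k. 1 / real (k + 2)) (at 0) sequentially"
  proof -
    have "(\<lambda>k. 1 / real (k + 2)) \<longlonglongrightarrow> 0"
      using LIMSEQ_ignore_initial_segment[OF lim_const_over_n[of 1], of 2] by simp
    then show ?thesis by (simp add: filterlim_at)
  qed
  ultimately have "(\<lambda>k. (f (1 / real (k + 2)) - f 0) / (1 / real (k + 2))) \<longlonglongrightarrow> d"
    by (rule filterlim_compose)
  from tendsto_minus[OF this] show ?thesis
    by (simp only: minus_divide_left minus_diff_eq)
qed

text \<open>The logarithm of \<open>x\<close> is the increasing limit of
  \<open>(1 - x powr (- u)) / u\<close> as \<open>u\<close> decreases to 0. Monotone convergence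
  gives integrability and the value together, the value being minus the derivative of
  \<open>gram_moment\<close> at 0.\<close>

lemma ln_gram_det_integral:
  fixes X :: "'w \<Rightarrow> complex^'n^'r"
  assumes M: "prob_space M" and iid: "iid_gaussian M (\<lambda>(a, b) \<omega>. X \<omega> $ a $ b)"
    and le: "CARD('n) \<le> CARD('r)"
  shows "integrable M (\<lambda>\<omega>. ln (gram_det (X \<omega>)))"
    and "(\<integral>\<omega>. ln (gram_det (X \<omega>)) \<partial>M) = gram_log_mean CARD('n) CARD('r)"
proof -
  interpret prob_space M by fact
  have [measurable]: "X \<in> borel_measurable M"
  proof -
    have "(\<lambda>\<omega>. \<chi> a b. X \<omega> $ a $ b) \<in> borel_measurable M"
      using iid_gaussian_measurable[OF M iid] by (intro borel_measurable_vec_lambda) (metis case_prod_conv)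
    then show ?thesis by simp
  qed
  note mom = gram_det_powr_nn_integral[OF M iid le]
  \<comment> \<open>The offset 2 keeps every \<open>u k\<close> strictly below 1, the range in which
    the negative moments have been computed.\<close>
  define u where "u k = 1 / real (k + 2)" for k
  have u: "0 < u k" "u k < 1" for k by (auto simp: u_def)
  define f where "f k \<omega> = (1 - gram_det (X \<omega>) powr (- u k)) / u k" for k \<omega>
  have ae: "AE \<omega> in M. gram_det (X \<omega>) > 0" using mom(1)[of "1/2"] by simp
  have bi: "has_bochner_integral M (\<lambda>\<omega>. gram_det (X \<omega>) powr (- u k)) (gram_moment CARD('n) CARD('r) (u k))" for k
    using mom(2)[OF u] gram_moment_props(3)[OF le u(2)] by (intro has_bochner_integral_nn_integral) (auto intro: less_imp_le)
  then have fi: "integrable M (f k)" and fI: "integral\<^sup>L M (f k) = (1 - gram_moment CARD('n) CARD('r) (u k)) / u k" for k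
    unfolding f_def by (auto simp: has_bochner_integral_iff prob_space)
  have fexp: "f k \<omega> = (1 - exp (- u k * ln (gram_det (X \<omega>)))) / u k" if "gram_det (X \<omega>) > 0" for k \<omega>
    using that by (simp add: f_def powr_def)
  have mono: "AE \<omega> in M. mono (\<lambda>k. f k \<omega>)"
    using ae
  proof eventually_elim
    case (elim \<omega>)
    show ?case unfolding fexp[OF elim]
      by (intro monoI exp_difference_quotient_antimono) (auto simp: u_def field_simps)
  qed
  have lim: "AE \<omega> in M. (\<lambda>k. f k \<omega>) \<longlonglongrightarrow> ln (gram_det (X \<omega>))"
    using ae
  proof eventually_elim
    case (elim \<omega>)
    let ?z = "ln (gram_det (X \<omega>))"
    have "((\<lambda>t. exp (- t * ?z)) has_real_derivative - ?z) (at 0)"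
      by (auto intro!: derivative_eq_intros)
    from deriv_at_0_sequence[OF this] show ?case
      unfolding fexp[OF elim] by (simp add: u_def)
  qed
  have ilim: "(\<lambda>k. integral\<^sup>L M (f k)) \<longlonglongrightarrow> gram_log_mean CARD('n) CARD('r)"
    using deriv_at_0_sequence[OF gram_moment_props(2)[OF le]]
    unfolding fI u_def gram_moment_props(1)[OF le] by simp
  show "integrable M (\<lambda>\<omega>. ln (gram_det (X \<omega>)))"
    by (rule integrable_monotone_convergence[OF fi mono lim ilim]) measurable
  show "(\<integral>\<omega>. ln (gram_det (X \<omega>)) \<partial>M) = gram_log_mean CARD('n) CARD('r)"
    by (rule integral_monotone_convergence[OF fi mono lim ilim]) measurable
qed

text \<open>As a function of \<open>u\<close> the product has value 1 and slope
  \<open>- \<epsilon>\<close> at 0, so it falls below 1 just to the right of 0.\<close>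

lemma gram_moment_chernoff:
  assumes "n \<le> r" "\<epsilon> > 0"
  obtains u where "0 < u" "u < 1" "gram_moment n r u * exp (u * (gram_log_mean n r - \<epsilon>)) < 1"
proof -
  let ?f = "\<lambda>u. gram_moment n r u * exp (u * (gram_log_mean n r - \<epsilon>))"
  have "(?f has_real_derivative - \<epsilon>) (at 0)"
    using assms gram_moment_props(1)[of n r]
    by (auto intro!: derivative_eq_intros gram_moment_props(2))
  from DERIV_neg_dec_right[OF this] assms(2)
  obtain d where d: "d > 0" "\<And>h. h > 0 \<Longrightarrow> h < d \<Longrightarrow> ?f h < ?f 0" by auto
  show thesis
    using d(2)[of "min (d / 2) (1 / 2)"] d(1) assms gram_moment_props(1)[of n r]
    by (intro that[of "min (d / 2) (1 / 2)"]) auto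
qed

lemma block_indep:
  fixes H :: "nat \<Rightarrow> 'w \<Rightarrow> complex^'n^'r"
  assumes M: "prob_space M" and iid: "iid_gaussian M (\<lambda>(i, a, b) \<omega>. H i \<omega> $ a $ b)"
  shows "prob_space.indep_vars M (\<lambda>_. borel) H UNIV"
    and "iid_gaussian M (\<lambda>(a, b) \<omega>. H i \<omega> $ a $ b)"
    and "gauss_vec (distr M borel (H i))"
    and "H i \<in> borel_measurable M"
proof -
  interpret prob_space M by fact
  let ?Z = "\<lambda>(i, a, b) \<omega>. H i \<omega> $ a $ b"
  have Z: "indep_vars (\<lambda>_. borel) ?Z UNIV" using iid by (simp add: iid_gaussian_def)
  show ind: "indep_vars (\<lambda>_. borel) H UNIV"
  proof (rule indep_vars_groups[OF Z])
    show "disjoint_family (\<lambda>i. range (\<lambda>(a::'r, b::'n). (i::nat, a, b)))" by (auto simp: disjoint_family_on_def)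
    show "(\<lambda>f. \<chi> a b. f (i, a, b)) \<in> borel_measurable (PiM (range (\<lambda>(a::'r, b::'n). (i::nat, a, b))) (\<lambda>_. borel :: complex measure))" for i
      by (intro borel_measurable_vec_lambda measurable_component_singleton) (auto simp: image_iff)
    show "H i \<omega> = (\<chi> a b. restrict (\<lambda>i. ?Z i \<omega>) (range (\<lambda>(a, b). (i, a, b))) (i, a, b))" for i \<omega>
      by (auto simp: Finite_Cartesian_Product.vec_eq_iff image_iff)
  qed
  have "iid_gaussian M (\<lambda>p. ?Z (i, fst p, snd p))"
    by (rule iid_gaussian_reindex[OF M iid]) (auto simp: inj_def)
  then show 2: "iid_gaussian M (\<lambda>(a, b) \<omega>. H i \<omega> $ a $ b)"
    by (simp add: case_prod_unfold)
  show "gauss_vec (distr M borel (H i))"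
    using gauss_vec_iid_mat[OF M 2] by simp
  show "H i \<in> borel_measurable M" using ind by (auto simp: indep_vars_def)
qed

text \<open>Markov's inequality for the power \<open>- u\<close> of the product; independence of the
  blocks turns the moment into a \<open>k\<close>-th power.\<close>

lemma prod_gram_det_chernoff:
  fixes H :: "nat \<Rightarrow> 'w \<Rightarrow> complex^'n^'r"
  assumes M: "prob_space M" and iid: "iid_gaussian M (\<lambda>(i, a, b) \<omega>. H i \<omega> $ a $ b)"
    and le: "CARD('n) \<le> CARD('r)" and u: "0 < u" "u < 1"
  shows "measure M {\<omega> \<in> space M. (\<Prod>i<k. gram_det (H i \<omega>)) < exp (real k * c)} \<le>
    (gram_moment CARD('n) CARD('r) u * exp (u * c)) ^ k"
proof -
  interpret prob_space M by fact
  note blk = block_indep[OF M iid]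
  have [measurable]: "H i \<in> borel_measurable M" for i by (rule blk)
  let ?A = "{\<omega> \<in> space M. (\<Prod>i<k. gram_det (H i \<omega>)) < exp (real k * c)}"
  let ?\<Phi> = "gram_moment CARD('n) CARD('r) u"
  have ae: "AE \<omega> in M. \<forall>i. gram_det (H i \<omega>) > 0"
    by (subst AE_all_countable) (intro allI gram_det_powr_nn_integral(1)[OF M blk(2) le u])
  have "emeasure M ?A = (\<integral>\<^sup>+\<omega>. indicator ?A \<omega> \<partial>M)" by simp
  also have "\<dots> \<le> (\<integral>\<^sup>+\<omega>. ennreal (exp (u * (real k * c))) * (\<Prod>i<k. ennreal (gram_det (H i \<omega>) powr (- u))) \<partial>M)"
  proof (rule nn_integral_mono_AE)
    show "AE \<omega> in M. indicator ?A \<omega> \<le> ennreal (exp (u * (real k * c))) * (\<Prod>i<k. ennreal (gram_det (H i \<omega>) powr (- u)))"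
      using ae
    proof eventually_elim
      case (elim \<omega>)
      let ?P = "\<Prod>i<k. gram_det (H i \<omega>)"
      have P: "?P > 0" using elim by (intro prod_pos) auto
      have pp: "(\<Prod>i<k. gram_det (H i \<omega>) powr (- u)) = ?P powr (- u)"
        using elim by (subst prod_powr_distrib) (auto intro: less_imp_le)
      have "1 \<le> exp (u * (real k * c)) * ?P powr (- u)" if "?P < exp (real k * c)"
      proof -
        have "ln ?P < real k * c" using that P by (metis ln_exp ln_less_cancel_iff exp_gt_zero)
        then have "u * ln ?P \<le> u * (real k * c)" using u by simp
        then show ?thesis using P by (simp add: powr_def mult_exp_exp less_imp_neq[OF P, symmetric] del: prod_zero_iff)
      qed
      then show ?case
        by (auto simp: prod_ennreal pp ennreal_mult[symmetric] split: split_indicator)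
    qed
  qed
  also have "\<dots> = ennreal (exp (u * (real k * c))) * (\<integral>\<^sup>+\<omega>. (\<Prod>i<k. ennreal (gram_det (H i \<omega>) powr (- u))) \<partial>M)"
    by (rule nn_integral_cmult) measurable
  also have "(\<integral>\<^sup>+\<omega>. (\<Prod>i<k. ennreal (gram_det (H i \<omega>) powr (- u))) \<partial>M) = (\<Prod>i<k. \<integral>\<^sup>+\<omega>. ennreal (gram_det (H i \<omega>) powr (- u)) \<partial>M)"
  proof (rule indep_vars_nn_integral)
    have "indep_vars (\<lambda>_. borel) H {..<k}" using blk(1) by (rule indep_vars_subset) auto
    then show "indep_vars (\<lambda>_. borel) (\<lambda>i \<omega>. ennreal (gram_det (H i \<omega>) powr (- u))) {..<k}"
      by (rule indep_vars_compose2) measurable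
  qed auto
  also have "\<dots> = ennreal (?\<Phi> ^ k)"
    using gram_moment_props(3)[OF le u(2)]
    by (simp add: gram_det_powr_nn_integral(2)[OF M blk(2) le u] ennreal_power)
  also have "ennreal (exp (u * (real k * c))) * ennreal (?\<Phi> ^ k) = ennreal ((?\<Phi> * exp (u * c)) ^ k)"
    using gram_moment_props(3)[OF le u(2)]
    by (simp add: ennreal_mult[symmetric] power_mult_distrib exp_of_nat_mult[symmetric] mult.commute mult.left_commute)
  finally show ?thesis
    using gram_moment_props(3)[OF le u(2)] by (simp add: emeasure_eq_measure)
qed

section \<open>Volumes of ellipsoids\<close>

definition quad_form :: "nat \<Rightarrow> (nat \<Rightarrow> nat \<Rightarrow> real) \<Rightarrow> (nat \<Rightarrow> real) \<Rightarrow> real" where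
  "quad_form d G c = (\<Sum>i<d. \<Sum>j<d. G i j * c i * c j)"

definition schur :: "nat \<Rightarrow> (nat \<Rightarrow> nat \<Rightarrow> real) \<Rightarrow> nat \<Rightarrow> nat \<Rightarrow> real" where
  "schur d G i j = G i j - G i d * G d j / G d d"

lemma det_schur:
  assumes "G d d \<noteq> 0"
  shows "Determinant.det (Matrix.mat (Suc d) (Suc d) (\<lambda>(i, j). G i j)) =
    G d d * Determinant.det (Matrix.mat d d (\<lambda>(i, j). schur d G i j))"
proof -
  let ?M = "Matrix.mat (Suc d) (Suc d) (\<lambda>(i, j). G i j)"
  \<comment> \<open>A unit triangular row operation that subtracts multiples of the last row so as
    to clear the last column above its diagonal entry.\<close>
  define U where "U = Matrix.mat (Suc d) (Suc d)
    (\<lambda>(i, j). if i = j then 1 else if j = d \<and> i < d then - G i d / G d d else 0)"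
  define B where "B = four_block_mat (Matrix.mat d d (\<lambda>(i, j). schur d G i j)) (0\<^sub>m d 1)
    (Matrix.mat 1 d (\<lambda>(i, j). G d j)) (Matrix.mat 1 1 (\<lambda>_. G d d))"
  have U: "U \<in> carrier_mat (Suc d) (Suc d)" by (simp add: U_def)
  have "Determinant.det U = prod_list (diag_mat U)"
    by (rule det_upper_triangular[OF _ U]) (auto simp: U_def)
  also have "\<dots> = 1"
    unfolding prod_list_diag_prod by (intro prod.neutral) (auto simp: U_def)
  finally have dU: "Determinant.det U = 1" .
  have "U * ?M = B"
  proof (rule eq_matI)
    fix i j assume "i < dim_row B" "j < dim_col B"
    then have ij: "i < Suc d" "j < Suc d" by (auto simp: B_def)
    have "(U * ?M) $$ (i, j) = (\<Sum>l\<in>{0..<Suc d}. U $$ (i, l) * G l j)"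
      using ij by (simp add: U_def Matrix.scalar_prod_def)
    also have "\<dots> = (if i < d then G i j - G i d / G d d * G d j else G d j)"
    proof (cases "i < d")
      case True
      have "(\<Sum>l\<in>{0..<d}. U $$ (i, l) * G l j) = (\<Sum>l\<in>{0..<d}. if l = i then G i j else 0)"
        using True by (intro sum.cong) (auto simp: U_def)
      moreover have "U $$ (i, d) = - G i d / G d d" using True by (simp add: U_def)
      ultimately show ?thesis using True by simp
    next
      case False
      then have [simp]: "i = d" using ij by simp
      have "(\<Sum>l\<in>{0..<Suc d}. U $$ (i, l) * G l j) = (\<Sum>l\<in>{0..<d}. 0) + G d j"
        by (auto simp: U_def intro!: sum.neutral)
      then show ?thesis by simp
    qed
    also have "\<dots> = B $$ (i, j)"
      using ij assms by (auto simp: B_def schur_def less_Suc_eq)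
    finally show "(U * ?M) $$ (i, j) = B $$ (i, j)" .
  qed (auto simp: B_def U_def)
  then have "Determinant.det B = Determinant.det U * Determinant.det ?M"
    using det_mult[OF U, of ?M] by simp
  moreover have "Determinant.det B = Determinant.det (Matrix.mat d d (\<lambda>(i, j). schur d G i j)) * G d d"
    unfolding B_def by (subst det_four_block_mat_upper_right_zero_col) (auto simp: det_single)
  ultimately show ?thesis unfolding dU by (simp only: mult_1 mult.commute)
qed

text \<open>Completing the square in the last coordinate; what is left over is the form of the Schur
  complement.\<close>

lemma quad_form_schur:
  assumes "G d d \<noteq> 0" "\<And>i. i < d \<Longrightarrow> G d i = G i d"
  shows "quad_form (Suc d) G c = G d d * (c d + (\<Sum>i<d. G i d / G d d * c i))\<^sup>2 + quad_form d (schur d G) c"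
proof -
  define s where "s = (\<Sum>i<d. G i d * c i)"
  have "quad_form (Suc d) G c = (\<Sum>i<d. \<Sum>j<d. G i j * c i * c j) + 2 * c d * s + G d d * (c d)\<^sup>2"
    using assms(2)
    by (simp add: quad_form_def s_def sum.distrib sum_distrib_left algebra_simps power2_eq_square)
  moreover have "quad_form d (schur d G) c = (\<Sum>i<d. \<Sum>j<d. G i j * c i * c j) - s * s / G d d"
  proof -
    have "quad_form d (schur d G) c = (\<Sum>i<d. \<Sum>j<d. G i j * c i * c j) - (\<Sum>i<d. \<Sum>j<d. (G i d * c i) * (G j d * c j)) / G d d"
      using assms(2)
      by (simp add: quad_form_def schur_def sum_subtractf[symmetric] sum_divide_distrib algebra_simps)
    then show ?thesis by (simp add: s_def sum_product)
  qed
  moreover have "(\<Sum>i<d. G i d / G d d * c i) = s / G d d"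
    by (simp add: s_def sum_divide_distrib)
  moreover have "x + 2 * y * s + g * y\<^sup>2 = g * (y + s / g)\<^sup>2 + (x - s * s / g)" if "g \<noteq> 0" for x y g :: real
    using that by (simp add: power2_eq_square field_simps)
  ultimately show ?thesis
    using assms(1) by (simp only:)
qed

definition pos_def :: "nat \<Rightarrow> (nat \<Rightarrow> nat \<Rightarrow> real) \<Rightarrow> bool" where
  "pos_def d G \<longleftrightarrow> (\<forall>i<d. \<forall>j<d. G i j = G j i) \<and> (\<forall>c. (\<exists>i<d. c i \<noteq> 0) \<longrightarrow> quad_form d G c > 0)"

lemma pos_def_schur:
  assumes "pos_def (Suc d) G"
  shows "G d d > 0" "pos_def d (schur d G)" "\<And>i. i < d \<Longrightarrow> G d i = G i d"
proof -
  have sym: "G i j = G j i" if "i < Suc d" "j < Suc d" for i j using assms that by (auto simp: pos_def_def)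
  have pos: "quad_form (Suc d) G c > 0" if "\<exists>i<Suc d. c i \<noteq> 0" for c using assms that by (auto simp: pos_def_def)
  have "quad_form (Suc d) G (\<lambda>i. if i = d then 1 else 0) = G d d"
    by (simp add: quad_form_def)
  then show g: "G d d > 0" using pos[of "\<lambda>i. if i = d then 1 else 0"] by auto
  show s: "\<And>i. i < d \<Longrightarrow> G d i = G i d" using sym by auto
  have "quad_form d (schur d G) c > 0" if c: "\<exists>i<d. c i \<noteq> 0" for c
  proof -
    \<comment> \<open>The last coordinate is chosen to annihilate the completed square, so both
      forms take the same value.\<close>
    define c' where "c' = c(d := - (\<Sum>i<d. G i d / G d d * c i))"
    have "(\<Sum>i<d. G i d / G d d * c' i) = (\<Sum>i<d. G i d / G d d * c i)"
      by (intro sum.cong) (auto simp: c'_def)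
    moreover have "quad_form d (schur d G) c' = quad_form d (schur d G) c"
      unfolding quad_form_def by (intro sum.cong) (auto simp: c'_def)
    ultimately have "quad_form (Suc d) G c' = quad_form d (schur d G) c"
      using quad_form_schur[of G d c'] g s by (simp add: c'_def)
    moreover have "\<exists>i<Suc d. c' i \<noteq> 0" using c by (auto simp: c'_def intro: less_SucI)
    ultimately show ?thesis using pos by metis
  qed
  then show "pos_def d (schur d G)"
    using sym by (auto simp: pos_def_def schur_def)
qed

lemma quad_form_nonneg: "pos_def d G \<Longrightarrow> quad_form d G c \<ge> 0"
proof -
  assume "pos_def d G"
  then have "quad_form d G c > 0" if "\<exists>i<d. c i \<noteq> 0" using that by (auto simp: pos_def_def)
  moreover have "quad_form d G c = 0" if "\<not> (\<exists>i<d. c i \<noteq> 0)"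
    unfolding quad_form_def using that by (intro sum.neutral ballI) auto
  ultimately show ?thesis by fastforce
qed

lemma det_pos_def: "pos_def d G \<Longrightarrow> Determinant.det (Matrix.mat d d (\<lambda>(i, j). G i j)) > 0"
proof (induction d arbitrary: G)
  case (Suc d)
  note s = pos_def_schur[OF Suc.prems]
  show ?case using det_schur[of G d] s(1) Suc.IH[OF s(2)] by simp
qed simp

text \<open>Serves to make bounded sets of lattice points finite, since a bounded form leaves
  finitely many integer coefficient vectors. In the induction, the last coordinate differs from the
  quantity in the completed square by a linear form in the others, which Cauchy-Schwarz
  bounds.\<close>

lemma pos_def_coord_bound: "pos_def d G \<Longrightarrow> \<exists>C\<ge>0. \<forall>c. \<forall>i<d. (c i)\<^sup>2 \<le> C * quad_form d G c"
proof (induction d arbitrary: G)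
  case (Suc d)
  note s = pos_def_schur[OF Suc.prems]
  obtain C where C: "C \<ge> 0" "\<And>c i. i < d \<Longrightarrow> (c i)\<^sup>2 \<le> C * quad_form d (schur d G) c"
    using Suc.IH[OF s(2)] by auto
  define B where "B = (\<Sum>i<d. (G i d / G d d)\<^sup>2)"
  define C' where "C' = C + 2 / G d d + 2 * (B * (real d * C))"
  have B: "B \<ge> 0" by (simp add: B_def sum_nonneg)
  show ?case
  proof (intro exI[of _ C'] conjI allI impI)
    show "C' \<ge> 0" using C(1) s(1) B by (simp add: C'_def)
    fix c i assume i: "i < Suc d"
    let ?q = "quad_form (Suc d) G c" let ?q' = "quad_form d (schur d G) c"
    let ?\<beta> = "\<Sum>i<d. G i d / G d d * c i"
    have q: "?q = G d d * (c d + ?\<beta>)\<^sup>2 + ?q'"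
      using s by (intro quad_form_schur) auto
    have q': "0 \<le> ?q'" "?q' \<le> ?q" using quad_form_nonneg[OF s(2)] s(1) by (auto simp: q)
    have t: "0 \<le> C * ?q" "0 \<le> 2 / G d d * ?q" "0 \<le> 2 * (B * (real d * C)) * ?q"
      using q' C(1) s(1) B by (auto intro!: mult_nonneg_nonneg)
    have C'q: "C' * ?q = C * ?q + 2 / G d d * ?q + 2 * (B * (real d * C)) * ?q"
      by (simp add: C'_def distrib_right)
    show "(c i)\<^sup>2 \<le> C' * ?q"
    proof (cases "i < d")
      case True
      then have "(c i)\<^sup>2 \<le> C * ?q" using C(2)[OF True, of c] q'(2) C(1) by (meson mult_left_mono order_trans)
      then show ?thesis using t unfolding C'q by linarith
    next
      case False
      then have [simp]: "i = d" using i by simp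
      have "(\<Sum>i<d. (c i)\<^sup>2) \<le> (\<Sum>i<d. C * ?q)"
        using C q' by (intro sum_mono) (meson lessThan_iff mult_left_mono order_trans)
      then have "?\<beta>\<^sup>2 \<le> B * (real d * C * ?q)"
        using Cauchy_Schwarz_ineq_sum[of "\<lambda>i. G i d / G d d" c "{..<d}"] B
        by (force simp: B_def[symmetric] algebra_simps intro: order_trans mult_left_mono)
      moreover have "(c d + ?\<beta>)\<^sup>2 \<le> ?q / G d d"
        using s(1) q q'(1) by (simp add: field_simps)
      moreover have "(c d)\<^sup>2 \<le> 2 * (c d + ?\<beta>)\<^sup>2 + 2 * ?\<beta>\<^sup>2"
      proof -
        have "x\<^sup>2 \<le> 2 * (x + y)\<^sup>2 + 2 * y\<^sup>2" for x y :: real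
          using zero_le_power2[of "x + 2 * y"] by (simp add: power2_eq_square algebra_simps)
        then show ?thesis .
      qed
      ultimately have "(c d)\<^sup>2 \<le> 2 * (?q / G d d) + 2 * (B * (real d * C * ?q))" by linarith
      also have "\<dots> = 2 / G d d * ?q + 2 * (B * (real d * C)) * ?q" by simp
      finally show ?thesis using t(1) unfolding C'q \<open>i = d\<close> by linarith
    qed
  qed
qed auto

lemma quad_form_measurable [measurable]:
  assumes "d \<le> e"
  shows "quad_form d G \<in> borel_measurable (PiM {..<e} (\<lambda>_. lborel))"
proof -
  have "(\<lambda>c. c i) \<in> borel_measurable (PiM {..<e} (\<lambda>_. lborel))" if "i < d" for i
    using measurable_component_singleton[of i "{..<e}" "\<lambda>_. lborel :: real measure"] that assms by simp
  then show ?thesis unfolding quad_form_def[abs_def]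
    by (intro borel_measurable_sum borel_measurable_times borel_measurable_const) auto
qed

text \<open>A linear change of variables carried out one coordinate at a time: a one-dimensional
  affine substitution normalizes the completed square and contributes \<open>1 / sqrt g\<close>, and
  the Schur complement takes the other coordinates. \<open>F\<close> is arbitrary because the
  induction hypothesis is applied to \<open>F\<close> shifted by \<open>y\<^sup>2\<close>.\<close>

lemma nn_integral_quad_form:
  fixes F :: "real \<Rightarrow> ennreal"
  assumes "pos_def d G" "F \<in> borel_measurable borel"
  shows "(\<integral>\<^sup>+c. F (quad_form d G c) \<partial>PiM {..<d} (\<lambda>_. lborel)) =
    ennreal (1 / sqrt (Determinant.det (Matrix.mat d d (\<lambda>(i, j). G i j)))) *
      (\<integral>\<^sup>+c. F (\<Sum>i<d. (c i)\<^sup>2) \<partial>PiM {..<d} (\<lambda>_. lborel))"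
  using assms
proof (induction d arbitrary: G F)
  case 0
  then show ?case by (simp add: quad_form_def)
next
  case (Suc d)
  interpret product_sigma_finite "\<lambda>_. lborel :: real measure" ..
  interpret Pd: sigma_finite_measure "PiM {..<d} (\<lambda>_. lborel :: real measure)"
    by (rule sigma_finite) simp
  note [measurable] = Suc.prems(2)
  note s = pos_def_schur[OF Suc.prems(1)]
  define g where "g = G d d"
  have g: "g > 0" using s by (simp add: g_def)
  define G' where "G' = schur d G"
  let ?\<beta> = "\<lambda>c. \<Sum>i<d. G i d / G d d * c i"
  let ?D = "Determinant.det (Matrix.mat d d (\<lambda>(i, j). G' i j))"
  have D: "?D > 0" using det_pos_def[OF s(2)] by (simp add: G'_def)
  have c: "(\<lambda>c. c i) \<in> borel_measurable (PiM {..<e} (\<lambda>_. lborel))" if "i < e" for i e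
    using measurable_component_singleton[of i "{..<e}" "\<lambda>_. lborel :: real measure"] that by simp
  have [measurable]: "(\<lambda>c. c d) \<in> borel_measurable (PiM {..<Suc d} (\<lambda>_. lborel))" using c by simp
  have [measurable]: "quad_form d G' \<in> borel_measurable (PiM {..<Suc d} (\<lambda>_. lborel))"
    "quad_form d G' \<in> borel_measurable (PiM {..<d} (\<lambda>_. lborel))"
    "quad_form (Suc d) G \<in> borel_measurable (PiM {..<Suc d} (\<lambda>_. lborel))"
    by (intro quad_form_measurable, simp)+
  have [measurable]: "(\<lambda>c. \<Sum>i<e. (c i)\<^sup>2) \<in> borel_measurable (PiM {..<e} (\<lambda>_. lborel :: real measure))" for e :: nat
    by (intro borel_measurable_sum borel_measurable_power) (auto intro: c)
  have qu: "quad_form d G' (c(d := y)) = quad_form d G' c" for c y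
    unfolding quad_form_def by (intro sum.cong) auto
  have ins: "{..<Suc d} = insert d {..<d}" by auto
  have affine: "(\<integral>\<^sup>+y. F (g * (y + \<beta>)\<^sup>2 + q) \<partial>lborel) = ennreal (1 / sqrt g) * (\<integral>\<^sup>+y. F (y\<^sup>2 + q) \<partial>lborel)" for \<beta> q
  proof -
    have "(\<integral>\<^sup>+y. F (g * (y + \<beta>)\<^sup>2 + q) \<partial>lborel) =
      ennreal \<bar>1 / sqrt g\<bar> * (\<integral>\<^sup>+y. F (g * ((- \<beta> + 1 / sqrt g * y) + \<beta>)\<^sup>2 + q) \<partial>lborel)"
      using g by (intro nn_integral_real_affine) auto
    then show ?thesis using g by (simp add: power_divide)
  qed
  have "(\<integral>\<^sup>+c. F (quad_form (Suc d) G c) \<partial>PiM {..<Suc d} (\<lambda>_. lborel)) =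
    (\<integral>\<^sup>+c. \<integral>\<^sup>+y. F (quad_form (Suc d) G (c(d := y))) \<partial>lborel \<partial>PiM {..<d} (\<lambda>_. lborel))"
    unfolding ins by (rule product_nn_integral_insert) (auto simp flip: ins)
  also have "\<dots> = (\<integral>\<^sup>+c. ennreal (1 / sqrt g) * (\<integral>\<^sup>+y. F (y\<^sup>2 + quad_form d G' c) \<partial>lborel) \<partial>PiM {..<d} (\<lambda>_. lborel))"
  proof (rule nn_integral_cong)
    fix c :: "nat \<Rightarrow> real"
    have "?\<beta> (c(d := y)) = ?\<beta> c" for y by (intro sum.cong) auto
    then have "quad_form (Suc d) G (c(d := y)) = g * (y + ?\<beta> c)\<^sup>2 + quad_form d G' c" for y
      using quad_form_schur[of G d "c(d := y)"] s g qu[of c y] by (simp add: g_def G'_def)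
    then show "(\<integral>\<^sup>+y. F (quad_form (Suc d) G (c(d := y))) \<partial>lborel) =
      ennreal (1 / sqrt g) * (\<integral>\<^sup>+y. F (y\<^sup>2 + quad_form d G' c) \<partial>lborel)"
      by (simp add: affine)
  qed
  also have "\<dots> = ennreal (1 / sqrt g) * (\<integral>\<^sup>+c. \<integral>\<^sup>+y. F (y\<^sup>2 + quad_form d G' c) \<partial>lborel \<partial>PiM {..<d} (\<lambda>_. lborel))"
    by (rule nn_integral_cmult) measurable
  also have "(\<integral>\<^sup>+c. \<integral>\<^sup>+y. F (y\<^sup>2 + quad_form d G' c) \<partial>lborel \<partial>PiM {..<d} (\<lambda>_. lborel)) =
    (\<integral>\<^sup>+c. F ((c d)\<^sup>2 + quad_form d G' c) \<partial>PiM {..<Suc d} (\<lambda>_. lborel))"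
    unfolding ins by (subst product_nn_integral_insert) (auto simp: qu simp flip: ins)
  also have "\<dots> = (\<integral>\<^sup>+y. \<integral>\<^sup>+c. F (y\<^sup>2 + quad_form d G' c) \<partial>PiM {..<d} (\<lambda>_. lborel) \<partial>lborel)"
    unfolding ins by (subst product_nn_integral_insert_rev) (auto simp: qu simp flip: ins)
  also have "\<dots> = (\<integral>\<^sup>+y. ennreal (1 / sqrt ?D) * (\<integral>\<^sup>+c. F (y\<^sup>2 + (\<Sum>i<d. (c i)\<^sup>2)) \<partial>PiM {..<d} (\<lambda>_. lborel)) \<partial>lborel)"
    using s(2) by (intro nn_integral_cong Suc.IH) (auto simp: G'_def)
  also have "\<dots> = ennreal (1 / sqrt ?D) * (\<integral>\<^sup>+y. \<integral>\<^sup>+c. F (y\<^sup>2 + (\<Sum>i<d. (c i)\<^sup>2)) \<partial>PiM {..<d} (\<lambda>_. lborel) \<partial>lborel)"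
    by (rule nn_integral_cmult) (rule Pd.borel_measurable_nn_integral, measurable)
  also have "(\<integral>\<^sup>+y. \<integral>\<^sup>+c. F (y\<^sup>2 + (\<Sum>i<d. (c i)\<^sup>2)) \<partial>PiM {..<d} (\<lambda>_. lborel) \<partial>lborel) =
    (\<integral>\<^sup>+c. F (\<Sum>i<Suc d. (c i)\<^sup>2) \<partial>PiM {..<Suc d} (\<lambda>_. lborel))"
  proof -
    have sq: "(\<Sum>i<d. ((x(d := y)) i)\<^sup>2) = (\<Sum>i<d. (x i)\<^sup>2)" for x :: "nat \<Rightarrow> real" and y
      by (intro sum.cong) auto
    have "(\<integral>\<^sup>+c. F (\<Sum>i<Suc d. (c i)\<^sup>2) \<partial>PiM (insert d {..<d}) (\<lambda>_. lborel)) =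
      (\<integral>\<^sup>+y. \<integral>\<^sup>+x. F (\<Sum>i<Suc d. ((x(d := y)) i)\<^sup>2) \<partial>PiM {..<d} (\<lambda>_. lborel) \<partial>lborel)"
      by (rule product_nn_integral_insert_rev) (auto simp flip: ins simp del: sum.lessThan_Suc)
    then show ?thesis by (simp add: sq add.commute ins[symmetric])
  qed
  also have "ennreal (1 / sqrt g) * (ennreal (1 / sqrt ?D) * (\<integral>\<^sup>+c. F (\<Sum>i<Suc d. (c i)\<^sup>2) \<partial>PiM {..<Suc d} (\<lambda>_. lborel))) =
    ennreal (1 / sqrt (Determinant.det (Matrix.mat (Suc d) (Suc d) (\<lambda>(i, j). G i j)))) *
      (\<integral>\<^sup>+c. F (\<Sum>i<Suc d. (c i)\<^sup>2) \<partial>PiM {..<Suc d} (\<lambda>_. lborel))"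
    using det_schur[of G d] g D
    by (simp add: mult.assoc[symmetric] ennreal_mult[symmetric] real_sqrt_mult G'_def g_def)
  finally show ?case .
qed

lemma ellipsoid_volume:
  assumes G: "pos_def (2 * N) G" and \<rho>: "\<rho> > 0"
  shows "emeasure (PiM {..<2 * N} (\<lambda>_. lborel)) {c \<in> space (PiM {..<2 * N} (\<lambda>_. lborel)). quad_form (2 * N) G c \<le> \<rho>} =
    ennreal ((pi * \<rho>) ^ N / (fact N * sqrt (Determinant.det (Matrix.mat (2 * N) (2 * N) (\<lambda>(i, j). G i j)))))"
proof -
  let ?P = "PiM {..<2 * N} (\<lambda>_. lborel :: real measure)" and ?D = "Determinant.det (Matrix.mat (2 * N) (2 * N) (\<lambda>(i, j). G i j))"
  have [measurable]: "quad_form (2 * N) G \<in> borel_measurable ?P" by (rule quad_form_measurable) simp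
  have c: "(\<lambda>c. c i) \<in> borel_measurable ?P" if "i < 2 * N" for i
    using measurable_component_singleton[of i "{..<2 * N}" "\<lambda>_. lborel :: real measure"] that by simp
  have [measurable]: "(\<lambda>c. \<Sum>i<2 * N. (c i)\<^sup>2) \<in> borel_measurable ?P"
    unfolding power2_eq_square by (intro borel_measurable_sum borel_measurable_times c) auto
  have "emeasure ?P {c \<in> space ?P. quad_form (2 * N) G c \<le> \<rho>} = (\<integral>\<^sup>+c. indicator {c \<in> space ?P. quad_form (2 * N) G c \<le> \<rho>} c \<partial>?P)"
    by (simp add: nn_integral_indicator)
  also have "\<dots> = (\<integral>\<^sup>+c. indicator {..\<rho>} (quad_form (2 * N) G c) \<partial>?P)"
    by (intro nn_integral_cong) (auto split: split_indicator)
  also have "\<dots> = ennreal (1 / sqrt ?D) * (\<integral>\<^sup>+c. indicator {..\<rho>} (\<Sum>i<2 * N. (c i)\<^sup>2) \<partial>?P)"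
    by (rule nn_integral_quad_form[OF G]) simp
  also have "(\<integral>\<^sup>+c. indicator {..\<rho>} (\<Sum>i<2 * N. (c i)\<^sup>2) \<partial>?P) =
    (\<integral>\<^sup>+c. indicator ({c. sqrt (\<Sum>i<2 * N. (c i)\<^sup>2) \<le> sqrt \<rho>} \<inter> space ?P) c \<partial>?P)"
    by (intro nn_integral_cong) (auto split: split_indicator)
  also have "\<dots> = emeasure ?P ({c. sqrt (\<Sum>i<2 * N. (c i)\<^sup>2) \<le> sqrt \<rho>} \<inter> space ?P)"
  proof (rule nn_integral_indicator)
    have "{c \<in> space ?P. (\<Sum>i<2 * N. (c i)\<^sup>2) \<le> \<rho>} \<in> sets ?P" by measurable
    then show "{c. sqrt (\<Sum>i<2 * N. (c i)\<^sup>2) \<le> sqrt \<rho>} \<inter> space ?P \<in> sets ?P"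
      by (rule back_subst[where P = "\<lambda>A. A \<in> sets ?P"]) auto
  qed
  also have "\<dots> = ennreal (unit_ball_vol (real (2 * N)) * sqrt \<rho> ^ (2 * N))"
    using emeasure_cball_aux[of "{..<2 * N}" "sqrt \<rho>"] \<rho> by simp
  also have "unit_ball_vol (real (2 * N)) = pi ^ N / fact N"
    by (rule unit_ball_vol_even)
  also have "sqrt \<rho> ^ (2 * N) = \<rho> ^ N" using \<rho> by (simp add: power_mult)
  finally show ?thesis
    using det_pos_def[OF G] \<rho> by (simp add: ennreal_mult'[symmetric] power_mult_distrib mult.commute)
qed

section \<open>Translates of the integer lattice\<close>

lemma nn_integral_PiM_lborel_translate:
  fixes f :: "('i \<Rightarrow> real) \<Rightarrow> ennreal"
  assumes "finite I" and f: "f \<in> borel_measurable (PiM I (\<lambda>_. lborel))"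
  shows "(\<integral>\<^sup>+x. f (\<lambda>i\<in>I. x i + z i) \<partial>PiM I (\<lambda>_. lborel)) = (\<integral>\<^sup>+x. f x \<partial>PiM I (\<lambda>_. lborel))"
proof -
  interpret product_sigma_finite "\<lambda>_. lborel :: real measure" ..
  let ?P = "PiM I (\<lambda>_. lborel :: real measure)" and ?T = "\<lambda>x. \<lambda>i\<in>I. x i + z i"
  have T: "?T \<in> measurable ?P ?P"
  proof (rule measurable_restrict)
    fix i assume "i \<in> I"
    then have "(\<lambda>x. x i) \<in> borel_measurable ?P"
      using measurable_component_singleton[of i I "\<lambda>_. lborel :: real measure"] by simp
    then show "(\<lambda>x. x i + z i) \<in> measurable ?P lborel" by simp
  qed
  have "?P = distr ?P ?P ?T"
  proof (rule PiM_eqI[symmetric])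
    fix A :: "'i \<Rightarrow> real set" assume A: "\<And>i. i \<in> I \<Longrightarrow> A i \<in> sets lborel"
    have tr: "emeasure lborel ((\<lambda>x. x + z i) -` A i) = emeasure lborel (A i)" if "i \<in> I" for i
    proof -
      have "emeasure lborel (A i) = emeasure (distr lborel borel ((+) (z i))) (A i)"
        by (simp add: lborel_distr_plus)
      then show ?thesis using A[OF that] by (simp add: emeasure_distr add.commute vimage_def)
    qed
    have m: "(\<lambda>x. x + z i) -` A i \<in> sets lborel" if "i \<in> I" for i
      using measurable_sets[of "\<lambda>x. x + z i" borel borel "A i"] A[OF that] by simp
    have "?T -` PiE I A \<inter> space ?P = PiE I (\<lambda>i. (\<lambda>x. x + z i) -` A i)"
      by (auto simp: space_PiM PiE_def extensional_def Pi_def)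
    then have "emeasure (distr ?P ?P ?T) (PiE I A) = emeasure ?P (PiE I (\<lambda>i. (\<lambda>x. x + z i) -` A i))"
      using A assms(1) by (subst emeasure_distr[OF T]) (auto intro: sets_PiM_I_finite)
    also have "\<dots> = (\<Prod>i\<in>I. emeasure lborel (A i))"
      using m assms(1) by (subst emeasure_PiM) (auto simp: tr)
    finally show "emeasure (distr ?P ?P ?T) (PiE I A) = (\<Prod>i\<in>I. emeasure lborel (A i))" .
  qed (use assms in auto)
  then have "(\<integral>\<^sup>+x. f x \<partial>?P) = (\<integral>\<^sup>+x. f x \<partial>distr ?P ?P ?T)" by simp
  also have "\<dots> = (\<integral>\<^sup>+x. f (?T x) \<partial>?P)" by (rule nn_integral_distr[OF T]) (use f in simp)
  finally show ?thesis by simp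
qed

text \<open>Cutting space into integer unit cubes and moving them all onto the cube at 0 shows that
  the number of integer translates of \<open>x\<close> lying in \<open>E\<close>, averaged over that
  cube, equals the volume \<open>T\<close>. Some \<open>x\<close> must reach the average.\<close>

lemma integer_translate_pigeonhole:
  fixes E :: "('i \<Rightarrow> real) set"
  assumes "finite I" and E: "E \<in> sets (PiM I (\<lambda>_. lborel))"
    and vol: "emeasure (PiM I (\<lambda>_. lborel)) E = ennreal T" "T > 0"
    and fin: "\<And>x. finite {z \<in> PiE I (\<lambda>_. UNIV :: int set). (\<lambda>i\<in>I. x i + of_int (z i)) \<in> E}"
  shows "\<exists>x. T \<le> real (card {z \<in> PiE I (\<lambda>_. UNIV :: int set). (\<lambda>i\<in>I. x i + of_int (z i)) \<in> E})"
proof (rule ccontr)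
  interpret product_sigma_finite "\<lambda>_. lborel :: real measure" ..
  let ?P = "PiM I (\<lambda>_. lborel :: real measure)" and ?Z = "PiE I (\<lambda>_. UNIV :: int set)"
  let ?S = "\<lambda>x. {z \<in> ?Z. (\<lambda>i\<in>I. x i + of_int (z i)) \<in> E}"
  assume "\<not> ?thesis"
  then have lt: "real (card (?S x)) < T" for x by (meson not_le)
  \<comment> \<open>The largest integer below \<open>T\<close>. Counts are integers, so counts below
    \<open>T\<close> are at most \<open>m\<close>, a uniform gap that survives integration.\<close>
  define m where "m = nat (\<lceil>T\<rceil> - 1)"
  have mT: "real m < T" using vol(2) unfolding m_def by linarith
  have card: "card (?S x) \<le> m" for x using lt[of x] unfolding m_def by linarith
  have cZ: "countable ?Z" using assms(1) by (intro countable_PiE) auto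
  let ?Q = "PiE I (\<lambda>_. {0..<1::real})"
  have Q: "?Q \<in> sets ?P" using assms(1) by (intro sets_PiM_I_finite) auto
  have cell: "{x \<in> space ?P. \<forall>i\<in>I. \<lfloor>x i\<rfloor> = z i} \<in> sets ?P" for z :: "'i \<Rightarrow> int"
  proof -
    have "{x \<in> space ?P. \<forall>i\<in>I. \<lfloor>x i\<rfloor> = z i} = PiE I (\<lambda>i. {of_int (z i)..<of_int (z i) + 1})"
      by (auto simp: space_PiM PiE_def Pi_def floor_eq_iff)
    then show ?thesis using assms(1) by (auto intro: sets_PiM_I_finite)
  qed
  let ?h = "\<lambda>z x. indicator E x * indicator {x \<in> space ?P. \<forall>i\<in>I. \<lfloor>x i\<rfloor> = z i} x :: ennreal"
  have "ennreal T = (\<integral>\<^sup>+x. indicator E x \<partial>?P)" using E vol by simp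
  \<comment> \<open>Splitting by integer parts: for each \<open>x\<close> exactly one
    \<open>z\<close> contributes, the vector of floors.\<close>
  also have "\<dots> = (\<integral>\<^sup>+x. \<integral>\<^sup>+z. ?h z x \<partial>count_space ?Z \<partial>?P)"
  proof (rule nn_integral_cong)
    fix x assume x: "x \<in> space ?P"
    let ?z = "\<lambda>i\<in>I. \<lfloor>x i\<rfloor>"
    have "(\<integral>\<^sup>+z. ?h z x \<partial>count_space ?Z) = (\<integral>\<^sup>+z. indicator E x * indicator {?z} z \<partial>count_space ?Z)"
    proof (rule nn_integral_cong)
      fix z assume "z \<in> space (count_space ?Z)"
      then have "(\<forall>i\<in>I. \<lfloor>x i\<rfloor> = z i) \<longleftrightarrow> z = ?z" by (auto simp: PiE_def extensional_def fun_eq_iff)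
      then show "?h z x = indicator E x * indicator {?z} z" using x by (auto split: split_indicator)
    qed
    also have "\<dots> = indicator E x"
      by (subst nn_integral_cmult) (auto simp: emeasure_count_space)
    finally show "indicator E x = (\<integral>\<^sup>+z. ?h z x \<partial>count_space ?Z)" by simp
  qed
  also have "\<dots> = (\<integral>\<^sup>+z. \<integral>\<^sup>+x. ?h z x \<partial>?P \<partial>count_space ?Z)"
    using cZ E cell by (intro nn_integral_count_space_nn_integral) auto
  also have "\<dots> = (\<integral>\<^sup>+z. \<integral>\<^sup>+x. indicator E (\<lambda>i\<in>I. x i + of_int (z i)) * indicator ?Q x \<partial>?P \<partial>count_space ?Z)"
  proof (rule nn_integral_cong)
    fix z :: "'i \<Rightarrow> int"
    have "(\<integral>\<^sup>+x. ?h z x \<partial>?P) = (\<integral>\<^sup>+x. ?h z (\<lambda>i\<in>I. x i + of_int (z i)) \<partial>?P)"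
      using E cell assms(1) by (intro nn_integral_PiM_lborel_translate[symmetric]) auto
    also have "\<dots> = (\<integral>\<^sup>+x. indicator E (\<lambda>i\<in>I. x i + of_int (z i)) * indicator ?Q x \<partial>?P)"
    proof (rule nn_integral_cong)
      fix x assume x: "x \<in> space ?P"
      have "\<lfloor>x i + of_int (z i)\<rfloor> = z i \<longleftrightarrow> 0 \<le> x i \<and> x i < 1" for i
        by (simp add: floor_eq_iff)
      then show "?h z (\<lambda>i\<in>I. x i + of_int (z i)) = indicator E (\<lambda>i\<in>I. x i + of_int (z i)) * indicator ?Q x"
        using x by (auto split: split_indicator simp: space_PiM PiE_def Pi_def)
    qed
    finally show "(\<integral>\<^sup>+x. ?h z x \<partial>?P) = (\<integral>\<^sup>+x. indicator E (\<lambda>i\<in>I. x i + of_int (z i)) * indicator ?Q x \<partial>?P)" .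
  qed
  also have "\<dots> = (\<integral>\<^sup>+x. \<integral>\<^sup>+z. indicator E (\<lambda>i\<in>I. x i + of_int (z i)) * indicator ?Q x \<partial>count_space ?Z \<partial>?P)"
  proof (rule nn_integral_count_space_nn_integral[symmetric, OF cZ])
    fix z :: "'i \<Rightarrow> int"
    have "(\<lambda>x. \<lambda>i\<in>I. x i + of_int (z i)) \<in> measurable ?P ?P"
    proof (rule measurable_restrict)
      fix i assume "i \<in> I"
      then have "(\<lambda>x. x i) \<in> borel_measurable ?P"
        using measurable_component_singleton[of i I "\<lambda>_. lborel :: real measure"] by simp
      then show "(\<lambda>x. x i + of_int (z i)) \<in> measurable ?P lborel" by simp
    qed
    from borel_measurable_times_ennreal[OF measurable_compose[OF this borel_measurable_indicator[OF E]]
        borel_measurable_indicator[OF Q]]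
    show "(\<lambda>x. indicator E (\<lambda>i\<in>I. x i + of_int (z i)) * indicator ?Q x :: ennreal) \<in> borel_measurable ?P"
      .
  qed
  also have "\<dots> \<le> (\<integral>\<^sup>+x. ennreal (real m) * indicator ?Q x \<partial>?P)"
  proof (rule nn_integral_mono)
    fix x
    have "(\<integral>\<^sup>+z. indicator E (\<lambda>i\<in>I. x i + of_int (z i)) * indicator ?Q x \<partial>count_space ?Z) =
      (\<integral>\<^sup>+z. indicator (?S x) z \<partial>count_space ?Z) * indicator ?Q x"
    proof -
      have "(\<integral>\<^sup>+z. indicator E (\<lambda>i\<in>I. x i + of_int (z i)) \<partial>count_space ?Z) = (\<integral>\<^sup>+z. indicator (?S x) z \<partial>count_space ?Z)"
        by (intro nn_integral_cong) (auto split: split_indicator)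
      then show ?thesis by (subst nn_integral_multc) auto
    qed
    also have "(\<integral>\<^sup>+z. indicator (?S x) z \<partial>count_space ?Z) = ennreal (real (card (?S x)))"
      using fin[of x] by (subst nn_integral_indicator) (auto simp: emeasure_count_space ennreal_of_nat_eq_real_of_nat)
    also have "ennreal (real (card (?S x))) * indicator ?Q x \<le> ennreal (real m) * indicator ?Q x"
      using card[of x] by (intro mult_right_mono) auto
    finally show "(\<integral>\<^sup>+z. indicator E (\<lambda>i\<in>I. x i + of_int (z i)) * indicator ?Q x \<partial>count_space ?Z) \<le> ennreal (real m) * indicator ?Q x"
      .
  qed
  also have "\<dots> = ennreal (real m)"
    using Q assms(1) by (subst nn_integral_cmult_indicator) (auto simp: emeasure_PiM)
  finally show False using mT by simp
qed

section \<open>Lattice codes\<close>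

lemma mb_inner_eq: "mb_inner k X Y = (\<Sum>i<k. X i \<bullet> Y i)"
  by (auto simp: mb_inner_def trace_def matrix_matrix_mult_def ctranspose_def inner_vec_def inner_complex_def
      intro!: sum.cong)

lemma mb_norm_eq: "mb_norm k X = sqrt (\<Sum>i<k. (norm (X i))\<^sup>2)"
  by (simp add: mb_norm_def mb_inner_eq power2_norm_eq_inner)

lemma norm_le_mb_norm: "i < k \<Longrightarrow> norm (X i) \<le> mb_norm k X"
  unfolding mb_norm_eq by (rule real_le_rsqrt) (rule member_le_sum, auto)

definition comb :: "nat \<Rightarrow> (nat \<Rightarrow> 'n multiblock) \<Rightarrow> (nat \<Rightarrow> real) \<Rightarrow> ('n::finite) multiblock" where
  "comb d b c = (\<lambda>i. \<Sum>j<d. c j *\<^sub>R b j i)"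

definition gram :: "nat \<Rightarrow> (nat \<Rightarrow> ('n::finite) multiblock) \<Rightarrow> nat \<Rightarrow> nat \<Rightarrow> real" where
  "gram k b i j = mb_inner k (b i) (b j)"

lemma quad_form_gram: "quad_form d (gram k b) c = (\<Sum>i<k. (norm (comb d b c i))\<^sup>2)"
proof -
  have "(\<Sum>i<k. (norm (comb d b c i))\<^sup>2) = (\<Sum>i<k. \<Sum>j<d. \<Sum>l<d. (b j i \<bullet> b l i) * c j * c l)"
    by (simp add: power2_norm_eq_inner comb_def inner_sum_left inner_sum_right sum_distrib_left sum_distrib_right mult_ac)
       (subst sum.swap[of _ "{..<d}" "{..<d}"], simp add: mult_ac inner_commute)
  also have "\<dots> = (\<Sum>j<d. \<Sum>l<d. \<Sum>i<k. (b j i \<bullet> b l i) * c j * c l)"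
    by (subst sum.swap) (intro sum.cong refl sum.swap)
  finally show ?thesis
    by (simp add: quad_form_def gram_def mb_inner_eq sum_distrib_right)
qed

lemma lattice_basisD:
  assumes "lattice_basis k d b L"
  shows "\<And>j. j < d \<Longrightarrow> b j \<in> multiblocks k"
    and "comb d b c = (\<lambda>_. 0) \<Longrightarrow> j < d \<Longrightarrow> c j = 0"
    and "X \<in> L \<longleftrightarrow> (\<exists>z::nat \<Rightarrow> int. X = comb d b (\<lambda>j. of_int (z j)))"
    and "comb d b c \<in> multiblocks k"
proof -
  show b: "\<And>j. j < d \<Longrightarrow> b j \<in> multiblocks k" using assms by (simp add: lattice_basis_def)
  show "comb d b c = (\<lambda>_. 0) \<Longrightarrow> j < d \<Longrightarrow> c j = 0"
    using assms by (auto simp: lattice_basis_def comb_def fun_eq_iff)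
  show "X \<in> L \<longleftrightarrow> (\<exists>z::nat \<Rightarrow> int. X = comb d b (\<lambda>j. of_int (z j)))"
    using assms by (auto simp: lattice_basis_def comb_def)
  show "comb d b c \<in> multiblocks k"
    using b by (auto simp: comb_def multiblocks_def intro!: sum.neutral)
qed

lemma pos_def_gram:
  assumes "lattice_basis k d b L"
  shows "pos_def d (gram k b)"
  unfolding pos_def_def
proof (intro conjI allI impI)
  fix i j show "gram k b i j = gram k b j i"
    by (simp add: gram_def mb_inner_eq inner_commute)
next
  fix c :: "nat \<Rightarrow> real" assume "\<exists>i<d. c i \<noteq> 0"
  then have "comb d b c \<noteq> (\<lambda>_. 0)" using lattice_basisD(2)[OF assms] by blast
  then obtain i where i: "comb d b c i \<noteq> 0" by auto
  then have "i < k" using lattice_basisD(4)[OF assms, of c] by (auto simp: multiblocks_def not_le[symmetric])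
  then have "0 < (\<Sum>i<k. (norm (comb d b c i))\<^sup>2)" using i by (intro sum_pos2[of _ i]) auto
  then show "quad_form d (gram k b) c > 0" by (simp add: quad_form_gram)
qed

text \<open>\<open>lattice_vol\<close> picks one basis by choice. Obtaining exactly that basis ties
  the Gram determinant in the ellipsoid volume to the volume that enters
  \<open>code_scale\<close>.\<close>

lemma lattice_vol_basis:
  assumes "is_lattice k d L"
  obtains b where "lattice_basis k d b L"
    "lattice_vol k d L = sqrt (Determinant.det (Matrix.mat d d (\<lambda>(i, j). gram k b i j)))"
    "lattice_vol k d L > 0"
proof -
  let ?b = "SOME b. lattice_basis k d b L"
  have b: "lattice_basis k d ?b L"
    using assms unfolding is_lattice_def by (rule someI_ex)
  have v: "lattice_vol k d L = sqrt (Determinant.det (Matrix.mat d d (\<lambda>(i, j). gram k ?b i j)))"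
    by (simp add: lattice_vol_def gram_def Let_def)
  show thesis
    using that[OF b v] det_pos_def[OF pos_def_gram[OF b]] v by simp
qed

lemma comb_simps:
  "comb d b c i + comb d b c' i = comb d b (\<lambda>j. c j + c' j) i"
  "comb d b c i - comb d b c' i = comb d b (\<lambda>j. c j - c' j) i"
  by (simp_all add: comb_def sum.distrib sum_subtractf scaleR_add_left scaleR_diff_left)

lemma lattice_diff:
  assumes "is_lattice k d L" "X \<in> L" "Y \<in> L"
  shows "(\<lambda>i. X i - Y i) \<in> L"
proof -
  obtain b where b: "lattice_basis k d b L" using assms(1) by (auto simp: is_lattice_def)
  obtain z z' :: "nat \<Rightarrow> int" where "X = comb d b (\<lambda>j. of_int (z j))" "Y = comb d b (\<lambda>j. of_int (z' j))"
    using assms lattice_basisD(3)[OF b] by auto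
  then have "(\<lambda>i. X i - Y i) = comb d b (\<lambda>j. of_int ((z j) - z' j))"
    by (simp add: comb_simps)
  then show ?thesis unfolding lattice_basisD(3)[OF b] by (intro exI[of _ "\<lambda>j. z j - z' j"])
qed

lemma finite_lattice_bounded:
  assumes "is_lattice k d L"
  shows "finite {X \<in> L. \<forall>i<k. norm (X i) \<le> B}"
proof -
  obtain b where b: "lattice_basis k d b L" using assms by (auto simp: is_lattice_def)
  obtain C where C: "C \<ge> 0" "\<And>c i. i < d \<Longrightarrow> (c i)\<^sup>2 \<le> C * quad_form d (gram k b) c"
    using pos_def_coord_bound[OF pos_def_gram[OF b]] by auto
  define m where "m = \<lceil>C * (real k * B\<^sup>2)\<rceil>"
  let ?f = "\<lambda>z. comb d b (\<lambda>j. of_int (z j))"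
  have "{X \<in> L. \<forall>i<k. norm (X i) \<le> B} \<subseteq> ?f ` PiE {..<d} (\<lambda>_. {- m..m})"
  proof
    fix X assume X: "X \<in> {X \<in> L. \<forall>i<k. norm (X i) \<le> B}"
    then obtain z :: "nat \<Rightarrow> int" where z: "X = ?f z" using lattice_basisD(3)[OF b] by auto
    have "\<bar>z j\<bar> \<le> m" if "j < d" for j
    proof -
      have "quad_form d (gram k b) (\<lambda>j. of_int (z j)) \<le> (\<Sum>i<k. B\<^sup>2)"
        unfolding quad_form_gram z[symmetric] using X by (intro sum_mono power_mono) auto
      then have "(of_int (z j))\<^sup>2 \<le> C * (real k * B\<^sup>2)"
        using C(2)[OF that, of "\<lambda>j. of_int (z j)"] C(1) mult_left_mono by fastforce
      \<comment> \<open>An integer is at most its square in absolute value, so the bound on the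
        square bounds the coefficient directly.\<close>
      moreover have "real_of_int \<bar>z j\<bar> \<le> (of_int (z j))\<^sup>2"
      proof -
        have "\<bar>z j\<bar> * 1 \<le> \<bar>z j\<bar> * \<bar>z j\<bar>"
          by (cases "z j = 0", simp, rule mult_left_mono) linarith+
        then have "\<bar>z j\<bar> \<le> (z j)\<^sup>2" by (simp add: power2_eq_square abs_mult_self_eq)
        then show ?thesis by (metis of_int_le_iff of_int_power)
      qed
      ultimately show ?thesis unfolding m_def by (meson ceiling_mono ceiling_of_int le_of_int_ceiling of_int_le_iff order_trans)
    qed
    then have "restrict z {..<d} \<in> PiE {..<d} (\<lambda>_. {- m..m})" by (force simp: abs_le_iff)
    moreover have "X = ?f (restrict z {..<d})" unfolding z comb_def by (intro ext sum.cong) auto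
    ultimately show "X \<in> ?f ` PiE {..<d} (\<lambda>_. {- m..m})" by blast
  qed
  then show ?thesis by (rule finite_subset) (intro finite_imageI finite_PiE, auto)
qed

text \<open>The power \<open>CARD('n)\<^sup>2 * k\<close> clears the roots in
  \<open>code_scale\<close>. In this form it shows that the ball of the power constraint has
  \<open>2 powr (R * CARD('n) * k)\<close> times the volume of a cell of the scaled lattice.\<close>

lemma code_scale_power:
  fixes L :: "('n::finite) multiblock set"
  assumes L: "is_lattice k (2 * (CARD('n)\<^sup>2 * k)) L" and k: "k > 0" and P: "P > 0"
  shows "code_scale P R k L > 0"
    and "((code_scale P R k L)\<^sup>2) ^ (CARD('n)\<^sup>2 * k) =
      code_const CARD('n) k * P ^ (CARD('n)\<^sup>2 * k) /
        (2 powr (R * real CARD('n) * real k) * lattice_vol k (2 * (CARD('n)\<^sup>2 * k)) L)"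
proof -
  let ?n = "CARD('n)" let ?N = "?n\<^sup>2 * k" let ?V = "lattice_vol k (2 * ?N) L"
  have N: "?N > 0" using k by simp
  have V: "?V > 0" using lattice_vol_basis[OF L] by metis
  have C: "code_const ?n k > 0" using k by (simp add: code_const_def)
  let ?a = "code_const ?n k powr (1 / real ?N) * P / (2 powr (R / real ?n) * ?V powr (1 / real ?N))"
  have a: "?a > 0" using C V P by simp
  have e: "code_scale P R k L = sqrt ?a" by (simp add: code_scale_def Let_def)
  show "code_scale P R k L > 0" unfolding e using a by simp
  have root: "(x powr (1 / real ?N)) ^ ?N = x" if "x > 0" for x :: real
    using that N by (simp add: powr_power)
  have two: "(2 powr (R / real ?n)) ^ ?N = 2 powr (R * real ?n * real k)"
    by (simp add: powr_power power2_eq_square mult_ac)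
  show "((code_scale P R k L)\<^sup>2) ^ ?N = code_const ?n k * P ^ ?N / (2 powr (R * real ?n * real k) * ?V)"
    unfolding e real_sqrt_pow2[OF less_imp_le[OF a]] power_divide power_mult_distrib root[OF C] root[OF V] two ..
qed

lemma finite_shifted_bounded:
  fixes L :: "('n::finite) multiblock set"
  assumes L: "is_lattice k d L" and \<alpha>: "code_scale P R k L > 0"
  shows "finite {X \<in> shifted_lattice P R k L S. \<forall>i<k. norm (X i) \<le> B}"
proof -
  let ?\<alpha> = "code_scale P R k L"
  let ?B = "(B + (\<Sum>i<k. norm (S i))) / ?\<alpha>"
  have "{X \<in> shifted_lattice P R k L S. \<forall>i<k. norm (X i) \<le> B} \<subseteq>
    (\<lambda>X i. S i + ?\<alpha> *\<^sub>R X i) ` {X \<in> L. \<forall>i<k. norm (X i) \<le> ?B}"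
  proof (clarsimp simp: shifted_lattice_def, rule imageI, clarsimp)
    fix X i assume X: "X \<in> L" and B: "\<forall>i<k. norm (S i + ?\<alpha> *\<^sub>R X i) \<le> B" and i: "i < k"
    have "?\<alpha> * norm (X i) = norm ((S i + ?\<alpha> *\<^sub>R X i) - S i)" using \<alpha> by simp
    also have "\<dots> \<le> B + norm (S i)" using B i by (intro order_trans[OF norm_triangle_ineq4]) auto
    also have "norm (S i) \<le> (\<Sum>i<k. norm (S i))" using i by (intro member_le_sum) auto
    finally show "norm (X i) \<le> ?B" using \<alpha> by (simp add: field_simps)
  qed
  then show ?thesis by (rule finite_subset) (intro finite_imageI finite_lattice_bounded[OF L])
qed

lemma finite_lattice_code:
  fixes L :: "('n::finite) multiblock set"
  assumes "is_lattice k d L" "code_scale P R k L > 0"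
  shows "finite (lattice_code P R k L S)"
proof -
  have "lattice_code P R k L S \<subseteq>
    {X \<in> shifted_lattice P R k L S. \<forall>i<k. norm (X i) \<le> sqrt (P * real k * real CARD('n))}"
    by (auto simp: lattice_code_def intro: order_trans[OF norm_le_mb_norm])
  then show ?thesis by (rule finite_subset) (rule finite_shifted_bounded[OF assms])
qed

text \<open>In lattice coordinates the ball becomes an ellipsoid, and the scale is such that its
  volume is exactly the wanted number of codewords; a translate reaching the average count gives the
  shift.\<close>

lemma admissible_shift_exists:
  fixes L :: "('n::finite) multiblock set"
  assumes L: "is_lattice k (2 * (CARD('n)\<^sup>2 * k)) L" and k: "k > 0" and P: "P > 0"
  shows "\<exists>S. admissible_shift P R k L S"
proof -
  let ?n = "CARD('n)" let ?N = "?n\<^sup>2 * k" let ?d = "2 * ?N" let ?\<alpha> = "code_scale P R k L"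
  let ?PM = "PiM {..<?d} (\<lambda>_. lborel :: real measure)" and ?Z = "PiE {..<?d} (\<lambda>_. UNIV :: int set)"
  obtain b where b: "lattice_basis k ?d b L"
    and V: "lattice_vol k ?d L = sqrt (Determinant.det (Matrix.mat ?d ?d (\<lambda>(i, j). gram k b i j)))"
      "lattice_vol k ?d L > 0"
    using lattice_vol_basis[OF L] by metis
  note \<alpha> = code_scale_power[OF L k P, of R]
  \<comment> \<open>Squared radius of the ball after division by the scale.\<close>
  define \<rho> where "\<rho> = P * real k * real ?n / ?\<alpha>\<^sup>2"
  have \<rho>: "\<rho> > 0" using \<alpha>(1) P k by (simp add: \<rho>_def)
  define T where "T = 2 powr (R * real ?n * real k)"
  define E where "E = {c \<in> space ?PM. quad_form ?d (gram k b) c \<le> \<rho>}"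
  have E: "E \<in> sets ?PM"
  proof -
    have [measurable]: "quad_form ?d (gram k b) \<in> borel_measurable ?PM" by (rule quad_form_measurable) simp
    show ?thesis unfolding E_def by measurable
  qed
  have "emeasure ?PM E = ennreal ((pi * \<rho>) ^ ?N / (fact ?N * lattice_vol k ?d L))"
    unfolding E_def V(1) by (rule ellipsoid_volume[OF pos_def_gram[OF b] \<rho>])
  also have "(pi * \<rho>) ^ ?N / (fact ?N * lattice_vol k ?d L) = T"
  proof -
    have "(pi * \<rho>) ^ ?N = (pi * P * real k * real ?n) ^ ?N / (?\<alpha>\<^sup>2) ^ ?N"
      by (simp add: \<rho>_def power_divide[symmetric] mult.assoc)
    also have "\<dots> = (pi * P * real k * real ?n) ^ ?N * (T * lattice_vol k ?d L) / (code_const ?n k * P ^ ?N)"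
      unfolding \<alpha>(2) T_def by simp
    also have "(pi * P * real k * real ?n) ^ ?N = (pi * real ?n * real k) ^ ?N * P ^ ?N"
      by (simp add: power_mult_distrib)
    also have "(pi * real ?n * real k) ^ ?N = code_const ?n k * fact ?N"
      by (simp add: code_const_def)
    finally show ?thesis
      using V(2) P k by (simp add: code_const_def)
  qed
  finally have vol: "emeasure ?PM E = ennreal T" .
  let ?S = "\<lambda>x. {z \<in> ?Z. (\<lambda>i\<in>{..<?d}. x i + of_int (z i)) \<in> E}"
  let ?l = "\<lambda>z. comb ?d b (\<lambda>j. of_int (z j))"
  have E_iff: "(\<lambda>i\<in>{..<?d}. x i + of_int (z i)) \<in> E \<longleftrightarrow> (\<Sum>i<k. (norm (comb ?d b x i + ?l z i))\<^sup>2) \<le> \<rho>" for x z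
  proof -
    have "comb ?d b (\<lambda>i\<in>{..<?d}. x i + of_int (z i)) i = comb ?d b x i + ?l z i" for i
      unfolding comb_simps unfolding comb_def by (intro sum.cong) auto
    then show ?thesis by (simp add: E_def quad_form_gram space_PiM)
  qed
  have inj: "inj_on ?l ?Z"
  proof (rule inj_onI)
    fix z z' assume z: "z \<in> ?Z" "z' \<in> ?Z" "?l z = ?l z'"
    then have "comb ?d b (\<lambda>j. of_int (z j) - of_int (z' j)) = (\<lambda>_. 0)"
      by (simp add: comb_simps(2)[symmetric] fun_eq_iff)
    from lattice_basisD(2)[OF b this] have "z j = z' j" if "j < ?d" for j using that by fastforce
    then show "z = z'" using z by (auto intro: PiE_ext)
  qed
  have fin: "finite (?S x)" for x
  proof (rule inj_on_finite)
    show "inj_on ?l (?S x)" using inj by (rule inj_on_subset) auto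
    let ?B = "sqrt \<rho> + (\<Sum>i<k. norm (comb ?d b x i))"
    show "?l ` ?S x \<subseteq> {X \<in> L. \<forall>i<k. norm (X i) \<le> ?B}"
    proof (intro subsetI CollectI conjI allI impI)
      fix X assume "X \<in> ?l ` ?S x"
      then obtain z where z: "X = ?l z" "(\<Sum>i<k. (norm (comb ?d b x i + ?l z i))\<^sup>2) \<le> \<rho>" using E_iff by auto
      show "X \<in> L" unfolding lattice_basisD(3)[OF b] z by blast
      fix i assume i: "i < k"
      have "(norm (comb ?d b x i + X i))\<^sup>2 \<le> (\<Sum>i<k. (norm (comb ?d b x i + X i))\<^sup>2)"
        using i by (intro member_le_sum) auto
      with z have "(norm (comb ?d b x i + X i))\<^sup>2 \<le> \<rho>" by simp
      then have "norm (comb ?d b x i + X i) \<le> sqrt \<rho>" by (rule real_le_rsqrt)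
      moreover have "norm (comb ?d b x i) \<le> (\<Sum>i<k. norm (comb ?d b x i))"
        using i by (intro member_le_sum) auto
      moreover have "norm (X i) \<le> norm (comb ?d b x i + X i) + norm (comb ?d b x i)"
        using norm_triangle_ineq4[of "comb ?d b x i + X i" "comb ?d b x i"] by simp
      ultimately show "norm (X i) \<le> ?B" by linarith
    qed
  qed (rule finite_lattice_bounded[OF L])
  obtain x where x: "T \<le> real (card (?S x))"
    using integer_translate_pigeonhole[OF _ E vol _ fin] by (auto simp: T_def)
  define S where "S = (\<lambda>i. ?\<alpha> *\<^sub>R comb ?d b x i)"
  have S: "S \<in> multiblocks k" using lattice_basisD(4)[OF b, of x] by (simp add: S_def multiblocks_def)
  let ?X = "\<lambda>z i. S i + ?\<alpha> *\<^sub>R ?l z i"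
  have "card (?S x) \<le> card (lattice_code P R k L S)"
  proof (rule card_inj_on_le)
    show "inj_on ?X (?S x)"
    proof (rule inj_onI)
      fix z z' assume z: "z \<in> ?S x" "z' \<in> ?S x" "?X z = ?X z'"
      then have "?l z = ?l z'" using \<alpha>(1) by (simp add: fun_eq_iff)
      then show "z = z'" using z inj by (auto dest: inj_onD)
    qed
    show "finite (lattice_code P R k L S)" using finite_lattice_code[OF L \<alpha>(1)] .
    show "?X ` ?S x \<subseteq> lattice_code P R k L S"
    proof
      fix X assume "X \<in> ?X ` ?S x"
      then obtain z where z: "X = ?X z" "(\<Sum>i<k. (norm (comb ?d b x i + ?l z i))\<^sup>2) \<le> \<rho>" using E_iff by auto
      have l: "?l z \<in> L" unfolding lattice_basisD(3)[OF b] by blast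
      have "(\<Sum>i<k. (norm (X i))\<^sup>2) = ?\<alpha>\<^sup>2 * (\<Sum>i<k. (norm (comb ?d b x i + ?l z i))\<^sup>2)"
        unfolding z(1) S_def scaleR_add_right[symmetric] by (simp add: power_mult_distrib sum_distrib_left)
      also have "\<dots> \<le> ?\<alpha>\<^sup>2 * \<rho>" using z(2) by (intro mult_left_mono) auto
      also have "\<dots> = P * real k * real ?n" using \<alpha>(1) by (simp add: \<rho>_def)
      finally have "mb_norm k X \<le> sqrt (P * real k * real ?n)" by (simp add: mb_norm_eq)
      moreover have "X \<in> multiblocks k"
        using S lattice_basisD(4)[OF b, of "\<lambda>j. of_int (z j)"] by (simp add: z(1) multiblocks_def)
      ultimately show "X \<in> lattice_code P R k L S"
        using l unfolding lattice_code_def shifted_lattice_def z(1) by auto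
    qed
  qed
  then have "admissible_shift P R k L S"
    using S x by (simp add: admissible_shift_def T_def)
  then show ?thesis by (intro exI[of _ S])
qed

section \<open>Decoding errors\<close>

lemma det_ctranspose:
  fixes A :: "complex^'n^'n"
  shows "det (ctranspose A) = cnj (det A)"
proof -
  have "cnj (det A) = det (transpose (ctranspose A))"
    by (simp add: Determinants.det_def ctranspose_def Finite_Cartesian_Product.transpose_def)
  then show ?thesis by (simp add: det_transpose)
qed

lemma gram_det_mult:
  fixes A :: "complex^'n^'r" and Z :: "complex^'n^'n"
  shows "gram_det (A ** Z) = gram_det A * (cmod (det Z))\<^sup>2"
proof -
  have "ctranspose (A ** Z) ** (A ** Z) = ctranspose Z ** (ctranspose A ** A) ** Z"
  proof -
    have "ctranspose (A ** Z) = ctranspose Z ** ctranspose A"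
      by (simp add: ctranspose_def matrix_matrix_mult_def Finite_Cartesian_Product.vec_eq_iff mult.commute)
    then show ?thesis by (simp add: matrix_mul_assoc)
  qed
  then have "complex_of_real (gram_det (A ** Z)) = cnj (det Z) * of_real (gram_det A) * det Z"
    by (simp add: det_ctranspose_self[symmetric] det_mul det_ctranspose)
  also have "\<dots> = of_real (gram_det A * (cmod (det Z))\<^sup>2)"
    using complex_norm_square[of "det Z"] by (simp add: mult_ac)
  finally show ?thesis by (simp only: of_real_eq_iff)
qed

lemma gram_det_le_prod_columns: "gram_det A \<le> (\<Prod>j\<in>UNIV. (norm (column j A))\<^sup>2)"
  unfolding gram_det_eq_rgram by (rule rgram_basic)

lemma norm_sq_columns:
  fixes A :: "complex^'n^'r"
  shows "(norm A)\<^sup>2 = (\<Sum>j\<in>UNIV. (norm (column j A))\<^sup>2)"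
  by (simp add: norm_vec_def L2_set_def sum_nonneg Finite_Cartesian_Product.column_def) (rule sum.swap)

lemma matrix_mult_scaleR: "A ** (c *\<^sub>R Z) = c *\<^sub>R ((A :: complex^'n^'r) ** (Z :: complex^'m^'n))"
  by (simp add: matrix_matrix_mult_def Finite_Cartesian_Product.vec_eq_iff scaleR_sum_right)

lemma received_distance_bound:
  fixes A :: "nat \<Rightarrow> complex^'n^'r" and Z :: "nat \<Rightarrow> complex^'n^'n"
  assumes k: "k > 0" and Z: "1 \<le> cmod (pdet k Z)"
  shows "real CARD('n) * real k * c\<^sup>2 * (\<Prod>i<k. gram_det (A i)) powr (1 / (real CARD('n) * real k)) \<le>
    (\<Sum>i<k. (norm (A i ** (c *\<^sub>R Z i)))\<^sup>2)"
proof -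
  let ?n = "CARD('n)" let ?S = "{..<k} \<times> (UNIV :: 'n set)"
  let ?x = "\<lambda>(i, j). (norm (column j (A i ** Z i)))\<^sup>2"
  have card: "real (card ?S) = real ?n * real k" by (simp add: card_cartesian_product mult.commute)
  have pos: "real ?n * real k > 0" using k by simp
  have "(\<Prod>i<k. gram_det (A i)) \<le> (\<Prod>i<k. gram_det (A i)) * (cmod (pdet k Z))\<^sup>2"
  proof -
    have "0 \<le> (\<Prod>i<k. gram_det (A i))" by (intro prod_nonneg ballI gram_det_nonneg)
    then show ?thesis using mult_left_mono[OF one_le_power[OF Z, of 2]] by fastforce
  qed
  also have "\<dots> = (\<Prod>i<k. gram_det (A i ** Z i))"
    by (simp add: gram_det_mult prod.distrib pdet_def prod_norm[symmetric] prod_power_distrib)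
  also have "\<dots> \<le> (\<Prod>i<k. \<Prod>j\<in>UNIV. (norm (column j (A i ** Z i)))\<^sup>2)"
    using gram_det_nonneg gram_det_le_prod_columns by (intro prod_mono) auto
  also have "\<dots> = (\<Prod>p\<in>?S. ?x p)" by (simp add: prod.cartesian_product)
  finally have "(\<Prod>i<k. gram_det (A i)) powr (1 / (real ?n * real k)) \<le> (\<Prod>p\<in>?S. ?x p) powr (1 / real (card ?S))"
    unfolding card using gram_det_nonneg pos by (intro powr_mono2 prod_nonneg) auto
  \<comment> \<open>AM-GM over the columns of all blocks at once; their number explains the exponent
    \<open>1 / (CARD('n) * k)\<close>.\<close>
  also have "\<dots> \<le> (\<Sum>p\<in>?S. ?x p / real (card ?S))"
    using k by (intro arith_geom_mean) auto
  also have "\<dots> = (\<Sum>i<k. (norm (A i ** Z i))\<^sup>2) / (real ?n * real k)"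
    unfolding card by (simp add: sum_divide_distrib[symmetric] norm_sq_columns sum.cartesian_product)
  finally have "real ?n * real k * (\<Prod>i<k. gram_det (A i)) powr (1 / (real ?n * real k)) \<le> (\<Sum>i<k. (norm (A i ** Z i))\<^sup>2)"
    using pos by (simp add: field_simps)
  then have "c\<^sup>2 * (real ?n * real k * (\<Prod>i<k. gram_det (A i)) powr (1 / (real ?n * real k))) \<le> c\<^sup>2 * (\<Sum>i<k. (norm (A i ** Z i))\<^sup>2)"
    by (intro mult_left_mono) auto
  then show ?thesis
    by (simp add: matrix_mult_scaleR power_mult_distrib sum_distrib_left mult_ac)
qed

lemma det_min_lower:
  assumes "det_min k L = 1" "X \<in> L" "X \<noteq> (\<lambda>_. 0)"
  shows "1 \<le> cmod (pdet k X)"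
proof -
  have "det_min k L \<le> cmod (pdet k X)"
    unfolding det_min_def using assms(2,3) by (intro cINF_lower bdd_belowI[of _ 0]) auto
  then show ?thesis using assms(1) by simp
qed

text \<open>The signal space of one block. It depends on the channel matrix only, so a single
  projection of the noise serves all lattice points.\<close>

definition column_space :: "complex^'n^'r \<Rightarrow> (complex^'n^'r) set" where
  "column_space A = range (\<lambda>Z::complex^'n^'n. A ** Z)"

lemma linear_matrix_mult: "linear (\<lambda>Z::complex^'n^'n. (A::complex^'n^'r) ** Z)"
  by (intro linearI) (simp_all add: matrix_add_ldistrib matrix_mult_scaleR)

lemma gram_det_pos_cancel:
  fixes A :: "complex^'n^'r" and Z :: "complex^'n^'n"
  assumes "gram_det A > 0" "A ** Z = 0"
  shows "Z = 0"
proof -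
  have "invertible (ctranspose A ** A)"
    using assms(1) by (simp add: invertible_det_nz det_ctranspose_self)
  then obtain B where B: "B ** (ctranspose A ** A) = mat 1" by (auto simp: invertible_def)
  have "Z = (B ** (ctranspose A ** A)) ** Z" by (simp add: B matrix_mul_lid)
  also have "\<dots> = (B ** ctranspose A) ** (A ** Z)" by (simp add: matrix_mul_assoc)
  also have "\<dots> = 0"
    unfolding assms(2) by (simp add: matrix_matrix_mult_def Finite_Cartesian_Product.vec_eq_iff)
  finally show ?thesis .
qed

lemma inj_matrix_mult:
  fixes A :: "complex^'n^'r"
  assumes "gram_det A > 0"
  shows "inj (\<lambda>Z::complex^'n^'n. A ** Z)"
  unfolding linear_injective_0[OF linear_matrix_mult] using gram_det_pos_cancel[OF assms] by blast

lemma subspace_column_space: "subspace (column_space A)"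
  unfolding column_space_def by (intro linear_subspace_image linear_matrix_mult subspace_UNIV)

lemma dim_column_space:
  fixes A :: "complex^'n^'r"
  assumes "gram_det A > 0"
  shows "dim (column_space A) = 2 * CARD('n)\<^sup>2"
proof -
  have "dim (column_space A) = dim (UNIV :: (complex^'n^'n) set)"
    unfolding column_space_def using inj_matrix_mult[OF assms]
    by (intro dim_image_eq linear_matrix_mult) auto
  then show ?thesis by (simp add: power2_eq_square)
qed

text \<open>Full column rank makes multiplication by \<open>H i\<close> bounded below, so the
  candidates no worse than \<open>X0\<close> form a bounded, hence finite, part of the shifted
  lattice. This covers the infinite search of naive lattice decoding.\<close>

lemma exists_arg_min_decoding_metric:
  fixes L :: "('n::finite) multiblock set" and H Y :: "nat \<Rightarrow> complex^'n^'r"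
  assumes L: "is_lattice k d L" and \<alpha>: "code_scale P R k L > 0"
    and A: "A \<subseteq> shifted_lattice P R k L S" "X0 \<in> A" and H: "\<And>i. i < k \<Longrightarrow> gram_det (H i) > 0"
  shows "\<exists>X. is_arg_min (decoding_metric k H Y) (\<lambda>X. X \<in> A) X"
proof -
  let ?f = "decoding_metric k H Y"
  let ?F = "{X \<in> A. ?f X \<le> ?f X0}"
  have "\<exists>B>0. \<forall>Z::complex^'n^'n. norm Z * B \<le> norm (H i ** Z)" if i: "i < k" for i
  proof (rule linear_inj_bounded_below_pos[OF linear_matrix_mult inj_matrix_mult[OF H[OF i]]])
    fix B :: real
    assume "0 < B" "\<And>Z::complex^'n^'n. B * norm Z \<le> norm (H i ** Z)"
    then show "\<exists>B>0. \<forall>Z::complex^'n^'n. norm Z * B \<le> norm (H i ** Z)"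
      by (intro exI[of _ B]) (simp add: mult.commute)
  qed
  then obtain B where B: "\<And>i. i < k \<Longrightarrow> B i > 0" "\<And>i (Z::complex^'n^'n). i < k \<Longrightarrow> norm Z * B i \<le> norm (H i ** Z)"
    by metis
  let ?b = "\<lambda>i. (sqrt (?f X0) + norm (Y i)) / B i"
  have "?F \<subseteq> {X \<in> shifted_lattice P R k L S. \<forall>i<k. norm (X i) \<le> (\<Sum>i<k. ?b i)}"
  proof (intro subsetI CollectI conjI allI impI)
    fix X i assume X: "X \<in> ?F" and i: "i < k"
    have f0: "?f X0 \<ge> 0" by (simp add: decoding_metric_def sum_nonneg)
    have "(norm (Y i - H i ** X i))\<^sup>2 \<le> ?f X"
      unfolding decoding_metric_def using i by (intro member_le_sum) auto
    also have "\<dots> \<le> ?f X0" using X by simp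
    finally have "norm (Y i - H i ** X i) \<le> sqrt (?f X0)" by (rule real_le_rsqrt)
    then have "norm (H i ** X i) \<le> sqrt (?f X0) + norm (Y i)"
      using norm_triangle_ineq2[of "H i ** X i" "Y i"] by (simp add: norm_minus_commute)
    then have "norm (X i) \<le> ?b i"
      using B(2)[OF i, of "X i"] B(1)[OF i] by (simp add: pos_le_divide_eq)
    also have "\<dots> \<le> (\<Sum>i<k. ?b i)"
      using i B(1) f0 by (intro member_le_sum) (auto intro!: divide_nonneg_pos)
    finally show "norm (X i) \<le> (\<Sum>i<k. ?b i)" .
  qed (use A in auto)
  then have "finite ?F" by (rule finite_subset) (rule finite_shifted_bounded[OF L \<alpha>])
  moreover have "?F \<noteq> {}" using A(2) by auto
  ultimately obtain X where X: "is_arg_min ?f (\<lambda>X. X \<in> ?F) X"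
    using ex_is_arg_min_if_finite[of ?F ?f] by metis
  have "\<not> ?f Z < ?f X" if "Z \<in> A" for Z
  proof
    assume less: "?f Z < ?f X"
    moreover have "?f X \<le> ?f X0" using X by (simp add: is_arg_min_def)
    ultimately have "Z \<in> ?F" using that by simp
    then show False using X less unfolding is_arg_min_def by blast
  qed
  then have "is_arg_min ?f (\<lambda>X. X \<in> A) X"
    using X by (simp add: is_arg_min_def)
  then show ?thesis by blast
qed

text \<open>\<open>A\<close> stands for the search set of either decoder. Comparing the metrics of
  the output and of the codeword, the energy of \<open>W\<close> cancels. The inequality is not
  strict, so wrong outputs caused by ties are covered as well.\<close>

lemma decoding_error_imp_close_lattice_point:
  fixes L :: "('n::finite) multiblock set" and H W :: "nat \<Rightarrow> complex^'n^'r"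
  assumes L: "is_lattice k d L" and \<alpha>: "code_scale P R k L > 0"
    and A: "A \<subseteq> shifted_lattice P R k L S" "X \<in> A" and H: "\<And>i. i < k \<Longrightarrow> gram_det (H i) > 0"
    and D: "min_distance_decoder k A D"
    and err: "D (\<lambda>i\<in>{..<k}. H i, \<lambda>i\<in>{..<k}. H i ** X i + W i) \<noteq> X"
  shows "\<exists>l\<in>L - {\<lambda>_. 0}. (\<Sum>i<k. (norm (H i ** (code_scale P R k L *\<^sub>R l i)))\<^sup>2) \<le>
    2 * (\<Sum>i<k. (H i ** (code_scale P R k L *\<^sub>R l i)) \<bullet> W i)"
proof -
  let ?\<alpha> = "code_scale P R k L"
  let ?H = "\<lambda>i\<in>{..<k}. H i" and ?Y = "\<lambda>i\<in>{..<k}. H i ** X i + W i"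
  let ?f = "decoding_metric k ?H ?Y"
  define X' where "X' = D (?H, ?Y)"
  have "(?H, ?Y) \<in> space (block_space k \<Otimes>\<^sub>M block_space k)"
    by (auto simp: space_pair_measure space_PiM)
  moreover have "\<exists>X. is_arg_min ?f (\<lambda>X. X \<in> A) X"
    using H by (intro exists_arg_min_decoding_metric[OF L \<alpha> A]) auto
  ultimately have min: "is_arg_min ?f (\<lambda>X. X \<in> A) X'"
    using D unfolding min_distance_decoder_def X'_def by blast
  have X': "X' \<in> A" "?f X' \<le> ?f X"
    using min A(2) by (auto simp: is_arg_min_def not_less)
  obtain l l' where l: "l \<in> L" "X = (\<lambda>i. S i + ?\<alpha> *\<^sub>R l i)" and l': "l' \<in> L" "X' = (\<lambda>i. S i + ?\<alpha> *\<^sub>R l' i)"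
    using subsetD[OF A(1) A(2)] subsetD[OF A(1) X'(1)] unfolding shifted_lattice_def by blast
  define m where "m = (\<lambda>i. l' i - l i)"
  have m: "m \<in> L" unfolding m_def by (rule lattice_diff[OF L l'(1) l(1)])
  have X'm: "X' i = X i + ?\<alpha> *\<^sub>R m i" for i
    by (simp add: l l' m_def scaleR_diff_right)
  have "m \<noteq> (\<lambda>_. 0)"
  proof
    assume "m = (\<lambda>_. 0)"
    then have "X' = X" using X'm by auto
    then show False using err by (simp add: X'_def)
  qed
  moreover have "(\<Sum>i<k. (norm (H i ** (?\<alpha> *\<^sub>R m i)))\<^sup>2) \<le> 2 * (\<Sum>i<k. (H i ** (?\<alpha> *\<^sub>R m i)) \<bullet> W i)"
  proof -
    have "?f X = (\<Sum>i<k. (norm (W i))\<^sup>2)" by (simp add: decoding_metric_def)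
    moreover have "?f X' = (\<Sum>i<k. (norm (W i))\<^sup>2 - 2 * ((H i ** (?\<alpha> *\<^sub>R m i)) \<bullet> W i) + (norm (H i ** (?\<alpha> *\<^sub>R m i)))\<^sup>2)"
      unfolding decoding_metric_def
    proof (intro sum.cong refl)
      fix i assume i: "i \<in> {..<k}"
      have "?Y i - ?H i ** X' i = W i - H i ** (?\<alpha> *\<^sub>R m i)"
        using i by (simp add: X'm matrix_add_ldistrib)
      then show "(norm (?Y i - ?H i ** X' i))\<^sup>2 =
        (norm (W i))\<^sup>2 - 2 * ((H i ** (?\<alpha> *\<^sub>R m i)) \<bullet> W i) + (norm (H i ** (?\<alpha> *\<^sub>R m i)))\<^sup>2"
        by (simp add: power2_norm_eq_inner inner_diff_left inner_diff_right inner_commute)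
    qed
    ultimately show ?thesis using X'(2) by (simp add: sum.distrib sum_subtractf sum_distrib_left)
  qed
  ultimately show ?thesis using m by blast
qed

text \<open>Lets the event that some lattice point is close be a countable union, hence
  measurable.\<close>

lemma countable_lattice:
  assumes "is_lattice k d L"
  shows "countable L"
proof (rule countable_subset)
  show "L \<subseteq> (\<Union>m::nat. {X \<in> L. \<forall>i<k. norm (X i) \<le> real m})"
  proof
    fix X assume X: "X \<in> L"
    obtain m :: nat where m: "(\<Sum>i<k. norm (X i)) \<le> real m" using real_arch_simple by blast
    have "norm (X i) \<le> real m" if "i < k" for i
    proof -
      have "norm (X i) \<le> (\<Sum>i<k. norm (X i))" using that by (intro member_le_sum) auto
      then show ?thesis using m by linarith
    qed
    then show "X \<in> (\<Union>m::nat. {X \<in> L. \<forall>i<k. norm (X i) \<le> real m})"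
      using X by (intro UN_I[of m]) auto
  qed
  show "countable (\<Union>m::nat. {X \<in> L. \<forall>i<k. norm (X i) \<le> real m})"
    by (rule countable_UN) (auto intro: countable_finite[OF finite_lattice_bounded[OF assms]])
qed

section \<open>Tail bounds for the error event\<close>

lemma close_point_imp_large_noise:
  fixes A :: "nat \<Rightarrow> complex^'n^'r" and Z :: "nat \<Rightarrow> complex^'n^'n"
  assumes "(\<Sum>i<k. (norm (A i ** Z i))\<^sup>2) \<le> 2 * (\<Sum>i<k. (A i ** Z i) \<bullet> w i)"
  shows "(\<Sum>i<k. (norm (A i ** Z i))\<^sup>2) \<le> 4 * (\<Sum>i<k. psq (column_space (A i)) (w i))"
proof -
  let ?s = "\<Sum>i<k. (norm (A i ** Z i))\<^sup>2" let ?p = "\<Sum>i<k. psq (column_space (A i)) (w i)"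
  have s0: "?s \<ge> 0" by (intro sum_nonneg) auto
  have p0: "?p \<ge> 0" by (intro sum_nonneg psq_nonneg)
  have "(\<Sum>i<k. (A i ** Z i) \<bullet> w i) \<le> (\<Sum>i<k. norm (A i ** Z i) * sqrt (psq (column_space (A i)) (w i)))"
    by (intro sum_mono inner_le_norm_psq subspace_column_space) (simp add: column_space_def)
  also have "\<dots> \<le> sqrt (?s * ?p)"
    using Cauchy_Schwarz_ineq_sum[of "\<lambda>i. norm (A i ** Z i)" "\<lambda>i. sqrt (psq (column_space (A i)) (w i))" "{..<k}"]
    by (intro real_le_rsqrt) (simp add: psq_nonneg)
  \<comment> \<open>Squaring and cancelling one factor \<open>?s\<close> produces the constant 4
    that reappears in the rate.\<close>
  finally have "?s \<le> 2 * sqrt (?s * ?p)" using assms by linarith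
  then have "?s\<^sup>2 \<le> (2 * sqrt (?s * ?p))\<^sup>2" using s0 by (intro power_mono) auto
  then have "?s * ?s \<le> ?s * (4 * ?p)"
    using s0 p0 by (simp add: power2_eq_square mult_ac)
  then show ?thesis
    using s0 p0 by (cases "?s = 0") (auto simp: mult_le_cancel_left)
qed

lemma borel_measurable_matrix_mult_right [measurable]:
  "(\<lambda>A::complex^'n^'r. A ** (Z::complex^'n^'n)) \<in> borel_measurable borel"
proof -
  have "linear (\<lambda>A::complex^'n^'r. A ** Z)"
    by (intro linearI)
       (simp_all add: matrix_matrix_mult_def Finite_Cartesian_Product.vec_eq_iff sum.distrib[symmetric]
          scaleR_sum_right algebra_simps)
  then show ?thesis
    by (intro borel_measurable_continuous_onI linear_continuous_on) (simp add: linear_conv_bounded_linear)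
qed

text \<open>Only the dimension of each column space enters, so one value holds for every fixed
  channel of full rank, and the noise can be integrated before the channel.\<close>

lemma large_noise_chernoff:
  fixes W :: "nat \<Rightarrow> 'w \<Rightarrow> complex^'n^'r"
  assumes M: "prob_space M" and iid: "iid_gaussian M (\<lambda>(i, a, b) \<omega>. W i \<omega> $ a $ b)"
    and h: "\<And>i. i < k \<Longrightarrow> gram_det (h i) > 0" and t: "0 \<le> t" "t < 1"
  shows "(\<integral>\<^sup>+\<omega>. (\<Prod>i<k. ennreal (exp (t * psq (column_space (h i)) (W i \<omega>)))) \<partial>M) =
    ennreal ((1 - t) powr (- real (CARD('n)\<^sup>2 * k)))"
proof -
  interpret prob_space M by fact
  note blk = block_indep[OF M iid]
  have [measurable]: "W i \<in> borel_measurable M" for i by (rule blk)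
  have "(\<integral>\<^sup>+\<omega>. (\<Prod>i<k. ennreal (exp (t * psq (column_space (h i)) (W i \<omega>)))) \<partial>M) =
    (\<Prod>i<k. \<integral>\<^sup>+\<omega>. ennreal (exp (t * psq (column_space (h i)) (W i \<omega>))) \<partial>M)"
  proof (rule indep_vars_nn_integral)
    have "indep_vars (\<lambda>_. borel) W {..<k}" using blk(1) by (rule indep_vars_subset) auto
    then show "indep_vars (\<lambda>_. borel) (\<lambda>i \<omega>. ennreal (exp (t * psq (column_space (h i)) (W i \<omega>)))) {..<k}"
      by (rule indep_vars_compose2) measurable
  qed auto
  also have "\<dots> = (\<Prod>i<k. ennreal ((1 - t) powr (- real (CARD('n)\<^sup>2))))"
  proof (rule prod.cong[OF refl])
    fix i assume "i \<in> {..<k}"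
    then have "dim (column_space (h i)) = 2 * CARD('n)\<^sup>2" using h by (intro dim_column_space) auto
    then show "(\<integral>\<^sup>+\<omega>. ennreal (exp (t * psq (column_space (h i)) (W i \<omega>))) \<partial>M) = ennreal ((1 - t) powr (- real (CARD('n)\<^sup>2)))"
      using gauss_vec_exp_psq[OF blk(3)[of i] subspace_column_space[of "h i"] t]
      by (simp add: nn_integral_distr)
  qed
  also have "\<dots> = ennreal ((1 - t) powr (- real (CARD('n)\<^sup>2 * k)))"
    using t by (simp add: ennreal_power powr_power mult.commute)
  finally show ?thesis .
qed

text \<open>By independence the noise is integrated with the channel held fixed. When the
  determinant product is large, every point of \<open>Ls\<close> has received energy at least
  \<open>m\<close>, so if any of them is close the projected noise energy is at least
  \<open>m / 4\<close>; one exponential bound covers them all.\<close>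

lemma close_lattice_point_prob:
  fixes H W :: "nat \<Rightarrow> 'w \<Rightarrow> complex^'n^'r" and Ls :: "'n multiblock set"
    and \<alpha> c :: real
  assumes M: "prob_space M"
    and iidH: "iid_gaussian M (\<lambda>(i, a, b) \<omega>. H i \<omega> $ a $ b)"
    and iidW: "iid_gaussian M (\<lambda>(i, a, b) \<omega>. W i \<omega> $ a $ b)"
    and ind: "prob_space.indep_var M
           (PiM UNIV (\<lambda>_. borel)) (\<lambda>\<omega> i. H i \<omega>) (PiM UNIV (\<lambda>_. borel)) (\<lambda>\<omega> i. W i \<omega>)"
    and le: "CARD('n) \<le> CARD('r)" and u: "0 < u" "u < 1" and t: "0 \<le> t" "t < 1" and k: "k > 0"
    and Ls: "countable Ls" "\<And>l. l \<in> Ls \<Longrightarrow> 1 \<le> cmod (pdet k l)"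
  defines "B \<equiv> {\<omega> \<in> space M. (\<Prod>i<k. gram_det (H i \<omega>)) < exp (real k * c) \<or>
      (\<exists>l\<in>Ls. (\<Sum>i<k. (norm (H i \<omega> ** (\<alpha> *\<^sub>R l i)))\<^sup>2) \<le> 2 * (\<Sum>i<k. (H i \<omega> ** (\<alpha> *\<^sub>R l i)) \<bullet> W i \<omega>))}"
  shows "B \<in> sets M"
    and "measure M B \<le> (gram_moment CARD('n) CARD('r) u * exp (u * c)) ^ k +
      exp (- t * (real CARD('n) * real k * \<alpha>\<^sup>2 * exp (c / real CARD('n)) / 4)) * (1 - t) powr (- real (CARD('n)\<^sup>2 * k))"
proof -
  interpret prob_space M by fact
  let ?n = "CARD('n)"
  let ?S = "PiM UNIV (\<lambda>_::nat. borel :: (complex^'n^'r) measure)"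
  define m where "m = real ?n * real k * \<alpha>\<^sup>2 * exp (c / real ?n)"
  define K where "K = exp (- t * (m / 4)) * (1 - t) powr (- real (?n\<^sup>2 * k))"
  \<comment> \<open>Building the determinant condition into \<open>close\<close> makes the section
    of \<open>G\<close> at a bad channel empty, so the conditional bound holds for every
    \<open>h\<close>.\<close>
  define close where "close l h w \<longleftrightarrow> exp (real k * c) \<le> (\<Prod>i<k. gram_det (h i)) \<and>
    (\<Sum>i<k. (norm (h i ** (\<alpha> *\<^sub>R l i)))\<^sup>2) \<le> 2 * (\<Sum>i<k. (h i ** (\<alpha> *\<^sub>R l i)) \<bullet> w i)"
    for l :: "'n multiblock" and h w :: "nat \<Rightarrow> complex^'n^'r"
  define G where "G = (\<Union>l\<in>Ls. {x \<in> space (?S \<Otimes>\<^sub>M ?S). close l (fst x) (snd x)})"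
  have [measurable]: "H i \<in> borel_measurable M" "W i \<in> borel_measurable M" for i
    using block_indep(4)[OF M iidH] block_indep(4)[OF M iidW] by auto
  have [measurable]: "(\<lambda>x. fst x i) \<in> borel_measurable (?S \<Otimes>\<^sub>M ?S)" "(\<lambda>x. snd x i) \<in> borel_measurable (?S \<Otimes>\<^sub>M ?S)" for i
    by measurable
  have mult: "(\<lambda>x. fst x i ** Z) \<in> borel_measurable (?S \<Otimes>\<^sub>M ?S)" for i and Z :: "complex^'n^'n"
    by measurable
  have G: "G \<in> sets (?S \<Otimes>\<^sub>M ?S)"
    unfolding G_def
  proof (rule sets.countable_UN''[OF Ls(1)])
    fix l :: "'n multiblock"
    note [measurable] = mult
    show "{x \<in> space (?S \<Otimes>\<^sub>M ?S). close l (fst x) (snd x)} \<in> sets (?S \<Otimes>\<^sub>M ?S)"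
      unfolding close_def by measurable
  qed
  let ?H = "\<lambda>\<omega> i. H i \<omega>" and ?W = "\<lambda>\<omega> i. W i \<omega>"
  have mH: "?H \<in> measurable M ?S" and mW: "?W \<in> measurable M ?S"
    using ind by (auto dest: indep_var_rv1 indep_var_rv2)
  have mHW: "(\<lambda>\<omega>. (?H \<omega>, ?W \<omega>)) \<in> measurable M (?S \<Otimes>\<^sub>M ?S)" using mH mW by (rule measurable_Pair)
  let ?B1 = "{\<omega> \<in> space M. (\<Prod>i<k. gram_det (H i \<omega>)) < exp (real k * c)}"
  let ?B2 = "(\<lambda>\<omega>. (?H \<omega>, ?W \<omega>)) -` G \<inter> space M"
  have B1: "?B1 \<in> sets M" by measurable
  have B2: "?B2 \<in> sets M" by (rule measurable_sets[OF mHW G])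
  have B: "B = ?B1 \<union> ?B2"
    by (auto simp: B_def G_def close_def space_pair_measure space_PiM not_less)
  show "B \<in> sets M" unfolding B using B1 B2 by blast
  have inner: "(\<integral>\<^sup>+w. indicator G (h, w) \<partial>distr M ?S ?W) \<le> ennreal K" for h
  proof (cases "exp (real k * c) \<le> (\<Prod>i<k. gram_det (h i))")
    case False
    then have "(\<integral>\<^sup>+w. indicator G (h, w) \<partial>distr M ?S ?W) = (\<integral>\<^sup>+w. 0 \<partial>distr M ?S ?W)"
      by (intro nn_integral_cong) (auto simp: G_def close_def split: split_indicator)
    then show ?thesis by simp
  next
    case True
    have P: "(\<Prod>i<k. gram_det (h i)) > 0" by (rule less_le_trans[OF exp_gt_zero True])
    have pos: "gram_det (h i) > 0" if "i < k" for i
      using P gram_det_nonneg[of "h i"] that by (metis finite_lessThan lessThan_iff less_irrefl less_le prod_zero)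
    have "(\<integral>\<^sup>+w. indicator G (h, w) \<partial>distr M ?S ?W) = (\<integral>\<^sup>+\<omega>. indicator G (h, ?W \<omega>) \<partial>M)"
    proof (rule nn_integral_distr[OF mW])
      have "(\<lambda>w. (h, w)) \<in> measurable (distr M ?S ?W) (?S \<Otimes>\<^sub>M ?S)" by (simp add: space_PiM)
      from measurable_compose[OF this borel_measurable_indicator[OF G]]
      show "(\<lambda>w. indicator G (h, w) :: ennreal) \<in> borel_measurable (distr M ?S ?W)" .
    qed
    also have "\<dots> \<le> (\<integral>\<^sup>+\<omega>. ennreal (exp (- t * (m / 4))) * (\<Prod>i<k. ennreal (exp (t * psq (column_space (h i)) (W i \<omega>)))) \<partial>M)"
    proof (rule nn_integral_mono)
      fix \<omega>
      show "indicator G (h, ?W \<omega>) \<le> ennreal (exp (- t * (m / 4))) * (\<Prod>i<k. ennreal (exp (t * psq (column_space (h i)) (W i \<omega>))))"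
      proof (cases "(h, ?W \<omega>) \<in> G")
        case True': True
        then obtain l where l: "l \<in> Ls" "close l h (?W \<omega>)" by (auto simp: G_def)
        let ?p = "\<Sum>i<k. psq (column_space (h i)) (W i \<omega>)"
        have "exp (c / real ?n) = exp (real k * c) powr (1 / (real ?n * real k))"
          using k by (simp add: powr_def)
        also have "\<dots> \<le> (\<Prod>i<k. gram_det (h i)) powr (1 / (real ?n * real k))"
          using True by (intro powr_mono2) auto
        finally have "m \<le> real ?n * real k * \<alpha>\<^sup>2 * (\<Prod>i<k. gram_det (h i)) powr (1 / (real ?n * real k))"
          unfolding m_def by (intro mult_left_mono) auto
        also have "\<dots> \<le> (\<Sum>i<k. (norm (h i ** (\<alpha> *\<^sub>R l i)))\<^sup>2)"
          by (rule received_distance_bound[OF k Ls(2)[OF l(1)]])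
        also have "\<dots> \<le> 4 * ?p"
          using l(2) by (intro close_point_imp_large_noise) (simp add: close_def)
        finally have "t * (m / 4) \<le> t * ?p" using t by (intro mult_left_mono) auto
        then have "1 \<le> exp (- t * (m / 4)) * exp (t * ?p)" by (simp add: mult_exp_exp)
        then show ?thesis
          by (simp add: True' prod_ennreal exp_sum[symmetric] sum_distrib_left[symmetric] ennreal_mult[symmetric])
      qed simp
    qed
    also have "\<dots> = ennreal (exp (- t * (m / 4))) * ennreal ((1 - t) powr (- real (?n\<^sup>2 * k)))"
      by (subst nn_integral_cmult, measurable, subst large_noise_chernoff[OF M iidW pos t]) auto
    finally show ?thesis by (simp add: K_def ennreal_mult)
  qed
  have "emeasure M ?B2 = (\<integral>\<^sup>+\<omega>. indicator G (?H \<omega>, ?W \<omega>) \<partial>M)"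
    by (subst nn_integral_indicator[OF B2, symmetric]) (auto intro!: nn_integral_cong split: split_indicator)
  also have "\<dots> = (\<integral>\<^sup>+h. \<integral>\<^sup>+w. indicator G (h, w) \<partial>distr M ?S ?W \<partial>distr M ?S ?H)"
    by (rule indep_var_nn_integral[OF ind borel_measurable_indicator[OF G]])
  also have "\<dots> \<le> (\<integral>\<^sup>+h. ennreal K \<partial>distr M ?S ?H)"
    by (intro nn_integral_mono inner)
  also have "\<dots> = ennreal K"
    using prob_space.emeasure_space_1[OF prob_space_distr[OF mH]] by simp
  finally have "measure M ?B2 \<le> K" by (simp add: emeasure_eq_measure K_def)
  moreover have "measure M ?B1 \<le> (gram_moment ?n CARD('r) u * exp (u * c)) ^ k"
    by (rule prod_gram_det_chernoff[OF M iidH le u])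
  moreover have "measure M B \<le> measure M ?B1 + measure M ?B2"
    unfolding B using B1 B2 by (rule measure_Un_le)
  ultimately show "measure M B \<le> (gram_moment ?n CARD('r) u * exp (u * c)) ^ k +
      exp (- t * (real ?n * real k * \<alpha>\<^sup>2 * exp (c / real ?n) / 4)) * (1 - t) powr (- real (?n\<^sup>2 * k))"
    by (simp add: K_def m_def)
qed

text \<open>The covering event \<open>B\<close> does not mention the transmitted codeword, so
  averaging over codewords costs nothing. Off the event of a small determinant product all channel
  matrices have full rank, which guarantees that the decoder has a minimizer.\<close>

lemma error_prob_bound:
  fixes H W :: "nat \<Rightarrow> 'w \<Rightarrow> complex^'n^'r" and L :: "'n multiblock set"
  assumes M: "prob_space M"
    and iidH: "iid_gaussian M (\<lambda>(i, a, b) \<omega>. H i \<omega> $ a $ b)"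
    and iidW: "iid_gaussian M (\<lambda>(i, a, b) \<omega>. W i \<omega> $ a $ b)"
    and ind: "prob_space.indep_var M
           (PiM UNIV (\<lambda>_. borel)) (\<lambda>\<omega> i. H i \<omega>) (PiM UNIV (\<lambda>_. borel)) (\<lambda>\<omega> i. W i \<omega>)"
    and le: "CARD('n) \<le> CARD('r)" and u: "0 < u" "u < 1" and t: "0 \<le> t" "t < 1" and k: "k > 0"
    and L: "is_lattice k d L" "det_min k L = 1" and \<alpha>: "code_scale P R k L > 0"
    and S: "admissible_shift P R k L S"
    and A: "lattice_code P R k L S \<subseteq> A" "A \<subseteq> shifted_lattice P R k L S"
    and D: "min_distance_decoder k A D"
  shows "error_prob M H W k (lattice_code P R k L S) D \<le> (gram_moment CARD('n) CARD('r) u * exp (u * c)) ^ k +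
      exp (- t * (real CARD('n) * real k * (code_scale P R k L)\<^sup>2 * exp (c / real CARD('n)) / 4)) *
      (1 - t) powr (- real (CARD('n)\<^sup>2 * k))"
proof -
  interpret prob_space M by fact
  let ?C = "lattice_code P R k L S" and ?\<alpha> = "code_scale P R k L"
  define B where "B = {\<omega> \<in> space M. (\<Prod>i<k. gram_det (H i \<omega>)) < exp (real k * c) \<or>
      (\<exists>l\<in>L - {\<lambda>_. 0}. (\<Sum>i<k. (norm (H i \<omega> ** (?\<alpha> *\<^sub>R l i)))\<^sup>2) \<le> 2 * (\<Sum>i<k. (H i \<omega> ** (?\<alpha> *\<^sub>R l i)) \<bullet> W i \<omega>))}"
  have cL: "countable (L - {\<lambda>_. 0})" using countable_lattice[OF L(1)] by auto
  have "\<And>l. l \<in> L - {\<lambda>_. 0} \<Longrightarrow> 1 \<le> cmod (pdet k l)" using det_min_lower[OF L(2)] by auto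
  note B = close_lattice_point_prob[OF M iidH iidW ind le u t k cL this, where c = c and \<alpha> = ?\<alpha>, folded B_def]
  have "0 < 2 powr (R * real CARD('n) * real k)" by simp
  also have "\<dots> \<le> real (card ?C)" using S by (simp add: admissible_shift_def)
  finally have C: "finite ?C" "?C \<noteq> {}" by (auto simp: card_gt_0_iff)
  interpret C: prob_space "uniform_count_measure ?C" by (rule prob_space_uniform_count_measure[OF C])
  interpret CM: pair_prob_space "uniform_count_measure ?C" M ..
  let ?E = "{(X, \<omega>) \<in> ?C \<times> space M.
          D (\<lambda>i\<in>{..<k}. H i \<omega>, \<lambda>i\<in>{..<k}. H i \<omega> ** X i + W i \<omega>) \<noteq> X}"
  have sub: "?E \<subseteq> ?C \<times> B"
  proof (clarsimp)
    fix X \<omega> assume X: "X \<in> ?C" and \<omega>: "\<omega> \<in> space M"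
      and err: "D (\<lambda>i\<in>{..<k}. H i \<omega>, \<lambda>i\<in>{..<k}. H i \<omega> ** X i + W i \<omega>) \<noteq> X"
    show "\<omega> \<in> B"
    proof (cases "(\<Prod>i<k. gram_det (H i \<omega>)) < exp (real k * c)")
      case False
      then have P: "(\<Prod>i<k. gram_det (H i \<omega>)) > 0" by (meson exp_gt_zero less_le_trans not_less)
      have pos: "gram_det (H i \<omega>) > 0" if "i < k" for i
        using P gram_det_nonneg[of "H i \<omega>"] that by (metis finite_lessThan lessThan_iff less_irrefl less_le prod_zero)
      have "X \<in> A" using A X by auto
      from decoding_error_imp_close_lattice_point[OF L(1) \<alpha> A(2) this pos D err] show ?thesis
        using \<omega> by (auto simp: B_def)
    qed (use \<omega> in \<open>simp add: B_def\<close>)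
  qed
  have CB: "?C \<times> B \<in> sets (uniform_count_measure ?C \<Otimes>\<^sub>M M)"
    using B(1) by (intro pair_measureI) (auto simp: sets_uniform_count_measure)
  \<comment> \<open>No measurability of the error event is needed: non-measurable sets have measure \<open>0\<close>.\<close>
  have "error_prob M H W k ?C D \<le> measure (uniform_count_measure ?C \<Otimes>\<^sub>M M) (?C \<times> B)"
    unfolding error_prob_def by (rule CM.finite_measure_mono[OF sub CB])
  also have "\<dots> = measure (uniform_count_measure ?C) ?C * measure M B"
    using B(1) by (simp add: measure_def emeasure_pair_measure_Times sets_uniform_count_measure enn2real_mult)
  also have "measure (uniform_count_measure ?C) ?C = 1"
    using C.prob_space by (simp add: space_uniform_count_measure)
  finally show ?thesis using B(2) by simp
qed

section \<open>Asymptotics\<close>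

text \<open>Induction through \<open>(1 + 1 / N) ^ (N + 1) \<ge> exp 1\<close>. The polynomial
  factor is harmless because only the \<open>N\<close>-th root matters later.\<close>

lemma fact_le_Stirling:
  assumes "N > 0"
  shows "fact N \<le> exp 1 * real N * (real N / exp 1) ^ N"
  using assms
proof (induction N rule: nat_induct_non_zero)
  case 1 then show ?case by simp
next
  case (Suc N)
  let ?x = "real N" and ?e = "exp 1 :: real"
  have "1 / (?x + 1) \<le> ln ((?x + 1) / ?x)"
  proof -
    have "ln (?x / (?x + 1)) \<le> ?x / (?x + 1) - 1" using Suc by (intro ln_le_minus_one) auto
    then show ?thesis using Suc by (simp add: ln_div field_simps)
  qed
  then have "1 \<le> (?x + 1) * ln ((?x + 1) / ?x)" using Suc by (simp add: field_simps)
  then have "exp 1 \<le> exp (real (N + 1) * ln ((?x + 1) / ?x))" by (simp add: add.commute)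
  also have "\<dots> = ((?x + 1) / ?x) ^ (N + 1)" using Suc by (simp only: exp_of_nat_mult) simp
  finally have e: "?e * ?x ^ (N + 1) \<le> (?x + 1) ^ (N + 1)"
    using Suc by (simp add: power_divide field_simps)
  have "fact (Suc N) = (?x + 1) * fact N" by simp
  also have "\<dots> \<le> (?x + 1) * (?e * ?x * (?x / ?e) ^ N)" using Suc by (intro mult_left_mono) auto
  also have "\<dots> = (?x + 1) * (?e * ?x ^ (N + 1)) / ?e ^ N" by (simp add: power_divide)
  also have "\<dots> \<le> (?x + 1) * (?x + 1) ^ (N + 1) / ?e ^ N"
    using e by (intro divide_right_mono mult_left_mono) auto
  also have "\<dots> = ?e * real (Suc N) * (real (Suc N) / ?e) ^ Suc N"
    by (simp add: power_divide add.commute)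
  finally show ?case .
qed

text \<open>With \<open>N = n\<^sup>2 * k\<close>, dividing \<open>pi * n * k\<close> by the
  Stirling term \<open>N / exp 1\<close> gives \<open>pi * exp 1 / n\<close>, the source of pi and e
  in the rate. The remaining factor tends to 1.\<close>

lemma code_const_root_lower:
  assumes "n > 0" "k > 0"
  shows "pi * exp 1 / real n * (exp 1 * real (n\<^sup>2 * k)) powr (- (1 / real (n\<^sup>2 * k))) \<le>
    code_const n k powr (1 / real (n\<^sup>2 * k))"
proof -
  define N where "N = n\<^sup>2 * k"
  have N: "N > 0" using assms by (simp add: N_def)
  let ?x = "exp 1 * real N" and ?y = "real N / exp 1" and ?z = "pi * real n * real k"
  have root: "(x ^ N) powr (1 / real N) = x" if "x > 0" for x :: real
    using that N by (simp add: powr_realpow[symmetric] powr_powr)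
  have "fact N powr (1 / real N) \<le> (?x * ?y ^ N) powr (1 / real N)"
    using fact_le_Stirling[OF N] by (intro powr_mono2) auto
  also have "\<dots> = ?x powr (1 / real N) * ?y"
    using N by (simp add: powr_mult root)
  finally have f: "fact N powr (1 / real N) \<le> ?x powr (1 / real N) * ?y" .
  have "pi * exp 1 / real n * ?x powr (- (1 / real N)) = ?z / (?x powr (1 / real N) * ?y)"
    using assms by (simp add: N_def powr_minus field_simps power2_eq_square)
  also have "\<dots> \<le> ?z / fact N powr (1 / real N)"
    using f assms by (intro divide_left_mono) (auto simp: N_def)
  also have "\<dots> = code_const n k powr (1 / real N)"
    using assms by (simp add: code_const_def N_def[symmetric] powr_divide root)
  finally show ?thesis by (simp add: N_def)
qed

lemma code_scale_sq_lower:
  fixes L :: "('n::finite) multiblock set"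
  assumes L: "is_lattice k (2 * (CARD('n)\<^sup>2 * k)) L" and k: "k > 0" and P: "P > 0"
    and C: "lattice_vol k (2 * (CARD('n)\<^sup>2 * k)) L powr (1 / real (CARD('n)\<^sup>2 * k)) \<le> C\<^sub>L"
  shows "pi * exp 1 / real CARD('n) * (exp 1 * real (CARD('n)\<^sup>2 * k)) powr (- (1 / real (CARD('n)\<^sup>2 * k))) *
      P / (2 powr (R / real CARD('n)) * C\<^sub>L) \<le> (code_scale P R k L)\<^sup>2"
proof -
  let ?n = "CARD('n)" let ?N = "?n\<^sup>2 * k" let ?V = "lattice_vol k (2 * ?N) L"
  let ?a = "code_const ?n k powr (1 / real ?N) * P / (2 powr (R / real ?n) * ?V powr (1 / real ?N))"
  have V: "?V > 0" using lattice_vol_basis[OF L] by metis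
  have "code_scale P R k L = sqrt ?a" by (simp add: code_scale_def Let_def)
  then have "(code_scale P R k L)\<^sup>2 = ?a" using P by simp
  moreover have "pi * exp 1 / real ?n * (exp 1 * real ?N) powr (- (1 / real ?N)) * P / (2 powr (R / real ?n) * C\<^sub>L) \<le> ?a"
  proof (rule frac_le)
    show "pi * exp 1 / real ?n * (exp 1 * real ?N) powr (- (1 / real ?N)) * P \<le> code_const ?n k powr (1 / real ?N) * P"
      using code_const_root_lower[of ?n k] k P by (intro mult_right_mono) auto
    show "2 powr (R / real ?n) * ?V powr (1 / real ?N) \<le> 2 powr (R / real ?n) * C\<^sub>L"
      using C by (intro mult_left_mono) auto
  qed (use V P in auto)
  ultimately show ?thesis by simp
qed

lemma vanishes_exponentially_alongI:
  assumes "0 < \<rho>\<^sub>1" "\<rho>\<^sub>1 < 1" "0 < \<rho>\<^sub>2" "\<rho>\<^sub>2 < 1"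
    and "\<forall>\<^sub>F k in inf at_top (principal K). p k \<le> \<rho>\<^sub>1 ^ k + \<rho>\<^sub>2 ^ k"
  shows "vanishes_exponentially_along K p"
proof -
  define \<rho> where "\<rho> = max \<rho>\<^sub>1 \<rho>\<^sub>2"
  have \<rho>: "0 < \<rho>" "\<rho> < 1" using assms by (auto simp: \<rho>_def)
  have "\<rho>\<^sub>1 ^ k + \<rho>\<^sub>2 ^ k \<le> 2 * exp (- (- ln \<rho>) * real k)" for k
  proof -
    have "\<rho>\<^sub>1 ^ k \<le> \<rho> ^ k" "\<rho>\<^sub>2 ^ k \<le> \<rho> ^ k" using assms by (auto intro!: power_mono simp: \<rho>_def)
    moreover have "exp (- (- ln \<rho>) * real k) = \<rho> ^ k"
      using \<rho> by (simp add: exp_of_nat2_mult)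
    ultimately show ?thesis by simp
  qed
  then have "\<forall>\<^sub>F k in inf at_top (principal K). p k \<le> 2 * exp (- (- ln \<rho>) * real k)"
    using assms(5) by (auto elim!: eventually_mono intro: order_trans)
  moreover have "- ln \<rho> > 0" using \<rho> by simp
  ultimately show ?thesis unfolding vanishes_exponentially_along_def by (meson zero_less_numeral)
qed

lemma vanishes_exponentially_along_imp_vanishes:
  assumes "\<And>k. 0 \<le> p k" "vanishes_exponentially_along K p"
  shows "vanishes_along K p"
proof -
  obtain A a where a: "a > 0" and ev: "\<forall>\<^sub>F k in inf at_top (principal K). p k \<le> A * exp (- a * real k)"
    using assms(2) by (auto simp: vanishes_exponentially_along_def)
  have "((\<lambda>k. A * exp (- a * real k)) \<longlongrightarrow> 0) at_top"
    using a by real_asymp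
  then have lim: "((\<lambda>k. A * exp (- a * real k)) \<longlongrightarrow> 0) (inf at_top (principal K))"
    by (rule filterlim_mono) auto
  show ?thesis
    unfolding vanishes_along_def
    by (rule tendsto_sandwich[OF _ ev tendsto_const lim]) (simp add: assms(1))
qed

section \<open>Expectation of the log determinant in terms of Digamma values\<close>

lemma log_det_gram_eq_log:
  fixes A :: "complex^'n^'r"
  shows "log_det_gram P A = log 2 ((P / real CARD('n)) ^ CARD('n) * gram_det A)"
proof -
  let ?p = "P / real CARD('n)"
  have "?p *\<^sub>R (ctranspose A ** A) = (\<chi> i. of_real ?p *s (ctranspose A ** A) $ i)"
    unfolding Finite_Cartesian_Product.vec_eq_iff by (simp add: scaleR_eq_vec_scale)
  then have "det (?p *\<^sub>R (ctranspose A ** A)) = of_real (?p ^ CARD('n) * gram_det A)"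
    using Determinants.det_rows_mul[of "\<lambda>_. of_real ?p" "\<lambda>i. (ctranspose A ** A) $ i"] det_ctranspose_self[of A]
    by simp
  then show ?thesis by (simp add: log_det_gram_def)
qed

lemma log_det_gram_eq:
  fixes A :: "complex^'n^'r"
  assumes "P > 0" "gram_det A > 0"
  shows "log_det_gram P A = real CARD('n) * log 2 (P / real CARD('n)) + ln (gram_det A) / ln 2"
proof -
  let ?p = "P / real CARD('n)"
  have p: "?p > 0" using assms by simp
  have "log_det_gram P A = log 2 (?p ^ CARD('n) * gram_det A)"
    by (rule log_det_gram_eq_log)
  also have "\<dots> = real CARD('n) * log 2 ?p + log 2 (gram_det A)"
    using p assms by (simp add: log_mult log_nat_power)
  finally show ?thesis by (simp add: log_def)
qed

lemma log_det_gram_integral: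
  fixes G :: "'w \<Rightarrow> complex^'n^'r"
  assumes M: "prob_space M" and iid: "iid_gaussian M (\<lambda>(a, b) \<omega>. G \<omega> $ a $ b)"
    and le: "CARD('n) \<le> CARD('r)" and P: "P > 0"
  shows "integrable M (\<lambda>\<omega>. log_det_gram P (G \<omega>))"
    and "(\<integral>\<omega>. log_det_gram P (G \<omega>) \<partial>M) =
      real CARD('n) * log 2 (P / real CARD('n)) + gram_log_mean CARD('n) CARD('r) / ln 2"
proof -
  interpret prob_space M by fact
  note ln = ln_gram_det_integral[OF M iid le]
  let ?f = "\<lambda>\<omega>. real CARD('n) * log 2 (P / real CARD('n)) + ln (gram_det (G \<omega>)) / ln 2"
  have m: "G \<in> borel_measurable M"
  proof -
    have "(\<lambda>\<omega>. \<chi> a b. G \<omega> $ a $ b) \<in> borel_measurable M"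
      using iid_gaussian_measurable[OF M iid] by (intro borel_measurable_vec_lambda) (metis case_prod_conv)
    then show ?thesis by simp
  qed
  have "gram_det (G \<omega>) > 0 \<Longrightarrow> log_det_gram P (G \<omega>) = ?f \<omega>" for \<omega>
    using P by (rule log_det_gram_eq)
  moreover have "AE \<omega> in M. gram_det (G \<omega>) > 0"
    using gram_det_powr_nn_integral(1)[OF M iid le, of "1/2"] by simp
  ultimately have ae: "AE \<omega> in M. log_det_gram P (G \<omega>) = ?f \<omega>" by auto
  have meas: "(\<lambda>\<omega>. log_det_gram P (G \<omega>)) \<in> borel_measurable M"
    unfolding log_det_gram_eq_log using m by simp
  have int: "integrable M ?f" using ln(1) by auto
  show "integrable M (\<lambda>\<omega>. log_det_gram P (G \<omega>))"
    using integrable_cong_AE[OF meas borel_measurable_integrable[OF int] ae] int by simp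
  have "(\<integral>\<omega>. log_det_gram P (G \<omega>) \<partial>M) = integral\<^sup>L M ?f"
    by (rule integral_cong_AE[OF meas borel_measurable_integrable[OF int] ae])
  also have "\<dots> = real CARD('n) * log 2 (P / real CARD('n)) + gram_log_mean CARD('n) CARD('r) / ln 2"
    using ln by (simp add: prob_space)
  finally show "(\<integral>\<omega>. log_det_gram P (G \<omega>) \<partial>M) =
      real CARD('n) * log 2 (P / real CARD('n)) + gram_log_mean CARD('n) CARD('r) / ln 2" .
qed

lemma gram_log_mean_eq:
  assumes "n \<le> r"
  shows "gram_log_mean n r = (\<Sum>i = r - n + 1..r. Digamma (real i))"
  unfolding gram_log_mean_def
  by (rule sum.reindex_bij_witness[of _ "\<lambda>i. r - i" "\<lambda>i. r - i"]) (use assms in \<open>auto simp: of_nat_diff\<close>)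

section \<open>From the rate margin to an exponential bound\<close>

lemma sub_one_exp_less_one:
  fixes s :: real
  assumes "s > 1"
  shows "s * exp (- (s - 1)) < 1"
proof -
  \<comment> \<open>The inequality \<open>ln x \<le> x - 1\<close> is used at \<open>sqrt s\<close>;
    the gap \<open>(sqrt s - 1)\<^sup>2\<close> between the two sides then makes the result
    strict.\<close>
  have "ln s = 2 * ln (sqrt s)" using assms by (simp add: ln_sqrt)
  also have "\<dots> \<le> 2 * (sqrt s - 1)" using assms ln_le_minus_one[of "sqrt s"] by simp
  also have "\<dots> < s - 1"
  proof -
    have "(sqrt s - 1)\<^sup>2 > 0" using assms by simp
    then show ?thesis using assms by (simp add: power2_eq_square algebra_simps)
  qed
  finally have "exp (ln s) < exp (s - 1)" by (simp only: exp_less_mono)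
  then show ?thesis
    unfolding exp_minus[of "s - 1"] inverse_eq_divide using assms by simp
qed

text \<open>The polynomial factor of the Stirling bound tends to 1 under the root, so it eventually
  exceeds any fixed number below 1.\<close>

lemma exponent_root_limit:
  fixes n :: nat
  assumes "n > 0" "q < 1"
  shows "\<forall>\<^sub>F k in at_top. q \<le> (exp 1 * real (n\<^sup>2 * k)) powr (- (1 / real (n\<^sup>2 * k)))"
proof -
  have "((\<lambda>x::real. (exp 1 * x) powr (- (1 / x))) \<longlongrightarrow> 1) at_top" by real_asymp
  moreover have "filterlim (\<lambda>k. real (n\<^sup>2 * k)) at_top at_top"
    using assms(1) by (intro filterlim_compose[OF filterlim_real_sequentially] filterlim_subseq)
      (auto simp: strict_mono_def)
  ultimately have "(\<lambda>k. (exp 1 * real (n\<^sup>2 * k)) powr (- (1 / real (n\<^sup>2 * k)))) \<longlonglongrightarrow> 1"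
    by (rule filterlim_compose)
  from order_tendstoD(1)[OF this assms(2)] show ?thesis by (auto elim: eventually_mono)
qed

text \<open>The rate margin \<open>q > 1\<close> is split into three cube roots. One pays for the
  Stirling factor, one for the fluctuation of the determinants, and the last, \<open>s\<close>,
  remains as a lower bound for the ratio of the noise threshold to
  \<open>CARD('n)\<^sup>2 * k\<close>, the mean of the projected noise energy.\<close>

lemma achievable_rate_exponent:
  fixes L :: "nat \<Rightarrow> ('n::finite) multiblock set" and K :: "nat set"
  assumes K: "0 \<notin> K"
    and L: "\<And>k. k \<in> K \<Longrightarrow> is_lattice k (2 * (CARD('n)\<^sup>2 * k)) (L k)"
    and C: "C\<^sub>L > 0" "\<And>k. k \<in> K \<Longrightarrow>
        lattice_vol k (2 * (CARD('n)\<^sup>2 * k)) (L k) powr (1 / real (CARD('n)\<^sup>2 * k)) \<le> C\<^sub>L"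
    and P: "P > 0"
    and R: "R < real CARD('n) * log 2 (P / real CARD('n)) + \<psi> / ln 2 - real CARD('n) * log 2 C\<^sub>L
              + real CARD('n) * log 2 (pi * exp 1 / (4 * real CARD('n)))"
  obtains \<epsilon> t \<rho> :: real where "\<epsilon> > 0" "0 \<le> t" "t < 1" "0 < \<rho>" "\<rho> < 1"
    "\<forall>\<^sub>F k in inf at_top (principal K).
      exp (- t * (real CARD('n) * real k * (code_scale P R k (L k))\<^sup>2 * exp ((\<psi> - \<epsilon>) / real CARD('n)) / 4)) *
      (1 - t) powr (- real (CARD('n)\<^sup>2 * k)) \<le> \<rho> ^ k"
proof -
  let ?n = "real CARD('n)"
  have n: "?n > 0" by simp
  \<comment> \<open>\<open>?n * log 2 y\<close> is the bound on the rate, so \<open>R\<close> lies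
    below it exactly when \<open>q > 1\<close>.\<close>
  define y where "y = P / ?n * exp (\<psi> / ?n) * (pi * exp 1 / (4 * ?n)) / C\<^sub>L"
  have y: "y > 0" using P C n by (simp add: y_def)
  define q where "q = y / 2 powr (R / ?n)"
  have q: "q > 0" using y by (simp add: q_def)
  have lnq: "?n * ln q = ln 2 * (?n * log 2 (P / ?n) + \<psi> / ln 2 - ?n * log 2 C\<^sub>L
              + ?n * log 2 (pi * exp 1 / (4 * ?n)) - R)"
  proof -
    have "ln y = ln (P / ?n) + \<psi> / ?n + ln (pi * exp 1 / (4 * ?n)) - ln C\<^sub>L"
      unfolding y_def using P C n by (subst ln_div ln_mult; simp)+
    moreover have "ln (2 powr (R / ?n)) = R / ?n * ln 2" by (simp add: ln_powr)
    ultimately have lnq: "ln q = ln (P / ?n) + \<psi> / ?n + ln (pi * exp 1 / (4 * ?n)) - ln C\<^sub>L - R / ?n * ln 2"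
      unfolding q_def using y by (simp add: ln_div)
    have "?n * ln q = ?n * ln (P / ?n) + \<psi> + ?n * ln (pi * exp 1 / (4 * ?n)) - ?n * ln C\<^sub>L - R * ln 2"
    proof -
      have *: "m * x = m * a + \<psi> + m * b - m * c - R * l"
        if "x = a + \<psi> / m + b - c - R / m * l" "m > 0" for m x a b c l :: real
        unfolding that(1) using that(2) by (simp add: field_simps)
      show ?thesis by (rule *[OF lnq n])
    qed
    then show ?thesis by (simp add: log_def algebra_simps)
  qed
  then have "?n * ln q > 0" using R by simp
  then have "ln q > 0" using n by (simp add: zero_less_mult_iff)
  then have q1: "q > 1" using q by simp
  \<comment> \<open>Chosen so that \<open>exp (- \<epsilon> / ?n)\<close> equals
    \<open>q powr (- (1 / 3))\<close>.\<close>
  define \<epsilon> where "\<epsilon> = ?n * ln q / 3"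
  define s where "s = q powr (1 / 3)"
  have s: "s > 1" using q1 by (simp add: s_def)
  \<comment> \<open>The minimizer of \<open>exp (- t * s) / (1 - t)\<close>, the Chernoff factor per
    complex noise dimension; its minimum is \<open>s * exp (- (s - 1))\<close>.\<close>
  define t where "t = 1 - 1 / s"
  have t: "0 \<le> t" "t < 1" "1 - t = 1 / s" "t * s = s - 1" using s by (auto simp: t_def field_simps)
  define \<rho> where "\<rho> = (s * exp (- (s - 1))) ^ (CARD('n)\<^sup>2)"
  have \<rho>: "0 < \<rho>" "\<rho> < 1"
    using s sub_one_exp_less_one[OF s] by (auto simp: \<rho>_def power_less_one_iff)
  have "q powr (- (1 / 3)) < 1" using q1 by (simp add: powr_less_one)
  from exponent_root_limit[OF _ this, of "CARD('n)"]
  have ev: "\<forall>\<^sub>F k in at_top. q powr (- (1 / 3)) \<le> (exp 1 * real (CARD('n)\<^sup>2 * k)) powr (- (1 / real (CARD('n)\<^sup>2 * k)))"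
    by simp
  have main: "exp (- t * (?n * real k * (code_scale P R k (L k))\<^sup>2 * exp ((\<psi> - \<epsilon>) / ?n) / 4)) *
      (1 - t) powr (- real (CARD('n)\<^sup>2 * k)) \<le> \<rho> ^ k"
    if k: "k \<in> K" and b: "q powr (- (1 / 3)) \<le> (exp 1 * real (CARD('n)\<^sup>2 * k)) powr (- (1 / real (CARD('n)\<^sup>2 * k)))" for k
  proof -
    let ?N = "CARD('n)\<^sup>2 * k" and ?\<alpha> = "code_scale P R k (L k)"
    have k0: "k > 0" using k K by (cases "k = 0") auto
    have "pi * exp 1 / ?n * q powr (- (1 / 3)) * P / (2 powr (R / ?n) * C\<^sub>L) \<le>
      pi * exp 1 / ?n * (exp 1 * real ?N) powr (- (1 / real ?N)) * P / (2 powr (R / ?n) * C\<^sub>L)"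
      using b P C by (intro divide_right_mono mult_right_mono mult_left_mono) auto
    also have "\<dots> \<le> ?\<alpha>\<^sup>2"
      by (rule code_scale_sq_lower[OF L[OF k] k0 P C(2)[OF k]])
    finally have \<alpha>: "pi * exp 1 / ?n * q powr (- (1 / 3)) * P / (2 powr (R / ?n) * C\<^sub>L) \<le> ?\<alpha>\<^sup>2" .
    have e: "exp ((\<psi> - \<epsilon>) / ?n) = exp (\<psi> / ?n) * q powr (- (1 / 3))"
    proof -
      have "\<epsilon> / ?n = 1 / 3 * ln q" using n by (simp add: \<epsilon>_def)
      then have "(\<psi> - \<epsilon>) / ?n = \<psi> / ?n + (- (1 / 3)) * ln q"
        by (simp add: diff_divide_distrib)
      moreover have "exp ((- (1 / 3)) * ln q) = q powr (- (1 / 3))"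
        using q by (simp add: powr_def)
      ultimately show ?thesis by (simp only: exp_add)
    qed
    have "real ?N * s = ?n * real k * (pi * exp 1 / ?n * q powr (- (1 / 3)) * P / (2 powr (R / ?n) * C\<^sub>L)) * (exp (\<psi> / ?n) * q powr (- (1 / 3))) / 4"
    proof -
      have "q powr (1 / 3) = q * (q powr (- (1 / 3)) * q powr (- (1 / 3)))"
        using q by (simp add: powr_add[symmetric] powr_mult_base)
      then have "s = y / 2 powr (R / ?n) * (q powr (- (1 / 3)) * q powr (- (1 / 3)))"
        by (simp add: s_def q_def)
      then show ?thesis using n C by (simp add: y_def field_simps power2_eq_square)
    qed
    also have "\<dots> \<le> ?n * real k * ?\<alpha>\<^sup>2 * (exp (\<psi> / ?n) * q powr (- (1 / 3))) / 4"
      using \<alpha> by (intro divide_right_mono mult_right_mono mult_left_mono) auto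
    also have "\<dots> = ?n * real k * ?\<alpha>\<^sup>2 * exp ((\<psi> - \<epsilon>) / ?n) / 4" by (simp only: e)
    finally have "t * (real ?N * s) \<le> t * (?n * real k * ?\<alpha>\<^sup>2 * exp ((\<psi> - \<epsilon>) / ?n) / 4)"
      using t by (intro mult_left_mono) auto
    moreover have "t * (real ?N * s) = real ?N * (s - 1)" by (simp only: t(4)[symmetric]) simp
    ultimately have "real ?N * (s - 1) \<le> t * (?n * real k * ?\<alpha>\<^sup>2 * exp ((\<psi> - \<epsilon>) / ?n) / 4)"
      by (simp only:)
    then have "exp (- t * (?n * real k * ?\<alpha>\<^sup>2 * exp ((\<psi> - \<epsilon>) / ?n) / 4)) \<le> exp (real ?N * (- (s - 1)))"
      by (simp only: exp_le_cancel_iff mult_minus_left mult_minus_right neg_le_iff_le)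
    then have "exp (- t * (?n * real k * ?\<alpha>\<^sup>2 * exp ((\<psi> - \<epsilon>) / ?n) / 4)) * (1 - t) powr (- real ?N) \<le>
      exp (real ?N * (- (s - 1))) * (1 - t) powr (- real ?N)"
      by (intro mult_right_mono) auto
    also have pw: "(1 - t) powr (- real ?N) = s ^ ?N"
      unfolding t(3) by (subst powr_minus, subst powr_realpow) (use s in \<open>auto simp: power_one_over\<close>)
    also have "exp (real ?N * (- (s - 1))) * s ^ ?N = \<rho> ^ k"
      unfolding exp_of_nat_mult \<rho>_def power_mult[symmetric] power_mult_distrib by (simp only: mult.commute)
    finally show ?thesis unfolding pw .
  qed
  have \<epsilon>: "\<epsilon> > 0" using \<open>?n * ln q > 0\<close> by (simp add: \<epsilon>_def)
  have "\<forall>\<^sub>F k in inf at_top (principal K).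
      exp (- t * (?n * real k * (code_scale P R k (L k))\<^sup>2 * exp ((\<psi> - \<epsilon>) / ?n) / 4)) *
      (1 - t) powr (- real (CARD('n)\<^sup>2 * k)) \<le> \<rho> ^ k"
    unfolding eventually_inf_principal using ev main by (auto elim: eventually_mono)
  then show thesis by (rule that[OF \<epsilon> t(1,2) \<rho>])
qed

theorem mainTheorem6:
  fixes M :: "'w measure"
    and H W :: "nat \<Rightarrow> 'w \<Rightarrow> complex^'n::finite^'r::finite"
    and G :: "'w \<Rightarrow> complex^'n^'r"
    and K :: "nat set"
    and L :: "nat \<Rightarrow> 'n multiblock set"
    and C\<^sub>L P :: real
  assumes "CARD('n) \<le> CARD('r)"
    and "prob_space M"
    and "iid_gaussian M (\<lambda>(i, a, b) \<omega>. H i \<omega> $ a $ b)"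
    and "iid_gaussian M (\<lambda>(i, a, b) \<omega>. W i \<omega> $ a $ b)"
    and "prob_space.indep_var M
           (PiM UNIV (\<lambda>_. borel)) (\<lambda>\<omega> i. H i \<omega>) (PiM UNIV (\<lambda>_. borel)) (\<lambda>\<omega> i. W i \<omega>)"
    and "iid_gaussian M (\<lambda>(a, b) \<omega>. G \<omega> $ a $ b)"
    and "infinite K" and "0 \<notin> K"
    and "\<And>k. k \<in> K \<Longrightarrow> is_lattice k (2 * CARD('n)\<^sup>2 * k) (L k)"
    and "\<And>k. k \<in> K \<Longrightarrow> det_min k (L k) = 1"
    and "C\<^sub>L > 0"
    and "\<And>k. k \<in> K \<Longrightarrow>
           lattice_vol k (2 * CARD('n)\<^sup>2 * k) (L k) powr (1 / real (CARD('n)\<^sup>2 * k)) \<le> C\<^sub>L"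
    and "P > 0"
  shows
    "(\<forall>R. R < (\<integral>\<omega>. log_det_gram P (G \<omega>) \<partial>M) - real CARD('n) * log 2 C\<^sub>L
              + real CARD('n) * log 2 (pi * exp 1 / (4 * real CARD('n))) \<longrightarrow>
        (\<forall>k\<in>K. \<exists>S. admissible_shift P R k (L k) S) \<and>
        (\<forall>S D. (\<forall>k\<in>K. admissible_shift P R k (L k) (S k)) \<and>
               ((\<forall>k\<in>K. min_distance_decoder k (lattice_code P R k (L k) (S k)) (D k)) \<or>
                (\<forall>k\<in>K. min_distance_decoder k (shifted_lattice P R k (L k) (S k)) (D k))) \<longrightarrow>
           vanishes_along K (\<lambda>k. error_prob M H W k (lattice_code P R k (L k) (S k)) (D k)) \<and>
           vanishes_exponentially_along K
             (\<lambda>k. error_prob M H W k (lattice_code P R k (L k) (S k)) (D k)))) \<and>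
     integrable M (\<lambda>\<omega>. log_det_gram P (G \<omega>)) \<and>
     (\<integral>\<omega>. log_det_gram P (G \<omega>) \<partial>M) =
       real CARD('n) * log 2 (P / real CARD('n) *
         exp (1 / real CARD('n) *
              (\<Sum>i = CARD('r) - CARD('n) + 1..CARD('r). Digamma (real i))))"
proof -
  let ?n = "CARD('n)" and ?\<psi> = "gram_log_mean CARD('n) CARD('r)"
  note le = assms(1) and M = assms(2) and P = assms(13)
  have L: "\<And>k. k \<in> K \<Longrightarrow> is_lattice k (2 * (?n\<^sup>2 * k)) (L k)"
    using assms(9) by (simp add: mult.assoc)
  have CL: "\<And>k. k \<in> K \<Longrightarrow> lattice_vol k (2 * (?n\<^sup>2 * k)) (L k) powr (1 / real (?n\<^sup>2 * k)) \<le> C\<^sub>L"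
    using assms(12) by (simp add: mult.assoc)
  have k0: "k > 0" if "k \<in> K" for k using that assms(8) by (cases "k = 0") auto
  note int = log_det_gram_integral[OF M assms(6) le P]
  have "(\<forall>k\<in>K. \<exists>S. admissible_shift P R k (L k) S) \<and>
        (\<forall>S D. (\<forall>k\<in>K. admissible_shift P R k (L k) (S k)) \<and>
               ((\<forall>k\<in>K. min_distance_decoder k (lattice_code P R k (L k) (S k)) (D k)) \<or>
                (\<forall>k\<in>K. min_distance_decoder k (shifted_lattice P R k (L k) (S k)) (D k))) \<longrightarrow>
           vanishes_along K (\<lambda>k. error_prob M H W k (lattice_code P R k (L k) (S k)) (D k)) \<and>
           vanishes_exponentially_along K
             (\<lambda>k. error_prob M H W k (lattice_code P R k (L k) (S k)) (D k)))"
    if R: "R < (\<integral>\<omega>. log_det_gram P (G \<omega>) \<partial>M) - real ?n * log 2 C\<^sub>L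
              + real ?n * log 2 (pi * exp 1 / (4 * real ?n))" for R
  proof (intro conjI ballI allI impI)
    show "\<exists>S. admissible_shift P R k (L k) S" if "k \<in> K" for k
      by (rule admissible_shift_exists[OF L[OF that] k0[OF that] P])
  next
    fix S and D :: "nat \<Rightarrow> (nat \<Rightarrow> complex^'n^'r) \<times> (nat \<Rightarrow> complex^'n^'r) \<Rightarrow> 'n multiblock"
    assume SD: "(\<forall>k\<in>K. admissible_shift P R k (L k) (S k)) \<and>
               ((\<forall>k\<in>K. min_distance_decoder k (lattice_code P R k (L k) (S k)) (D k)) \<or>
                (\<forall>k\<in>K. min_distance_decoder k (shifted_lattice P R k (L k) (S k)) (D k)))"
    let ?p = "\<lambda>k. error_prob M H W k (lattice_code P R k (L k) (S k)) (D k)"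
    obtain \<epsilon> t \<rho> :: real where e: "\<epsilon> > 0" "0 \<le> t" "t < 1" "0 < \<rho>" "\<rho> < 1" and
      ev: "\<forall>\<^sub>F k in inf at_top (principal K).
        exp (- t * (real ?n * real k * (code_scale P R k (L k))\<^sup>2 * exp ((?\<psi> - \<epsilon>) / real ?n) / 4)) *
        (1 - t) powr (- real (?n\<^sup>2 * k)) \<le> \<rho> ^ k"
      by (rule achievable_rate_exponent[OF assms(8) L assms(11) CL P R[unfolded int(2)]])
    \<comment> \<open>\<open>u\<close> is chosen after \<open>\<epsilon>\<close>, making a
      determinant product below \<open>exp (k * (?\<psi> - \<epsilon>))\<close> exponentially
      unlikely. Neither of them depends on \<open>k\<close>.\<close>
    obtain u where u: "0 < u" "u < 1" "gram_moment ?n CARD('r) u * exp (u * (?\<psi> - \<epsilon>)) < 1"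
      by (rule gram_moment_chernoff[OF le e(1)])
    have bound: "?p k \<le> (gram_moment ?n CARD('r) u * exp (u * (?\<psi> - \<epsilon>))) ^ k +
        exp (- t * (real ?n * real k * (code_scale P R k (L k))\<^sup>2 * exp ((?\<psi> - \<epsilon>) / real ?n) / 4)) *
        (1 - t) powr (- real (?n\<^sup>2 * k))" if k: "k \<in> K" for k
    proof -
      let ?C = "lattice_code P R k (L k) (S k)" and ?S = "shifted_lattice P R k (L k) (S k)"
      have sub: "?C \<subseteq> ?S" by (auto simp: lattice_code_def)
      \<comment> \<open>\<open>A\<close> is the code for maximum likelihood and the whole shifted
        lattice for naive lattice decoding.\<close>
      obtain A where "?C \<subseteq> A" "A \<subseteq> ?S" "min_distance_decoder k A (D k)"
        using SD k sub by blast
      moreover have "admissible_shift P R k (L k) (S k)" using SD k by blast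
      ultimately show ?thesis
        using code_scale_power(1)[OF L[OF k] k0[OF k] P, of R] assms(10)[OF k]
        by (intro error_prob_bound[OF M assms(3-5) le u(1,2) e(2,3) k0[OF k] L[OF k]])
    qed
    have "gram_moment ?n CARD('r) u * exp (u * (?\<psi> - \<epsilon>)) > 0"
      using gram_moment_props(3)[OF le u(2)] by simp
    moreover have "\<forall>\<^sub>F k in inf at_top (principal K).
        ?p k \<le> (gram_moment ?n CARD('r) u * exp (u * (?\<psi> - \<epsilon>))) ^ k + \<rho> ^ k"
      using ev unfolding eventually_inf_principal
      by eventually_elim (use bound in force)
    ultimately show ex: "vanishes_exponentially_along K ?p"
      using u(3) e(4,5) by (intro vanishes_exponentially_alongI)
    show "vanishes_along K ?p"
      by (rule vanishes_exponentially_along_imp_vanishes[OF _ ex]) (simp add: error_prob_def)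
  qed
  moreover have "real ?n * log 2 (P / real ?n) + ?\<psi> / ln 2 =
      real ?n * log 2 (P / real ?n * exp (1 / real ?n * (\<Sum>i = CARD('r) - ?n + 1..CARD('r). Digamma (real i))))"
    using P unfolding gram_log_mean_eq[OF le]
    by (subst log_mult) (auto simp: log_def distrib_left)
  ultimately show ?thesis using int by auto
qed

end
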